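(* Let $\mathbb{F}$ be a finite field. Suppose $\mathcal{A}$ is a dynamic algorithm that, for any matrix formula $f$ over $\mathbb{F}$, maintains $\det(g(\mathbf{M}_1,\dots,\mathbf{M}_p,\mathbf{P},\mathbf{Q},\mathbf{R}_k))$, where $g=\mathbf{P}f(\mathbf{M}_1,\dots,\mathbf{M}_p)\mathbf{Q}+\mathbf{R}_k$, while supporting either rank-1 updates, column updates, row updates, or entry updates to the input matrices $\mathbf{M}_1,\dots,\mathbf{M}_p$ in worst-case time $\mathcal{U}$, where $\mathcal{A}$ is allowed to stop supporting new updates once $\det(g(\mathbf{M}_1,\dots,\mathbf{M}_p,\mathbf{P},\mathbf{Q},\mathbf{R}_k))=0$. Then there exists a dynamic rank algorithm $\mathcal{B}$ that maintains $\operatorname{rank}(f(\mathbf{M}_1,\dots,\mathbf{M}_p))$ while supporting the same types of updates in worst-case time $\mathcal{U}$.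
   Context: A matrix formula is a rooted tree whose leaves are the input matrices (each used once) and whose internal nodes are matrix addition, subtraction, multiplication or inversion; here $f(\mathbf{M}_1,\dots,\mathbf{M}_p)\in\mathbb{F}^{n\times n}$. $\mathbf{P}$ is the $3n\times n$ matrix with $\mathbf{P}_{i,i}=1$ for $i\le n$ and $0$ elsewhere; $\mathbf{Q}$ is the $n\times 3n$ matrix with $\mathbf{Q}_{i,i}=1$ for $i\le n$ and $0$ elsewhere; $\mathbf{R}_k=\begin{bmatrix}\mathbf{0}&\mathbf{X}&\mathbf{0}\\ \mathbf{Y}&\mathbf{0}&\mathbf{I}_n\\ \mathbf{0}&\mathbf{I}_n&\mathbf{I}_k\end{bmatrix}$, where $\mathbf{X},\mathbf{Y}$ are $n\times n$ matrices with entries chosen independently uniformly at random from an extension field $\mathbb{F}^{ex}$ of $\mathbb{F}$, $\mathbf{I}_n$ is the identity and $\mathbf{I}_k$ ($0\le k\le n$) is the $n\times n$ diagonal matrix with ones in the first $k$ diagonal positions and zeros elsewhere. Entry updates to $\mathbf{R}_k$ (changing $k$) are also available to $\mathcal{A}$ as entry updates of an input of the formula $g$. *)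

theory Defs
  imports
    "HOL-Probability.Product_PMF"
    "HOL-Library.More_List"
    "Jordan_Normal_Form.Gauss_Jordan_Elimination"
    "Jordan_Normal_Form.DL_Rank"
begin

section \<open>Finite fields and their extensions\<close>

text \<open>The base field and its extension fields are finite subfields of one ambient field, the type
  \<open>'a\<close> (for instance an algebraic closure). This way the extension may vary inside a formula.\<close>

definition finite_subfield :: "'a::field set \<Rightarrow> bool" where
  "finite_subfield F \<longleftrightarrow> finite F \<and> 0 \<in> F \<and> 1 \<in> F \<and>
     (\<forall>x\<in>F. \<forall>y\<in>F. x + y \<in> F \<and> x * y \<in> F) \<and> (\<forall>x\<in>F. - x \<in> F \<and> inverse x \<in> F)"

definition extension_field :: "'a::field set \<Rightarrow> 'a set \<Rightarrow> bool" where
  "extension_field F E \<longleftrightarrow> finite_subfield E \<and> F \<subseteq> E"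


section \<open>Matrix formulas\<close>

text \<open>\<open>Leaf l\<close> refers to the input matrix with (0-based) index \<open>l\<close>.\<close>

datatype mformula =
    Leaf nat
  | Add mformula mformula
  | Sub mformula mformula
  | Mul mformula mformula
  | Inv mformula

fun leaves :: "mformula \<Rightarrow> nat list" where
  "leaves (Leaf l) = [l]"
| "leaves (Add a b) = leaves a @ leaves b"
| "leaves (Sub a b) = leaves a @ leaves b"
| "leaves (Mul a b) = leaves a @ leaves b"
| "leaves (Inv a) = leaves a"

text \<open>Dimensions of the result, given the dimensions of the inputs; \<open>None\<close> if ill-typed.\<close>

fun fdims :: "(nat \<times> nat) list \<Rightarrow> mformula \<Rightarrow> (nat \<times> nat) option" where
  "fdims ds (Leaf l) = (if l < length ds then Some (ds ! l) else None)"
| "fdims ds (Add a b) = (case (fdims ds a, fdims ds b) of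
     (Some d, Some e) \<Rightarrow> if d = e then Some d else None | _ \<Rightarrow> None)"
| "fdims ds (Sub a b) = (case (fdims ds a, fdims ds b) of
     (Some d, Some e) \<Rightarrow> if d = e then Some d else None | _ \<Rightarrow> None)"
| "fdims ds (Mul a b) = (case (fdims ds a, fdims ds b) of
     (Some (r, c), Some (r', c')) \<Rightarrow> if c = r' then Some (r, c') else None | _ \<Rightarrow> None)"
| "fdims ds (Inv a) = (case fdims ds a of
     Some (r, c) \<Rightarrow> if r = c then Some (r, c) else None | None \<Rightarrow> None)"

text \<open>Value of a formula; \<open>None\<close> if a singular matrix would have to be inverted.\<close>

fun feval :: "'a::field mat list \<Rightarrow> mformula \<Rightarrow> 'a mat option" where
  "feval Ms (Leaf l) = (if l < length Ms then Some (Ms ! l) else None)"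
| "feval Ms (Add a b) = (case (feval Ms a, feval Ms b) of
     (Some A, Some B) \<Rightarrow> Some (A + B) | _ \<Rightarrow> None)"
| "feval Ms (Sub a b) = (case (feval Ms a, feval Ms b) of
     (Some A, Some B) \<Rightarrow> Some (A - B) | _ \<Rightarrow> None)"
| "feval Ms (Mul a b) = (case (feval Ms a, feval Ms b) of
     (Some A, Some B) \<Rightarrow> Some (A * B) | _ \<Rightarrow> None)"
| "feval Ms (Inv a) = (case feval Ms a of Some A \<Rightarrow> mat_inverse A | None \<Rightarrow> None)"

text \<open>\<open>matrix_formula ds f n\<close>: over inputs with dimensions \<open>ds\<close>, each used exactly once, the
  formula \<open>f\<close> denotes an \<open>n \<times> n\<close> matrix.\<close>

definition matrix_formula :: "(nat \<times> nat) list \<Rightarrow> mformula \<Rightarrow> nat \<Rightarrow> bool" where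
  "matrix_formula ds f n \<longleftrightarrow>
     distinct (leaves f) \<and> set (leaves f) = {..<length ds} \<and>
     (\<forall>(r, c)\<in>set ds. 0 < r \<and> 0 < c) \<and> fdims ds f = Some (n, n)"

definition inputs_over :: "'a set \<Rightarrow> (nat \<times> nat) list \<Rightarrow> 'a mat list \<Rightarrow> bool" where
  "inputs_over F ds Ms \<longleftrightarrow>
     map (\<lambda>M. (dim_row M, dim_col M)) Ms = ds \<and> (\<forall>M\<in>set Ms. elements_mat M \<subseteq> F)"


section \<open>The formula $g = P f Q + R_k$\<close>

definition P_mat :: "nat \<Rightarrow> 'a::field mat" where
  "P_mat n = mat (3 * n) n (\<lambda>(i, j). if i = j then 1 else 0)"

definition Q_mat :: "nat \<Rightarrow> 'a::field mat" where
  "Q_mat n = mat n (3 * n) (\<lambda>(i, j). if i = j then 1 else 0)"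

definition partial_id :: "nat \<Rightarrow> nat \<Rightarrow> 'a::field mat" where
  "partial_id n k = mat n n (\<lambda>(i, j). if i = j \<and> i < k then 1 else 0)"

definition R_mat :: "nat \<Rightarrow> 'a::field mat \<Rightarrow> 'a mat \<Rightarrow> nat \<Rightarrow> 'a mat" where
  "R_mat n X Y k = mat (3 * n) (3 * n) (\<lambda>(i, j).
     [[0\<^sub>m n n, X,       0\<^sub>m n n],
      [Y,       0\<^sub>m n n, 1\<^sub>m n],
      [0\<^sub>m n n, 1\<^sub>m n,   partial_id n k]]
     ! (i div n) ! (j div n) $$ (i mod n, j mod n))"

text \<open>For a formula with \<open>p\<close> inputs, the matrices \<open>P\<close>, \<open>Q\<close>, \<open>R\<^sub>k\<close> become the inputs with indices
  \<open>p\<close>, \<open>p + 1\<close>, \<open>p + 2\<close>.\<close>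

definition g_formula :: "nat \<Rightarrow> mformula \<Rightarrow> mformula" where
  "g_formula p f = Add (Mul (Mul (Leaf p) f) (Leaf (p + 1))) (Leaf (p + 2))"

definition g_dims :: "(nat \<times> nat) list \<Rightarrow> nat \<Rightarrow> (nat \<times> nat) list" where
  "g_dims ds n = ds @ [(3 * n, n), (n, 3 * n), (3 * n, 3 * n)]"

definition g_inputs :: "nat \<Rightarrow> 'a::field mat \<Rightarrow> 'a mat \<Rightarrow> 'a mat list \<Rightarrow> nat \<Rightarrow> 'a mat list" where
  "g_inputs n X Y Ms k = Ms @ [P_mat n, Q_mat n, R_mat n X Y k]"

definition g_det ::
  "mformula \<Rightarrow> nat \<Rightarrow> 'a::field mat \<Rightarrow> 'a mat \<Rightarrow> 'a mat list \<Rightarrow> nat \<Rightarrow> 'a" where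
  "g_det f n X Y Ms k =
     Determinant.det (the (feval (g_inputs n X Y Ms k) (g_formula (length Ms) f)))"


section \<open>Updates\<close>

text \<open>The first argument is the index of the updated input. A rank-1 update adds \<open>u v\<^sup>T\<close>; column,
  row and entry updates overwrite the given column, row or entry.\<close>

datatype update_kind = RankOne | Column | Row | Entry

datatype 'a update =
    Rank1_Upd nat "'a vec" "'a vec"
  | Col_Upd nat nat "'a vec"
  | Row_Upd nat nat "'a vec"
  | Entry_Upd nat nat nat 'a

fun upd_kind :: "'a update \<Rightarrow> update_kind" where
  "upd_kind (Rank1_Upd l u v) = RankOne"
| "upd_kind (Col_Upd l j v) = Column"
| "upd_kind (Row_Upd l i v) = Row"
| "upd_kind (Entry_Upd l i j a) = Entry"

definition change_mat :: "'a mat \<Rightarrow> (nat \<Rightarrow> nat \<Rightarrow> 'a \<Rightarrow> 'a) \<Rightarrow> 'a mat" where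
  "change_mat M h = mat (dim_row M) (dim_col M) (\<lambda>(i, j). h i j (M $$ (i, j)))"

fun apply_upd :: "'a::field update \<Rightarrow> 'a mat list \<Rightarrow> 'a mat list" where
  "apply_upd (Rank1_Upd l u v) Ms =
     Ms[l := change_mat (Ms ! l) (\<lambda>i j a. a + vec_index u i * vec_index v j)]"
| "apply_upd (Col_Upd l j' v) Ms =
     Ms[l := change_mat (Ms ! l) (\<lambda>i j a. if j = j' then vec_index v i else a)]"
| "apply_upd (Row_Upd l i' v) Ms =
     Ms[l := change_mat (Ms ! l) (\<lambda>i j a. if i = i' then vec_index v j else a)]"
| "apply_upd (Entry_Upd l i' j' b) Ms =
     Ms[l := change_mat (Ms ! l) (\<lambda>i j a. if i = i' \<and> j = j' then b else a)]"

fun valid_upd :: "'a set \<Rightarrow> 'a mat list \<Rightarrow> 'a update \<Rightarrow> bool" where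
  "valid_upd F Ms (Rank1_Upd l u v) \<longleftrightarrow> l < length Ms \<and>
     dim_vec u = dim_row (Ms ! l) \<and> dim_vec v = dim_col (Ms ! l) \<and> vec_set u \<subseteq> F \<and> vec_set v \<subseteq> F"
| "valid_upd F Ms (Col_Upd l j v) \<longleftrightarrow> l < length Ms \<and>
     j < dim_col (Ms ! l) \<and> dim_vec v = dim_row (Ms ! l) \<and> vec_set v \<subseteq> F"
| "valid_upd F Ms (Row_Upd l i v) \<longleftrightarrow> l < length Ms \<and>
     i < dim_row (Ms ! l) \<and> dim_vec v = dim_col (Ms ! l) \<and> vec_set v \<subseteq> F"
| "valid_upd F Ms (Entry_Upd l i j a) \<longleftrightarrow> l < length Ms \<and>
     i < dim_row (Ms ! l) \<and> j < dim_col (Ms ! l) \<and> a \<in> F"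

text \<open>Update sequences for \<open>f\<close>: updates of the kinds in \<open>K\<close> with values in \<open>F\<close>, such that \<open>f\<close> stays
  defined.\<close>

inductive f_run ::
  "'a::field set \<Rightarrow> update_kind set \<Rightarrow> mformula \<Rightarrow> 'a mat list \<Rightarrow> 'a update list \<Rightarrow> 'a mat list \<Rightarrow> bool"
  for F K f Ms where
  f_run_Nil: "feval Ms f \<noteq> None \<Longrightarrow> f_run F K f Ms [] Ms"
| f_run_snoc: "\<lbrakk>f_run F K f Ms us Ms'; valid_upd F Ms' u; upd_kind u \<in> K;
     feval (apply_upd u Ms') f \<noteq> None\<rbrakk> \<Longrightarrow> f_run F K f Ms (us @ [u]) (apply_upd u Ms')"

text \<open>Update sequences for \<open>g\<close>: in addition, \<open>k\<close> can be increased or decreased by one through an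
  entry update of \<open>R\<^sub>k\<close>. The premise on \<open>g_det\<close> in each step case says that a further update is only
  made while the current determinant is nonzero; the last determinant may be zero.\<close>

inductive g_run ::
  "'a::field set \<Rightarrow> update_kind set \<Rightarrow> mformula \<Rightarrow> nat \<Rightarrow> 'a mat \<Rightarrow> 'a mat \<Rightarrow>
   'a mat list \<Rightarrow> nat \<Rightarrow> 'a update list \<Rightarrow> 'a mat list \<Rightarrow> nat \<Rightarrow> bool"
  for F K f n X Y Ms k where
  g_run_Nil: "feval Ms f \<noteq> None \<Longrightarrow> g_run F K f n X Y Ms k [] Ms k"
| g_run_upd: "\<lbrakk>g_run F K f n X Y Ms k us Ms' k'; g_det f n X Y Ms' k' \<noteq> 0;
     valid_upd F Ms' u; upd_kind u \<in> K; feval (apply_upd u Ms') f \<noteq> None\<rbrakk> \<Longrightarrow>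
     g_run F K f n X Y Ms k (us @ [u]) (apply_upd u Ms') k'"
| g_run_inc: "\<lbrakk>g_run F K f n X Y Ms k us Ms' k'; g_det f n X Y Ms' k' \<noteq> 0; k' < n\<rbrakk> \<Longrightarrow>
     g_run F K f n X Y Ms k
       (us @ [Entry_Upd (length Ms + 2) (2 * n + k') (2 * n + k') 1]) Ms' (k' + 1)"
| g_run_dec: "\<lbrakk>g_run F K f n X Y Ms k us Ms' (k' + 1); g_det f n X Y Ms' (k' + 1) \<noteq> 0\<rbrakk> \<Longrightarrow>
     g_run F K f n X Y Ms k
       (us @ [Entry_Upd (length Ms + 2) (2 * n + k') (2 * n + k') 0]) Ms' k'"


section \<open>Machine model\<close>

text \<open>A unit-cost algebraic random access machine with one memory for integers (also used as
  addresses) and one for field elements, read-only input, and a read-only random tape of field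
  elements. As usual for unit-cost machines with unbounded integers, integer arithmetic is limited
  to addition and (truncated) subtraction. The numeric operands of an instruction are cell
  addresses, except for the literals of \<open>NLit\<close> and \<open>FLit\<close>; division of field elements by zero
  yields zero.\<close>

datatype farith = FPlus | FMinus | FTimes | FDivide

datatype 'a instr =
    NLit nat nat | NAdd nat nat nat | NSub nat nat nat
  | NLoad nat nat | NStore nat nat | NInput nat nat
  | FLit nat 'a | FOp farith nat nat nat
  | FLoad nat nat | FStore nat nat | FInput nat nat | FRandom nat nat

datatype cond = NLess nat nat | NEq nat nat | FEq nat nat

datatype 'a com =
    Instr "'a instr"
  | Seq "'a com" "'a com"
  | If cond "'a com" "'a com"
  | While cond "'a com"

record 'a state =
  nmem :: "nat \<Rightarrow> nat"
  fmem :: "nat \<Rightarrow> 'a"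

record 'a input =
  nin :: "nat \<Rightarrow> nat"
  fin :: "nat \<Rightarrow> 'a"
  rnd :: "nat \<Rightarrow> 'a"

definition blank :: "'a::zero state" where
  "blank = \<lparr>nmem = (\<lambda>_. 0), fmem = (\<lambda>_. 0)\<rparr>"

fun apply_farith :: "farith \<Rightarrow> 'a::field \<Rightarrow> 'a \<Rightarrow> 'a" where
  "apply_farith FPlus x y = x + y"
| "apply_farith FMinus x y = x - y"
| "apply_farith FTimes x y = x * y"
| "apply_farith FDivide x y = x / y"

fun step :: "'a::field input \<Rightarrow> 'a instr \<Rightarrow> 'a state \<Rightarrow> 'a state" where
  "step inp (NLit d c) s = s\<lparr>nmem := (nmem s)(d := c)\<rparr>"
| "step inp (NAdd d a b) s = s\<lparr>nmem := (nmem s)(d := nmem s a + nmem s b)\<rparr>"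
| "step inp (NSub d a b) s = s\<lparr>nmem := (nmem s)(d := nmem s a - nmem s b)\<rparr>"
| "step inp (NLoad d a) s = s\<lparr>nmem := (nmem s)(d := nmem s (nmem s a))\<rparr>"
| "step inp (NStore d a) s = s\<lparr>nmem := (nmem s)(nmem s d := nmem s a)\<rparr>"
| "step inp (NInput d a) s = s\<lparr>nmem := (nmem s)(d := nin inp (nmem s a))\<rparr>"
| "step inp (FLit d c) s = s\<lparr>fmem := (fmem s)(d := c)\<rparr>"
| "step inp (FOp h d a b) s = s\<lparr>fmem := (fmem s)(d := apply_farith h (fmem s a) (fmem s b))\<rparr>"
| "step inp (FLoad d a) s = s\<lparr>fmem := (fmem s)(d := fmem s (nmem s a))\<rparr>"
| "step inp (FStore d a) s = s\<lparr>fmem := (fmem s)(nmem s d := fmem s a)\<rparr>"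
| "step inp (FInput d a) s = s\<lparr>fmem := (fmem s)(d := fin inp (nmem s a))\<rparr>"
| "step inp (FRandom d a) s = s\<lparr>fmem := (fmem s)(d := rnd inp (nmem s a))\<rparr>"

fun holds :: "cond \<Rightarrow> 'a state \<Rightarrow> bool" where
  "holds (NLess a b) s \<longleftrightarrow> nmem s a < nmem s b"
| "holds (NEq a b) s \<longleftrightarrow> nmem s a = nmem s b"
| "holds (FEq a b) s \<longleftrightarrow> fmem s a = fmem s b"

text \<open>\<open>exec inp c s t s'\<close>: started in \<open>s\<close>, the program \<open>c\<close> halts in \<open>s'\<close> after exactly \<open>t\<close> steps.\<close>

inductive exec :: "'a::field input \<Rightarrow> 'a com \<Rightarrow> 'a state \<Rightarrow> nat \<Rightarrow> 'a state \<Rightarrow> bool" for inp where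
  exec_Instr: "exec inp (Instr i) s 1 (step inp i s)"
| exec_Seq: "\<lbrakk>exec inp c s t s'; exec inp c' s' t' s''\<rbrakk> \<Longrightarrow> exec inp (Seq c c') s (t + t') s''"
| exec_If_True: "\<lbrakk>holds b s; exec inp c s t s'\<rbrakk> \<Longrightarrow> exec inp (If b c c') s (t + 1) s'"
| exec_If_False: "\<lbrakk>\<not> holds b s; exec inp c' s t s'\<rbrakk> \<Longrightarrow> exec inp (If b c c') s (t + 1) s'"
| exec_While_False: "\<not> holds b s \<Longrightarrow> exec inp (While b c) s 1 s"
| exec_While_True: "\<lbrakk>holds b s; exec inp c s t s'; exec inp (While b c) s' t' s''\<rbrakk> \<Longrightarrow>
     exec inp (While b c) s (t + t' + 1) s''"


section \<open>Dynamic algorithms\<close>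

text \<open>Input encodings. An instance is encoded as the dimension \<open>N\<close> of the (square) result, the
  number of inputs, the length of the formula, the input dimensions, and the formula in prefix
  notation; the entries of the inputs are listed row by row as field elements.\<close>

fun tokens :: "mformula \<Rightarrow> nat list" where
  "tokens (Leaf l) = [l + 4]"
| "tokens (Add a b) = 0 # tokens a @ tokens b"
| "tokens (Sub a b) = 1 # tokens a @ tokens b"
| "tokens (Mul a b) = 2 # tokens a @ tokens b"
| "tokens (Inv a) = 3 # tokens a"

definition init_input :: "(nat \<Rightarrow> 'a) \<Rightarrow> nat \<Rightarrow> mformula \<Rightarrow> 'a::field mat list \<Rightarrow> 'a input" where
  "init_input \<omega> N f Ms = \<lparr>
     nin = nth_default 0 ([N, length Ms, length (tokens f)] @
             concat (map (\<lambda>M. [dim_row M, dim_col M]) Ms) @ tokens f),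
     fin = nth_default 0 (concat (concat (map mat_to_list Ms))),
     rnd = \<omega>\<rparr>"

text \<open>The length of this encoding.\<close>

definition instance_size :: "(nat \<times> nat) list \<Rightarrow> mformula \<Rightarrow> nat" where
  "instance_size ds f = 3 + 2 * length ds + length (tokens f) + (\<Sum>(r, c)\<leftarrow>ds. r * c)"

fun upd_nats :: "'a update \<Rightarrow> nat list" where
  "upd_nats (Rank1_Upd l u v) = [0, l]"
| "upd_nats (Col_Upd l j v) = [1, l, j]"
| "upd_nats (Row_Upd l i v) = [2, l, i]"
| "upd_nats (Entry_Upd l i j a) = [3, l, i, j]"

fun upd_elems :: "'a update \<Rightarrow> 'a list" where
  "upd_elems (Rank1_Upd l u v) = list_of_vec u @ list_of_vec v"
| "upd_elems (Col_Upd l j v) = list_of_vec v"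
| "upd_elems (Row_Upd l i v) = list_of_vec v"
| "upd_elems (Entry_Upd l i j a) = [a]"

definition upd_input :: "(nat \<Rightarrow> 'a) \<Rightarrow> 'a::field update \<Rightarrow> 'a input" where
  "upd_input \<omega> u = \<lparr>nin = nth_default 0 (upd_nats u), fin = nth_default 0 (upd_elems u), rnd = \<omega>\<rparr>"

text \<open>A dynamic algorithm is a pair of programs, for preprocessing and for a single update, working
  on the same memory. \<open>alg_run D \<omega> N f Ms a b us s\<close>: on random tape \<open>\<omega>\<close>, preprocessing of the
  instance takes at most \<open>a\<close> steps, each of the updates \<open>us\<close> takes at most \<open>b\<close> steps, and the final
  memory is \<open>s\<close>.\<close>

record 'a dyn_alg =
  preprocess :: "'a com"
  process_upd :: "'a com"

inductive alg_run ::
  "'a::field dyn_alg \<Rightarrow> (nat \<Rightarrow> 'a) \<Rightarrow> nat \<Rightarrow> mformula \<Rightarrow> 'a mat list \<Rightarrow> nat \<Rightarrow> nat \<Rightarrow>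
   'a update list \<Rightarrow> 'a state \<Rightarrow> bool"
  for D \<omega> N f Ms a b where
  alg_run_init: "\<lbrakk>exec (init_input \<omega> N f Ms) (preprocess D) blank t s; t \<le> a\<rbrakk> \<Longrightarrow>
     alg_run D \<omega> N f Ms a b [] s"
| alg_run_upd: "\<lbrakk>alg_run D \<omega> N f Ms a b us s; exec (upd_input \<omega> u) (process_upd D) s t s'; t \<le> b\<rbrakk> \<Longrightarrow>
     alg_run D \<omega> N f Ms a b (us @ [u]) s'"

text \<open>Programs over \<open>F\<close> only use constants from \<open>F\<close>.\<close>

definition alg_over :: "'a set \<Rightarrow> 'a dyn_alg \<Rightarrow> bool" where
  "alg_over F D \<longleftrightarrow> set_com (preprocess D) \<subseteq> F \<and> set_com (process_upd D) \<subseteq> F"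

text \<open>\<open>maintains_g_det F E K D I U\<close>: for every matrix formula \<open>f\<close>, the deterministic algorithm \<open>D\<close>,
  run on the formula \<open>g\<close>, maintains the determinant of \<open>g\<close> in field cell \<open>0\<close>, for all matrices \<open>X\<close>,
  \<open>Y\<close> over the extension field \<open>E n\<close>. The preprocessing time \<open>I\<close> and the worst-case update time \<open>U\<close>
  depend on the formula and the dimensions of its inputs.\<close>

definition maintains_g_det ::
  "'a::field set \<Rightarrow> (nat \<Rightarrow> 'a set) \<Rightarrow> update_kind set \<Rightarrow> 'a dyn_alg \<Rightarrow>
   (mformula \<Rightarrow> (nat \<times> nat) list \<Rightarrow> nat) \<Rightarrow> (mformula \<Rightarrow> (nat \<times> nat) list \<Rightarrow> nat) \<Rightarrow> bool" where
  "maintains_g_det F E K D I U \<longleftrightarrow> alg_over F D \<and>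
     (\<forall>f ds n X Y Ms k us Ms' k'.
        matrix_formula ds f n \<and> inputs_over F ds Ms \<and>
        X \<in> carrier_mat n n \<and> Y \<in> carrier_mat n n \<and>
        elements_mat X \<subseteq> E n \<and> elements_mat Y \<subseteq> E n \<and> k \<le> n \<and>
        g_run F K f n X Y Ms k us Ms' k' \<longrightarrow>
        (\<exists>s. alg_run D (\<lambda>_. 0) (3 * n) (g_formula (length Ms) f) (g_inputs n X Y Ms k)
               (I f ds) (U f ds) us s \<and>
             fmem s 0 = g_det f n X Y Ms' k'))"

text \<open>A random tape holding \<open>m\<close> independent uniformly random elements of \<open>E\<close>.\<close>

definition random_tape :: "'a::zero set \<Rightarrow> nat \<Rightarrow> (nat \<Rightarrow> 'a) pmf" where
  "random_tape E m = Pi_pmf {..<m} 0 (\<lambda>_. pmf_of_set E)"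

definition outputs_correct ::
  "'a::field set \<Rightarrow> update_kind set \<Rightarrow> 'a dyn_alg \<Rightarrow> nat \<Rightarrow> nat \<Rightarrow>
   (nat \<Rightarrow> 'a) \<Rightarrow> nat \<Rightarrow> mformula \<Rightarrow> 'a mat list \<Rightarrow> 'a update list \<Rightarrow> bool" where
  "outputs_correct F K D a b \<omega> n f Ms us \<longleftrightarrow>
     (\<forall>i \<le> length us. \<forall>Ms'. f_run F K f Ms (take i us) Ms' \<longrightarrow>
        (\<exists>s. alg_run D \<omega> n f Ms a b (take i us) s \<and>
             nmem s 0 = vec_space.rank n (the (feval Ms' f))))"

text \<open>\<open>maintains_rank F E K D I U\<close>: for every matrix formula \<open>f\<close>, the randomized algorithm \<open>D\<close>
  maintains the rank of \<open>f\<close> in integer cell \<open>0\<close>. It uses \<open>2 n\<^sup>2\<close> random elements of \<open>E n\<close>, the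
  number of entries of \<open>X\<close> and \<open>Y\<close>. The time bounds hold for all random choices. For each sequence
  of \<open>T\<close> updates, the probability that any of the \<open>T + 1\<close> outputs is wrong is at most
  \<open>2 n (T + 1) / |E n|\<close>, a union bound with \<open>2 n / |E n|\<close> per output, where \<open>2 n\<close> is the
  Schwartz--Zippel degree bound for the determinant of \<open>g\<close> as a polynomial in the entries of \<open>X\<close>, \<open>Y\<close>.
  So all outputs are correct with high probability if \<open>|E n|\<close> is large compared to \<open>n T\<close>.\<close>

definition maintains_rank ::
  "'a::field set \<Rightarrow> (nat \<Rightarrow> 'a set) \<Rightarrow> update_kind set \<Rightarrow> 'a dyn_alg \<Rightarrow>
   (mformula \<Rightarrow> (nat \<times> nat) list \<Rightarrow> nat) \<Rightarrow> (mformula \<Rightarrow> (nat \<times> nat) list \<Rightarrow> nat) \<Rightarrow> bool" where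
  "maintains_rank F E K D I U \<longleftrightarrow> alg_over F D \<and>
     (\<forall>f ds n Ms us Ms'.
        matrix_formula ds f n \<and> inputs_over F ds Ms \<and> f_run F K f Ms us Ms' \<longrightarrow>
        (\<forall>\<omega> \<in> set_pmf (random_tape (E n) (2 * n\<^sup>2)).
           \<exists>s. alg_run D \<omega> n f Ms (I f ds) (U f ds) us s) \<and>
        measure_pmf.prob (random_tape (E n) (2 * n\<^sup>2))
          {\<omega>. outputs_correct F K D (I f ds) (U f ds) \<omega> n f Ms us}
          \<ge> 1 - 2 * real n * (real (length us) + 1) / real (card (E n)))"

text \<open>The reduction runs the preprocessing for \<open>g\<close> with each of the \<open>n + 1\<close> values of \<open>k\<close>, after
  having written down the instance for \<open>g\<close>.\<close>

definition rank_preprocessing_time ::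
  "(mformula \<Rightarrow> (nat \<times> nat) list \<Rightarrow> nat) \<Rightarrow> mformula \<Rightarrow> (nat \<times> nat) list \<Rightarrow> nat" where
  "rank_preprocessing_time I f ds =
     (let n = fst (the (fdims ds f))
      in (n + 1) * (I f ds + instance_size (g_dims ds n) (g_formula (length ds) f)))"

end

theory Submission
  imports Defs
begin

text \<open>Let \<open>M\<close> be the value of \<open>f\<close>. Block elimination shows that \<open>g\<close> is invertible iff \<open>M + X I\<^sub>k Y\<close>, the
  sum of \<open>M\<close> and the rank-one matrices \<open>x\<^sub>j y\<^sub>j\<^sup>T\<close> for \<open>j < k\<close>, is. This needs \<open>k \<ge> n - rank M\<close>, and for
  random \<open>X\<close>, \<open>Y\<close> every summand raises the rank, until it is full, except with probability \<open>2 / |E|\<close>. So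
  the rank can be read off the critical value \<open>k = n - rank M\<close>, the least one with a nonzero determinant.
  An update changes \<open>M\<close> by a matrix of rank at most one, so the critical \<open>k\<close> moves by at most one, and it
  is found with a constant number of updates of \<open>A\<close>. Since \<open>A\<close> need not continue after a zero
  determinant, it is simulated with a log of its memory writes, and the last update is undone whenever
  the determinant vanishes. If the rank drops, \<open>k\<close> has to be raised before the update, hence the
  determinant for the old \<open>M\<close> and \<open>k + 1\<close> must not vanish either; by the Sherman--Morrison formula this
  fails with probability at most \<open>1 / |E|\<close>, and \<open>2 k + 1 \<le> 2 n\<close> for \<open>k < n\<close>.\<close>

text \<open>Randomness enters only through one choice of \<open>X\<close> and \<open>Y\<close> at
  the start. The updates are fixed beforehand, so the matrices \<open>M\<close> met along the
  sequence do not depend on the tape, and a union bound over them suffices. The time bounds,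
  however, must hold for every tape in the support. Hence every determinant is tested before
  \<open>A\<close> is used again, and a zero where none should occur leads to the absorbing failure
  value \<open>k = n + 1\<close>. The log keeps undoing affordable in the worst case: a simulated
  step writes at most one cell, so a rollback costs at most a constant times the simulated time.
  Preprocessing uses the same log to return to blank memory between candidate values of
  \<open>k\<close>. The instance of \<open>g\<close> is not given as input. Its integers are
  produced on demand from registers and the real input; its field entries are tabulated for each
  tried \<open>k\<close>, with \<open>X\<close> and \<open>Y\<close> copied from the tape. The
  constant overhead per update is absorbed in \<open>C * U\<close>, because \<open>U\<close> is at
  least 1 whenever an update is possible.\<close>

unbundle no vec_syntax

section \<open>Linear algebra\<close>

subsection \<open>Rank-one perturbations\<close>

definition outer :: "nat \<Rightarrow> nat \<Rightarrow> (nat \<Rightarrow> 'a) \<Rightarrow> (nat \<Rightarrow> 'a) \<Rightarrow> 'a::field mat" where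
  "outer r c x y = mat r c (\<lambda>(i, j). x i * y j)"

lemma outer_carrier [simp]: "outer r c x y \<in> carrier_mat r c"
  by (simp add: outer_def)

lemma dim_outer [simp]: "dim_row (outer r c x y) = r" "dim_col (outer r c x y) = c"
  by (simp_all add: outer_def)

lemma index_outer [simp]: "i < r \<Longrightarrow> j < c \<Longrightarrow> outer r c x y $$ (i, j) = x i * y j"
  by (simp add: outer_def)

lemma rank_add_outer_le:
  assumes A: "(A :: 'a::field mat) \<in> carrier_mat n m"
  shows "vec_space.rank n (A + outer n m x y) \<le> vec_space.rank n A + 1"
proof -
  have "vec_space.rank n (A + outer n m x y)
      \<le> vec_space.rank n A + vec_space.rank n (outer n m x y)"
    by (rule vec_space.rank_subadditive[OF A outer_carrier])
  moreover have "vec_space.rank n (outer n m x y) \<le> 1"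
    by (rule vec_space.rank_le_1_product_entries[OF outer_carrier]) simp
  ultimately show ?thesis by linarith
qed

lemma rank_le_add_outer:
  assumes A: "(A :: 'a::field mat) \<in> carrier_mat n m"
  shows "vec_space.rank n A \<le> vec_space.rank n (A + outer n m x y) + 1"
proof -
  have "(A + outer n m x y) + outer n m (\<lambda>i. - x i) y = A"
    using A by (intro eq_matI) auto
  then show ?thesis
    using rank_add_outer_le[of "A + outer n m x y" n m "\<lambda>i. - x i" y] A by auto
qed

text \<open>If \<open>u\<close> and \<open>w\<close> span a left and a right kernel vector of \<open>A\<close>, then \<open>u x \<noteq> 0\<close> keeps \<open>x\<close> out of
  the column space of \<open>A\<close>, while \<open>y w \<noteq> 0\<close> puts \<open>x\<close> into the column space of \<open>A + x y\<^sup>T\<close>.\<close>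

lemma rank_add_outer_increase:
  assumes A: "(A :: 'a::field mat) \<in> carrier_mat n n"
    and u: "\<And>j. j < n \<Longrightarrow> (\<Sum>i<n. u i * A $$ (i, j)) = 0" and ux: "(\<Sum>i<n. u i * x i) \<noteq> 0"
    and w: "\<And>i. i < n \<Longrightarrow> (\<Sum>j<n. A $$ (i, j) * w j) = 0" and yw: "(\<Sum>j<n. w j * y j) \<noteq> 0"
  shows "vec_space.rank n A + 1 \<le> vec_space.rank n (A + outer n n x y)"
proof -
  interpret vec_space "TYPE('a)" n .
  let ?B = "A + outer n n x y" and ?x = "vec n x"
  have B: "?B \<in> carrier_mat n n" using A by simp
  let ?W = "span (set (cols ?B))"
  have Bcols: "set (cols ?B) \<subseteq> carrier_vec n" using cols_dim[of ?B] B by auto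
  have Acols: "set (cols A) \<subseteq> carrier_vec n" using cols_dim[of A] A by auto
  have inW: "?B *\<^sub>v v \<in> ?W" if "v \<in> carrier_vec n" for v
  proof -
    have "?B *\<^sub>v v \<in> col_space ?B"
      unfolding col_space_eq[OF B] using that B A by (auto intro!: mult_mat_vec_carrier)
    then show ?thesis by (simp add: col_space_def)
  qed
  have Bi: "(?B *\<^sub>v v) $ i = (A *\<^sub>v v) $ i + x i * (\<Sum>j<n. y j * v $ j)"
    if "v \<in> carrier_vec n" "i < n" for v i
    using that A
    by (simp add: scalar_prod_def lessThan_atLeast0 sum.distrib distrib_right sum_distrib_left mult.assoc)
  define c where "c = (\<Sum>j<n. w j * y j)"
  have xW: "?x \<in> ?W"
  proof -
    have "?B *\<^sub>v vec n (\<lambda>j. w j / c) = ?x"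
    proof (rule eq_vecI)
      fix i assume "i < dim_vec ?x"
      then have i: "i < n" by simp
      have "(A *\<^sub>v vec n (\<lambda>j. w j / c)) $ i = (\<Sum>j<n. A $$ (i, j) * w j) / c"
        using A i by (simp add: scalar_prod_def lessThan_atLeast0 sum_divide_distrib)
      moreover have "(\<Sum>j<n. y j * (w j / c)) = 1"
      proof -
        have "(\<Sum>j<n. y j * (w j / c)) = c / c"
          unfolding c_def sum_divide_distrib by (simp add: mult.commute)
        then show ?thesis using yw by (simp add: c_def)
      qed
      ultimately show "(?B *\<^sub>v vec n (\<lambda>j. w j / c)) $ i = ?x $ i"
        using Bi[of "vec n (\<lambda>j. w j / c)" i] i w[OF i] by simp
    qed (use A in simp)
    then show ?thesis using inW[of "vec n (\<lambda>j. w j / c)"] by simp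
  qed
  have AW: "col A j \<in> ?W" if j: "j < n" for j
  proof -
    have "col A j = ?B *\<^sub>v unit_vec n j + (- y j) \<cdot>\<^sub>v ?x"
    proof (rule eq_vecI)
      fix i assume "i < dim_vec (?B *\<^sub>v unit_vec n j + (- y j) \<cdot>\<^sub>v ?x)"
      then have i: "i < n" using A by simp
      have "(\<Sum>l<n. y l * unit_vec n j $ l) = y j"
        using j by (simp add: unit_vec_def if_distrib cong: if_cong)
      moreover have "(A *\<^sub>v unit_vec n j) $ i = A $$ (i, j)"
        using A i j by (simp add: scalar_prod_right_unit)
      ultimately show "col A j $ i = (?B *\<^sub>v unit_vec n j + (- y j) \<cdot>\<^sub>v ?x) $ i"
        using Bi[of "unit_vec n j" i] i j A by simp
    qed (use A in simp)
    moreover have "?B *\<^sub>v unit_vec n j \<in> ?W" by (rule inW) simp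
    moreover have "(- y j) \<cdot>\<^sub>v ?x \<in> ?W" by (rule smult_in_span[OF Bcols xW])
    ultimately show ?thesis using span_add1[OF Bcols] by simp
  qed
  \<comment> \<open>\<open>S\<close> is a basis of the column space of \<open>A\<close> drawn from
    its columns. It lies in the column space of \<open>?B\<close>, and the left kernel vector keeps
    \<open>?x\<close> out of its span; so \<open>S\<close> together with \<open>?x\<close> is
    independent there and has one element more.\<close>
  obtain S where S: "maximal S (\<lambda>T. T \<subseteq> set (cols A) \<and> lin_indpt T)" "finite S"
    using maximal_exists_superset[of "set (cols A)" "\<lambda>T. T \<subseteq> set (cols A) \<and> lin_indpt T" "{}"]
    by (auto simp: lin_dep_def)
  have rA: "rank A = card S" by (rule rank_card_indpt[OF A S(1)])
  have SA: "S \<subseteq> set (cols A)" and Sli: "lin_indpt S" using S(1) by (auto simp: maximal_def)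
  have Sc: "S \<subseteq> carrier_vec n" using SA Acols by auto
  have left0: "(\<Sum>i<n. u i * v $ i) = 0" if "v \<in> span S" for v
  proof -
    have "v \<in> col_space A" using that span_is_monotone[OF SA] by (auto simp: col_space_def)
    then obtain z where z: "z \<in> carrier_vec n" "v = A *\<^sub>v z"
      unfolding col_space_eq[OF A] using A by auto
    have "(\<Sum>i<n. u i * v $ i) = (\<Sum>i<n. \<Sum>j<n. u i * A $$ (i, j) * z $ j)"
      using z A by (simp add: scalar_prod_def lessThan_atLeast0 sum_distrib_left mult.assoc)
    also have "\<dots> = (\<Sum>j<n. (\<Sum>i<n. u i * A $$ (i, j)) * z $ j)"
      by (subst sum.swap) (simp add: sum_distrib_right)
    also have "\<dots> = 0" using u by simp
    finally show ?thesis .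
  qed
  have xS: "?x \<notin> span S" using left0[of ?x] ux by auto
  have "?x \<notin> S" using xS Sc in_own_span by auto
  then have li: "lin_indpt (S \<union> {?x})"
    using lin_dep_iff_in_span[of S ?x] Sc Sli xS by auto
  have sub: "S \<union> {?x} \<subseteq> ?W"
  proof -
    have "S \<subseteq> ?W" using SA AW A by (auto simp: cols_def)
    then show ?thesis using xW by auto
  qed
  have vsW: "vectorspace class_ring (vs ?W)"
    using Bcols span_is_subspace subspace_is_vs by auto
  have li': "LinearCombinations.module.lin_indpt class_ring (vs ?W) (S \<union> {?x})"
    using span_li_not_depend(2)[OF sub] li Bcols span_is_submodule by auto
  have "card (S \<union> {?x}) \<le> vectorspace.dim class_ring (vs ?W)"
  proof (rule vectorspace.li_le_dim(2)[OF vsW _ _ li'])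
    show "vectorspace.fin_dim class_ring (vs ?W)" by (rule fin_dim_span_cols[OF B])
  qed (use sub in simp)
  then show ?thesis
    using rA S(2) \<open>?x \<notin> S\<close> by (simp add: rank_def)
qed

text \<open>Vectors become functions read below \<open>n\<close>, so that kernel conditions are
  plain sums. This suits both the block splitting of \<open>g\<close> and the linear forms in tape
  cells.\<close>

lemma det_eq_0_iff_kernel:
  assumes A: "(A :: 'a::field mat) \<in> carrier_mat n n"
  shows "Determinant.det A = 0 \<longleftrightarrow>
    (\<exists>v. (\<exists>i<n. v i \<noteq> 0) \<and> (\<forall>i<n. (\<Sum>j<n. A $$ (i, j) * v j) = 0))" (is "_ \<longleftrightarrow> ?R")
proof -
  have Av: "(A *\<^sub>v v = 0\<^sub>v n) \<longleftrightarrow> (\<forall>i<n. (\<Sum>j<n. A $$ (i, j) * v $ j) = 0)"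
    if "v \<in> carrier_vec n" for v
    using A that by (auto simp: vec_eq_iff scalar_prod_def lessThan_atLeast0)
  have "Determinant.det A = 0 \<longleftrightarrow> (\<exists>v. v \<in> carrier_vec n \<and> v \<noteq> 0\<^sub>v n \<and> A *\<^sub>v v = 0\<^sub>v n)"
    by (rule det_0_iff_vec_prod_zero_field[OF A])
  also have "\<dots> \<longleftrightarrow> ?R"
  proof
    assume "\<exists>v. v \<in> carrier_vec n \<and> v \<noteq> 0\<^sub>v n \<and> A *\<^sub>v v = 0\<^sub>v n"
    then obtain v where v: "v \<in> carrier_vec n" "v \<noteq> 0\<^sub>v n" "A *\<^sub>v v = 0\<^sub>v n" by auto
    then have "\<exists>i<n. v $ i \<noteq> 0" by (auto simp: vec_eq_iff)
    then show ?R using v Av[OF v(1)] by (intro exI[of _ "\<lambda>i. v $ i"]) auto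
  next
    assume ?R
    then obtain v where v: "\<exists>i<n. v i \<noteq> 0" "\<forall>i<n. (\<Sum>j<n. A $$ (i, j) * v j) = 0" by auto
    then show "\<exists>v. v \<in> carrier_vec n \<and> v \<noteq> 0\<^sub>v n \<and> A *\<^sub>v v = 0\<^sub>v n"
      using A by (intro exI[of _ "vec n v"]) (auto simp: vec_eq_iff scalar_prod_def lessThan_atLeast0)
  qed
  finally show ?thesis .
qed

lemma det_eq_0_left_kernel:
  assumes A: "(A :: 'a::field mat) \<in> carrier_mat n n" and "Determinant.det A = 0"
  obtains u where "\<exists>i<n. u i \<noteq> 0" "\<And>j. j < n \<Longrightarrow> (\<Sum>i<n. u i * A $$ (i, j)) = 0"
proof -
  have "Determinant.det (transpose_mat A) = 0" using assms by (simp add: Determinant.det_transpose)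
  then obtain u where u: "\<exists>i<n. u i \<noteq> 0" "\<forall>i<n. (\<Sum>j<n. transpose_mat A $$ (i, j) * u j) = 0"
    using det_eq_0_iff_kernel[of "transpose_mat A" n] A by auto
  have "(\<Sum>i<n. u i * A $$ (i, j)) = 0" if "j < n" for j
    using u(2)[rule_format, OF that] that A by (simp add: mult.commute)
  then show thesis using u(1) that by blast
qed

subsection \<open>The determinant of $g$\<close>

text \<open>\<open>x\<close> and \<open>y\<close> are families of functions, so that one definition
  covers the columns of \<open>X\<close> with the rows of \<open>Y\<close> (\<open>col_fun\<close>,
  \<open>row_fun\<close>) and the corresponding cells of a random tape (\<open>tape_x\<close>,
  \<open>tape_y\<close>).\<close>

definition pert :: "nat \<Rightarrow> 'a::field mat \<Rightarrow> (nat \<Rightarrow> nat \<Rightarrow> 'a) \<Rightarrow> (nat \<Rightarrow> nat \<Rightarrow> 'a) \<Rightarrow> nat \<Rightarrow> 'a mat" where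
  "pert n M x y k = mat n n (\<lambda>(i, l). M $$ (i, l) + (\<Sum>j<k. x j i * y j l))"

lemma pert_carrier [simp]: "pert n M x y k \<in> carrier_mat n n"
  by (simp add: pert_def)

lemma pert_0: "M \<in> carrier_mat n n \<Longrightarrow> pert n M x y 0 = M"
  by (intro eq_matI) (auto simp: pert_def)

lemma pert_Suc: "pert n M x y (Suc k) = pert n M x y k + outer n n (x k) (y k)"
  by (intro eq_matI) (auto simp: pert_def add.assoc)

lemma rank_pert_le:
  "M \<in> carrier_mat n n \<Longrightarrow> vec_space.rank n (pert n M x y k) \<le> vec_space.rank n M + k"
proof (induction k)
  case (Suc k)
  then show ?case using rank_add_outer_le[OF pert_carrier, of n M x y k "x k" "y k"]
    by (simp add: pert_Suc)
qed (simp add: pert_0)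

lemma det_pert_eq_0:
  assumes "M \<in> carrier_mat n n" "vec_space.rank n M + k < n"
  shows "Determinant.det (pert n M x y k) = 0"
proof (rule ccontr)
  assume "Determinant.det (pert n M x y k) \<noteq> 0"
  then have "vec_space.rank n (pert n M x y k) = n"
    using vec_space.det_rank_iff[OF pert_carrier] by metis
  then show False using rank_pert_le[OF assms(1), of x y k] assms(2) by linarith
qed

section \<open>Values of matrix formulas: dependence on leaves, dimensions, entries\<close>

lemma feval_cong:
  assumes "\<And>l. l \<in> set (leaves f) \<Longrightarrow> l < length Ms \<and> l < length Ms' \<and> Ms ! l = Ms' ! l"
  shows "feval Ms f = feval Ms' f"
  using assms
proof (induction f)
  case (Add a b) show ?case using Add.IH Add.prems by (simp cong: option.case_cong)
next
  case (Sub a b) show ?case using Sub.IH Sub.prems by (simp cong: option.case_cong)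
next
  case (Mul a b) show ?case using Mul.IH Mul.prems by (simp cong: option.case_cong)
qed auto

lemma feval_carrier:
  assumes "map (\<lambda>M. (dim_row M, dim_col M)) Ms = ds" "fdims ds f = Some (r, c)" "feval Ms f = Some A"
  shows "(A :: 'a::field mat) \<in> carrier_mat r c"
  using assms
proof (induction f arbitrary: r c A)
  case (Leaf l)
  then show ?case by (auto split: if_splits)
next
  case (Add a b)
  obtain A1 B1 where e: "feval Ms a = Some A1" "feval Ms b = Some B1" "A = A1 + B1"
    using Add.prems by (auto split: option.splits)
  then show ?case using Add.IH(1)[OF _ _ e(1)] Add.IH(2)[OF _ _ e(2)] Add.prems
    by (auto split: option.splits if_splits)
next
  case (Sub a b)
  obtain A1 B1 where e: "feval Ms a = Some A1" "feval Ms b = Some B1" "A = A1 - B1"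
    using Sub.prems by (auto split: option.splits)
  then show ?case using Sub.IH(1)[OF _ _ e(1)] Sub.IH(2)[OF _ _ e(2)] Sub.prems
    by (auto split: option.splits if_splits)
next
  case (Mul a b)
  obtain A1 B1 where e: "feval Ms a = Some A1" "feval Ms b = Some B1" "A = A1 * B1"
    using Mul.prems by (auto split: option.splits)
  then show ?case using Mul.IH(1)[OF _ _ e(1)] Mul.IH(2)[OF _ _ e(2)] Mul.prems
    by (auto split: option.splits if_splits)
next
  case (Inv a)
  obtain A1 where e: "feval Ms a = Some A1" "mat_inverse A1 = Some A"
    using Inv.prems by (auto split: option.splits)
  obtain r1 where r1: "fdims ds a = Some (r1, r1)" "r = r1" "c = r1"
    using Inv.prems by (auto split: option.splits if_splits)
  show ?case using Inv.IH[OF Inv.prems(1) r1(1) e(1)] e(2) mat_inverse(2) r1 by blast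
qed

lemma elements_mat_subset_iff:
  "A \<in> carrier_mat r c \<Longrightarrow> elements_mat A \<subseteq> F \<longleftrightarrow> (\<forall>i<r. \<forall>j<c. A $$ (i, j) \<in> F)"
  by (auto dest!: elements_matD)

text \<open>Only inversion goes beyond ring operations on entries. There Cramer's rule writes each
  entry as a cofactor divided by the determinant, and both are Leibniz sums over \<open>F\<close>.
  The lemma serves \<open>U_pos\<close>, where a matrix built from the value of \<open>f\<close>
  must lie over the extension field.\<close>

lemma feval_over:
  fixes F :: "'a::field set"
  assumes "finite_subfield F" "map (\<lambda>M. (dim_row M, dim_col M)) Ms = ds"
    "\<forall>M\<in>set Ms. elements_mat M \<subseteq> F" "fdims ds f = Some (r, c)" "feval Ms f = Some A"
  shows "elements_mat A \<subseteq> F"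
proof -
  have F: "0 \<in> F" "1 \<in> F" "\<And>x y. x \<in> F \<Longrightarrow> y \<in> F \<Longrightarrow> x + y \<in> F" "\<And>x y. x \<in> F \<Longrightarrow> y \<in> F \<Longrightarrow> x * y \<in> F"
     "\<And>x. x \<in> F \<Longrightarrow> - x \<in> F" "\<And>x. x \<in> F \<Longrightarrow> inverse x \<in> F"
    using assms(1) by (auto simp: finite_subfield_def)
  have Fs: "sum h S \<in> F" if "\<And>i. i \<in> S \<Longrightarrow> h i \<in> F" for h :: "'b \<Rightarrow> 'a" and S
    using that by (induction S rule: infinite_finite_induct) (auto simp: F)
  have Fp: "prod h S \<in> F" if "\<And>i. i \<in> S \<Longrightarrow> h i \<in> F" for h :: "'b \<Rightarrow> 'a" and S
    using that by (induction S rule: infinite_finite_induct) (auto simp: F)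
  have Fpow: "(- 1) ^ k \<in> F" for k :: nat by (induction k) (auto simp: F intro: F(4)[of "-1", simplified])
  have Fd: "Determinant.det B \<in> F" if "elements_mat B \<subseteq> F" for B
  proof (cases "dim_row B = dim_col B")
    case True
    have "B $$ (i, j) \<in> F" if "i < dim_row B" "j < dim_row B" for i j
      by (rule subsetD[OF \<open>elements_mat B \<subseteq> F\<close>], rule elements_matI[of B "dim_row B" "dim_col B" i j])
        (use that True in \<open>auto intro: carrier_matI\<close>)
    moreover have "signof p \<in> F" for p :: "nat \<Rightarrow> nat" by (auto simp: sign_def F)
    moreover have "p i < dim_row B" if "p permutes {0..<dim_row B}" "i < dim_row B" for p i
      using that permutes_in_image[of p "{0..<dim_row B}" i] by auto
    ultimately show ?thesis
      unfolding Determinant.det_def using True by (auto intro!: Fs Fp F)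
  qed (simp add: Determinant.det_def F)
  show ?thesis
    using assms(4,5)
  proof (induction f arbitrary: r c A)
    case (Leaf l)
    then show ?case using assms(3) by (auto split: if_splits)
  next
    case (Add a b)
    obtain A1 B1 where e: "feval Ms a = Some A1" "feval Ms b = Some B1" "A = A1 + B1"
      using Add.prems by (auto split: option.splits)
    have d: "fdims ds a = Some (r, c)" "fdims ds b = Some (r, c)"
      using Add.prems by (auto split: option.splits if_splits)
    note c1 = feval_carrier[OF assms(2) d(1) e(1)] feval_carrier[OF assms(2) d(2) e(2)]
    have "x + y \<in> F" if "x \<in> F" "y \<in> F" for x y
      using F(3)[of x "y"] F(5) that by auto
    then show ?case
      using Add.IH(1)[OF d(1) e(1)] Add.IH(2)[OF d(2) e(2)] c1
      by (simp add: e(3) elements_mat_subset_iff[of _ r c])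
  next
    case (Sub a b)
    obtain A1 B1 where e: "feval Ms a = Some A1" "feval Ms b = Some B1" "A = A1 - B1"
      using Sub.prems by (auto split: option.splits)
    have d: "fdims ds a = Some (r, c)" "fdims ds b = Some (r, c)"
      using Sub.prems by (auto split: option.splits if_splits)
    note c1 = feval_carrier[OF assms(2) d(1) e(1)] feval_carrier[OF assms(2) d(2) e(2)]
    have "x - y \<in> F" if "x \<in> F" "y \<in> F" for x y
      using F(3)[of x "- y"] F(5) that by auto
    then show ?case
      using Sub.IH(1)[OF d(1) e(1)] Sub.IH(2)[OF d(2) e(2)] c1
      by (simp add: e(3) elements_mat_subset_iff[of _ r c] minus_carrier_mat)
  next
    case (Mul a b)
    obtain A1 B1 where e: "feval Ms a = Some A1" "feval Ms b = Some B1" "A = A1 * B1"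
      using Mul.prems by (auto split: option.splits)
    obtain d where d: "fdims ds a = Some (r, d)" "fdims ds b = Some (d, c)"
      using Mul.prems by (auto split: option.splits if_splits)
    note c1 = feval_carrier[OF assms(2) d(1) e(1)] feval_carrier[OF assms(2) d(2) e(2)]
    have "(A1 * B1) $$ (i, j) = (\<Sum>l\<in>{0..<d}. A1 $$ (i, l) * B1 $$ (l, j))" if "i < r" "j < c" for i j
      using c1 that by (simp add: scalar_prod_def)
    then show ?case
      using Mul.IH(1)[OF d(1) e(1)] Mul.IH(2)[OF d(2) e(2)] c1
      by (auto simp: e(3) elements_mat_subset_iff[of _ r c] elements_mat_subset_iff[of _ r d]
          elements_mat_subset_iff[of _ d c] intro!: Fs F(4))
  next
    case (Inv a)
    obtain A1 where e: "feval Ms a = Some A1" "mat_inverse A1 = Some A"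
      using Inv.prems by (auto split: option.splits)
    obtain r1 where r1: "fdims ds a = Some (r1, r1)" "r = r1" "c = r1"
      using Inv.prems by (auto split: option.splits if_splits)
    have A1: "A1 \<in> carrier_mat r1 r1" by (rule feval_carrier[OF assms(2) r1(1) e(1)])
    have inv: "A1 * A = 1\<^sub>m r1" "A * A1 = 1\<^sub>m r1" and A: "A \<in> carrier_mat r1 r1"
      using mat_inverse(2)[OF A1 e(2)] by auto
    have eA1: "elements_mat A1 \<subseteq> F" using Inv.IH[OF r1(1) e(1)] .
    have "Determinant.det A1 * Determinant.det A = 1"
      using det_mult[OF A1 A] inv by simp
    then have d0: "Determinant.det A1 \<noteq> 0" by auto
    have "A * (A1 * adj_mat A1) = adj_mat A1"
      using adj_mat(1)[OF A1] A1 A inv by (simp flip: assoc_mult_mat)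
    then have "A * (Determinant.det A1 \<cdot>\<^sub>m 1\<^sub>m r1) = adj_mat A1"
      using adj_mat(2)[OF A1] by simp
    then have eq: "Determinant.det A1 \<cdot>\<^sub>m A = adj_mat A1"
      using A mult_smult_distrib[OF A one_carrier_mat, of "Determinant.det A1"] by simp
    have "cofactor A1 j i \<in> F" for i j
    proof -
      have "elements_mat (mat_delete A1 j i) \<subseteq> F"
      proof
        fix z assume "z \<in> elements_mat (mat_delete A1 j i)"
        then obtain k l where kl: "k < r1 - 1" "l < r1 - 1"
          "z = A1 $$ (if k < j then k else Suc k, if l < i then l else Suc l)"
          using A1 unfolding mat_delete_def by fastforce
        then show "z \<in> F" using eA1 A1 elements_matI[OF A1] by (auto split: if_splits)
      qed
      then show ?thesis by (auto simp: cofactor_def intro!: F Fpow Fd)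
    qed
    show ?case
    proof
      fix z assume "z \<in> elements_mat A"
      then obtain i j where ij: "i < r1" "j < r1" "z = A $$ (i, j)" using A by auto
      have "Determinant.det A1 * z = cofactor A1 j i"
        using arg_cong[OF eq, of "\<lambda>B. B $$ (i, j)"] ij A A1 by (simp add: adj_mat_def)
      then have "z = inverse (Determinant.det A1) * cofactor A1 j i"
        using d0 by (auto simp: field_simps)
      then show "z \<in> F" using \<open>\<And>i j. cofactor A1 j i \<in> F\<close> Fd[OF eA1] by (auto intro!: F)
    qed
  qed
qed

lemma fdims_leaves: "fdims ds f = Some d \<Longrightarrow> l \<in> set (leaves f) \<Longrightarrow> l < length ds"
  by (induction f arbitrary: d) (auto split: option.splits if_splits)

lemma leaves_bound:
  "fdims ds f = Some d \<Longrightarrow> map (\<lambda>M. (dim_row M, dim_col M)) Ms = ds \<Longrightarrow> l \<in> set (leaves f) \<Longrightarrow> l < length Ms"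
  using fdims_leaves[of ds f d l] by auto

lemma feval_list_update:
  assumes "fdims (map (\<lambda>M. (dim_row M, dim_col M)) Ms) f = Some d" "l \<notin> set (leaves f)"
  shows "feval (Ms[l := M]) f = feval Ms f"
proof (rule feval_cong)
  fix m assume "m \<in> set (leaves f)"
  then show "m < length (Ms[l := M]) \<and> m < length Ms \<and> Ms[l := M] ! m = Ms ! m"
    using leaves_bound[OF assms(1) refl] assms(2) by (cases "m = l") simp_all
qed

section \<open>Block structure of the value of \<open>g\<close>\<close>

lemma feval_g_formula:
  assumes "set (leaves f) \<subseteq> {..<length Ms}"
  shows "feval (g_inputs n X Y Ms k) (g_formula (length Ms) f) =
    (case feval Ms f of Some M \<Rightarrow> Some (P_mat n * M * Q_mat n + R_mat n X Y k) | None \<Rightarrow> None)"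
proof -
  have "feval (g_inputs n X Y Ms k) f = feval Ms f"
    using assms by (intro feval_cong) (auto simp: g_inputs_def nth_append)
  then show ?thesis by (simp add: g_formula_def g_inputs_def nth_append split: option.splits)
qed

lemma sum_lessThan_add: "(\<Sum>j<a + b. h j) = (\<Sum>j<a. h j) + (\<Sum>j<b. h (a + j))"
  for h :: "nat \<Rightarrow> 'a::comm_monoid_add"
  by (induction b) (simp_all add: add.assoc)

lemma sum_delta_mult: "i < n \<Longrightarrow> (\<Sum>j<n. (if i = j then 1 else 0) * h j) = h i"
  for h :: "nat \<Rightarrow> 'a::semiring_1"
proof -
  assume "i < n"
  moreover have "(\<Sum>j<n. (if i = j then 1 else 0) * h j) = (\<Sum>j<n. if j = i then h j else 0)"
    by (intro sum.cong) auto
  ultimately show ?thesis by simp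
qed

lemma sum_lessThan_3:
  "(\<Sum>j<3 * n. h j) = (\<Sum>j<n. h j) + (\<Sum>j<n. h (n + j)) + (\<Sum>j<n. h (2 * n + j))"
  for h :: "nat \<Rightarrow> 'a::comm_monoid_add"
proof -
  have "(\<Sum>j<3 * n. h j) = (\<Sum>j<2 * n + n. h j)" by (simp add: numeral_3_eq_3)
  also have "\<dots> = (\<Sum>j<n + n. h j) + (\<Sum>j<n. h (2 * n + j))"
    by (subst sum_lessThan_add) (simp add: mult_2)
  also have "(\<Sum>j<n + n. h j) = (\<Sum>j<n. h j) + (\<Sum>j<n. h (n + j))"
    by (rule sum_lessThan_add)
  finally show ?thesis .
qed

lemma P_mult_Q_index:
  assumes "(M :: 'a::field mat) \<in> carrier_mat n n" "i < 3 * n" "j < 3 * n"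
  shows "(P_mat n * M * Q_mat n) $$ (i, j) = (if i < n \<and> j < n then M $$ (i, j) else 0)"
proof -
  have "(P_mat n * M) $$ (i, l) = (if i < n then M $$ (i, l) else 0)" if "l < n" for l
  proof -
    have "(P_mat n * M) $$ (i, l) = (\<Sum>m<n. (if i = m then 1 else 0) * M $$ (m, l))"
      using assms that by (simp add: P_mat_def scalar_prod_def lessThan_atLeast0)
    then show ?thesis by (cases "i < n") (simp_all add: sum_delta_mult)
  qed
  moreover have "(P_mat n * M * Q_mat n) $$ (i, j) = (\<Sum>l<n. (P_mat n * M) $$ (i, l) * (if l = j then 1 else 0))"
    using assms by (simp add: P_mat_def Q_mat_def scalar_prod_def lessThan_atLeast0)
  moreover have "\<dots> = (\<Sum>l<n. (if j = l then 1 else 0) * (P_mat n * M) $$ (i, l))"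
    by (intro sum.cong) auto
  moreover have "\<dots> = (if j < n then (P_mat n * M) $$ (i, j) else 0)"
    by (cases "j < n") (auto simp: sum_delta_mult intro!: sum.neutral)
  ultimately show ?thesis by simp
qed

lemma block_index:
  "l < n \<Longrightarrow> l div n = 0" "l < n \<Longrightarrow> l mod n = l" "l < n \<Longrightarrow> (n + l) div n = 1" "l < n \<Longrightarrow> (n + l) mod n = l"
  "l < n \<Longrightarrow> (2 * n + l) div n = 2" "l < n \<Longrightarrow> (2 * n + l) mod n = l"
  "l < n \<Longrightarrow> l < 3 * n" "l < n \<Longrightarrow> n + l < 3 * n" "l < n \<Longrightarrow> 2 * n + l < 3 * n" for l n :: nat
  by (simp_all add: div_add1_eq)

lemma R_mat_index:
  assumes "X \<in> carrier_mat n n" "Y \<in> carrier_mat n n" "i < n" "j < n"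
  shows "R_mat n X Y k $$ (i, j) = 0" "R_mat n X Y k $$ (i, n + j) = X $$ (i, j)"
    "R_mat n X Y k $$ (i, 2 * n + j) = 0"
    "R_mat n X Y k $$ (n + i, j) = Y $$ (i, j)" "R_mat n X Y k $$ (n + i, n + j) = 0"
    "R_mat n X Y k $$ (n + i, 2 * n + j) = (if i = j then 1 else 0)"
    "R_mat n X Y k $$ (2 * n + i, j) = 0" "R_mat n X Y k $$ (2 * n + i, n + j) = (if i = j then 1 else 0)"
    "R_mat n X Y k $$ (2 * n + i, 2 * n + j) = (if i = j \<and> i < k then 1 else 0)"
  unfolding R_mat_def using assms(3,4) by (simp_all add: block_index partial_id_def numeral_2_eq_2[symmetric])

definition col_fun :: "'a mat \<Rightarrow> nat \<Rightarrow> nat \<Rightarrow> 'a" where "col_fun X j i = X $$ (i, j)"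
definition row_fun :: "'a mat \<Rightarrow> nat \<Rightarrow> nat \<Rightarrow> 'a" where "row_fun Y i j = Y $$ (i, j)"

text \<open>Block elimination in the kernel: \<open>(a, b, c)\<close> lies in the kernel iff \<open>c = - Y a\<close>,
  \<open>b = I\<^sub>k Y a\<close> and \<open>(M + X I\<^sub>k Y) a = 0\<close>.\<close>

lemma g_det_eq_0_iff:
  assumes X: "X \<in> carrier_mat n n" and Y: "(Y :: 'a::field mat) \<in> carrier_mat n n" and k: "k \<le> n"
    and lv: "set (leaves f) \<subseteq> {..<length Ms}" and M: "feval Ms f = Some M" "M \<in> carrier_mat n n"
  shows "g_det f n X Y Ms k = 0 \<longleftrightarrow>
    Determinant.det (pert n M (col_fun X) (row_fun Y) k) = 0"
proof -
  define G where "G = P_mat n * M * Q_mat n + R_mat n X Y k"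
  \<comment> \<open>\<open>e\<close> is the diagonal of the partial identity, and
    \<open>Ya v\<close> is \<open>Y\<close> applied to the first block of \<open>v\<close>.\<close>
  define e :: "nat \<Rightarrow> 'a" where "e i = (if i < k then 1 else 0)" for i
  define Ya where "Ya v i = (\<Sum>j<n. Y $$ (i, j) * v j)" for v i
  have G: "G \<in> carrier_mat (3 * n) (3 * n)"
    by (simp add: G_def P_mat_def Q_mat_def R_mat_def carrier_matI)
  have dim_R: "dim_row (R_mat n X Y k) = 3 * n" "dim_col (R_mat n X Y k) = 3 * n"
    by (simp_all add: R_mat_def)
  have Gi: "G $$ (i, j) = M $$ (i, j)" "G $$ (i, n + j) = X $$ (i, j)" "G $$ (i, 2 * n + j) = 0"
    "G $$ (n + i, j) = Y $$ (i, j)" "G $$ (n + i, n + j) = 0"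
    "G $$ (n + i, 2 * n + j) = (if i = j then 1 else 0)"
    "G $$ (2 * n + i, j) = 0" "G $$ (2 * n + i, n + j) = (if i = j then 1 else 0)"
    "G $$ (2 * n + i, 2 * n + j) = (if i = j \<and> i < k then 1 else 0)"
    if "i < n" "j < n" for i j
    using that block_index(7-9)[OF that(1)] block_index(7-9)[OF that(2)]
    by (simp_all add: G_def R_mat_index[OF X Y that] P_mult_Q_index[OF M(2)] dim_R del: index_mult_mat)
  have row1: "(\<Sum>j<3 * n. G $$ (i, j) * v j) = (\<Sum>j<n. M $$ (i, j) * v j) + (\<Sum>j<n. X $$ (i, j) * v (n + j))"
    if "i < n" for i v
    using that by (simp add: sum_lessThan_3 Gi)
  have row2: "(\<Sum>j<3 * n. G $$ (n + i, j) * v j) = Ya v i + v (2 * n + i)" if "i < n" for i v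
    using that by (simp add: sum_lessThan_3 Gi Ya_def sum_delta_mult)
  have row3: "(\<Sum>j<3 * n. G $$ (2 * n + i, j) * v j) = v (n + i) + e i * v (2 * n + i)" if "i < n" for i v
    using that by (cases "i < k") (simp_all add: sum_lessThan_3 Gi sum_delta_mult e_def)
  have pert: "(\<Sum>j<n. pert n M (col_fun X) (row_fun Y) k $$ (i, j) * v j) =
      (\<Sum>j<n. M $$ (i, j) * v j) + (\<Sum>j<n. X $$ (i, j) * (e j * Ya v j))" if "i < n" for i v
  proof -
    have "(\<Sum>l<k. X $$ (i, l) * Y $$ (l, j)) = (\<Sum>l<n. X $$ (i, l) * e l * Y $$ (l, j))" for j
      using k by (intro sum.mono_neutral_cong_left) (auto simp: e_def)
    then have "(\<Sum>j<n. pert n M (col_fun X) (row_fun Y) k $$ (i, j) * v j) =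
        (\<Sum>j<n. M $$ (i, j) * v j) + (\<Sum>j<n. \<Sum>l<n. X $$ (i, l) * e l * Y $$ (l, j) * v j)"
      using that by (simp add: pert_def col_fun_def row_fun_def distrib_right sum.distrib sum_distrib_right)
    also have "(\<Sum>j<n. \<Sum>l<n. X $$ (i, l) * e l * Y $$ (l, j) * v j) = (\<Sum>l<n. X $$ (i, l) * (e l * Ya v l))"
      by (subst sum.swap) (simp add: Ya_def sum_distrib_left mult.assoc)
    finally show ?thesis .
  qed
  have "g_det f n X Y Ms k = Determinant.det G"
    using feval_g_formula[OF lv, of n X Y k] M by (simp add: g_det_def G_def)
  moreover have "Determinant.det G = 0 \<longleftrightarrow> Determinant.det (pert n M (col_fun X) (row_fun Y) k) = 0"
    unfolding det_eq_0_iff_kernel[OF G] det_eq_0_iff_kernel[OF pert_carrier]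
  proof
    assume "\<exists>v. (\<exists>i<3 * n. v i \<noteq> 0) \<and> (\<forall>i<3 * n. (\<Sum>j<3 * n. G $$ (i, j) * v j) = 0)"
    then obtain v i0 where v: "i0 < 3 * n" "v i0 \<noteq> 0" "\<And>i. i < 3 * n \<Longrightarrow> (\<Sum>j<3 * n. G $$ (i, j) * v j) = 0"
      by blast
    have c: "v (2 * n + i) = - Ya v i" if "i < n" for i
      using row2[OF that, of v] v(3)[of "n + i"] that by (simp add: eq_neg_iff_add_eq_0 add.commute)
    have b: "v (n + i) = e i * Ya v i" if "i < n" for i
      using row3[OF that, of v] v(3)[of "2 * n + i"] that c[OF that] by simp
    have a: "(\<Sum>j<n. M $$ (i, j) * v j) + (\<Sum>j<n. X $$ (i, j) * (e j * Ya v j)) = 0" if "i < n" for i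
      using row1[OF that, of v] v(3)[of i] that b by simp
    \<comment> \<open>The other two blocks depend linearly on the first one, so a nonzero kernel
      vector has a nonzero first block.\<close>
    have "\<exists>i<n. v i \<noteq> 0"
    proof (rule ccontr)
      assume "\<not> (\<exists>i<n. v i \<noteq> 0)"
      then have z: "v i = 0" if "i < n" for i using that by auto
      then have "Ya v i = 0" for i by (simp add: Ya_def)
      then have z': "v (n + i) = 0" "v (2 * n + i) = 0" if "i < n" for i using that b c by auto
      consider "i0 < n" | "i0 - n < n" "i0 = n + (i0 - n)" | "i0 - 2 * n < n" "i0 = 2 * n + (i0 - 2 * n)"
        using v(1) by linarith
      then show False using v(2) z z' by cases metis+
    qed
    then show "\<exists>v. (\<exists>i<n. v i \<noteq> 0) \<and> (\<forall>i<n. (\<Sum>j<n. pert n M (col_fun X) (row_fun Y) k $$ (i, j) * v j) = 0)"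
      using a pert by auto
  next
    assume "\<exists>v. (\<exists>i<n. v i \<noteq> 0) \<and> (\<forall>i<n. (\<Sum>j<n. pert n M (col_fun X) (row_fun Y) k $$ (i, j) * v j) = 0)"
    then obtain a i0 where a: "i0 < n" "a i0 \<noteq> 0"
      "\<And>i. i < n \<Longrightarrow> (\<Sum>j<n. pert n M (col_fun X) (row_fun Y) k $$ (i, j) * a j) = 0" by blast
    define v where "v i = (if i < n then a i else if i < 2 * n then e (i - n) * Ya a (i - n) else - Ya a (i - 2 * n))" for i
    have vi: "v i = a i" "v (n + i) = e i * Ya a i" "v (2 * n + i) = - Ya a i" if "i < n" for i
      using that by (auto simp: v_def)
    have Yv: "Ya v = Ya a" by (auto simp: Ya_def vi)
    have "(\<Sum>j<3 * n. G $$ (i, j) * v j) = 0" if "i < 3 * n" for i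
    proof -
      consider "i < n" | l where "l < n" "i = n + l" | l where "l < n" "i = 2 * n + l"
      proof -
        have "i < n \<or> (i - n < n \<and> i = n + (i - n)) \<or> (i - 2 * n < n \<and> i = 2 * n + (i - 2 * n))"
          using \<open>i < 3 * n\<close> by linarith
        then show thesis using that by blast
      qed
      then show ?thesis
      proof cases
        case 1
        then show ?thesis using row1[OF 1, of v] pert[OF 1, of a] a(3)[OF 1] by (simp add: vi)
      next
        case 2
        then show ?thesis using row2[OF 2(1), of v] by (simp add: vi Yv)
      next
        case 3
        then show ?thesis using row3[OF 3(1), of v] by (simp add: vi)
      qed
    qed
    then show "\<exists>v. (\<exists>i<3 * n. v i \<noteq> 0) \<and> (\<forall>i<3 * n. (\<Sum>j<3 * n. G $$ (i, j) * v j) = 0)"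
      using a(1,2) vi(1)[OF a(1)] by (intro exI[of _ v] conjI exI[of _ i0]) auto
  qed
  ultimately show ?thesis by simp
qed

subsection \<open>Updates change the formula value by rank one\<close>

text \<open>Overwriting a column adds (new minus old column) times a unit row; rows and entries are
  analogous. From here on the kind of update no longer matters.\<close>

lemma apply_upd_outer:
  assumes "valid_upd F Ms u"
  obtains l x y where "l < length Ms"
    "apply_upd u Ms = Ms[l := Ms ! l + outer (dim_row (Ms ! l)) (dim_col (Ms ! l)) x y]"
proof (cases u)
  case (Rank1_Upd l a b)
  show thesis
  proof (rule that[of l])
    show "apply_upd u Ms = Ms[l := Ms ! l + outer (dim_row (Ms ! l)) (dim_col (Ms ! l)) (vec_index a) (vec_index b)]"
      by (auto simp: Rank1_Upd change_mat_def intro!: arg_cong[where f = "list_update Ms l"] eq_matI)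
  qed (use assms Rank1_Upd in simp)
next
  case (Col_Upd l j v)
  let ?x = "\<lambda>i. vec_index v i - Ms ! l $$ (i, j)" and ?y = "\<lambda>j'. if j' = j then 1 else 0"
  show thesis
  proof (rule that[of l])
    show "apply_upd u Ms = Ms[l := Ms ! l + outer (dim_row (Ms ! l)) (dim_col (Ms ! l)) ?x ?y]"
      by (auto simp: Col_Upd change_mat_def intro!: arg_cong[where f = "list_update Ms l"] eq_matI)
  qed (use assms Col_Upd in simp)
next
  case (Row_Upd l i v)
  let ?x = "\<lambda>i'. if i' = i then 1 else 0" and ?y = "\<lambda>j. vec_index v j - Ms ! l $$ (i, j)"
  show thesis
  proof (rule that[of l])
    show "apply_upd u Ms = Ms[l := Ms ! l + outer (dim_row (Ms ! l)) (dim_col (Ms ! l)) ?x ?y]"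
      by (auto simp: Row_Upd change_mat_def intro!: arg_cong[where f = "list_update Ms l"] eq_matI)
  qed (use assms Row_Upd in simp)
next
  case (Entry_Upd l i j a)
  let ?x = "\<lambda>i'. if i' = i then a - Ms ! l $$ (i, j) else 0" and ?y = "\<lambda>j'. if j' = j then 1 else 0"
  show thesis
  proof (rule that[of l])
    show "apply_upd u Ms = Ms[l := Ms ! l + outer (dim_row (Ms ! l)) (dim_col (Ms ! l)) ?x ?y]"
      by (auto simp: Entry_Upd change_mat_def intro!: arg_cong[where f = "list_update Ms l"] eq_matI)
  qed (use assms Entry_Upd in simp)
qed

lemma outer_mult:
  "(C :: 'a::field mat) \<in> carrier_mat c d \<Longrightarrow> outer r c x y * C = outer r d x (\<lambda>j. \<Sum>l<c. y l * C $$ (l, j))"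
  by (intro eq_matI) (auto simp: scalar_prod_def lessThan_atLeast0 sum_distrib_left mult.assoc)

lemma mult_outer:
  "(C :: 'a::field mat) \<in> carrier_mat d r \<Longrightarrow> C * outer r c x y = outer d c (\<lambda>i. \<Sum>l<r. C $$ (i, l) * x l) y"
  by (intro eq_matI) (auto simp: scalar_prod_def lessThan_atLeast0 sum_distrib_right mult.assoc)

lemma add_outer_cancel: "(B :: 'a::field mat) \<in> carrier_mat r c \<Longrightarrow> B + outer r c x y + outer r c (\<lambda>i. - x i) y = B"
  by (intro eq_matI) auto

text \<open>Since leaves are distinct, only one operand of a binary node changes. Sums pass an outer
  product on, and a product with a fixed matrix turns it into another outer product. Inversion is
  handled by the resolvent identity.\<close>

lemma feval_add_outer:
  fixes Ms :: "'a::field mat list"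
  assumes "map (\<lambda>M. (dim_row M, dim_col M)) Ms = ds" "l < length Ms"
    and Ms': "Ms' = Ms[l := Ms ! l + outer (dim_row (Ms ! l)) (dim_col (Ms ! l)) x y]"
    and "distinct (leaves f)" "fdims ds f = Some (r, c)" "feval Ms f = Some A" "feval Ms' f = Some B"
  shows "\<exists>x y. B = A + outer r c x y"
  using assms(4-7)
proof (induction f arbitrary: r c A B)
  case (Leaf m)
  have "A \<in> carrier_mat r c" using feval_carrier[OF assms(1) Leaf.prems(2,3)] .
  \<comment> \<open>A leaf other than \<open>l\<close> keeps its value, which counts as adding a
    zero outer product.\<close>
  moreover have "A + outer r c (\<lambda>_. 0) (\<lambda>_. 0) = A" using calculation by (intro eq_matI) auto
  ultimately show ?case using Leaf.prems Ms' assms(2)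
    by (cases "m = l") (auto split: if_splits intro: sym)
next
  case (Add a b)
  obtain A1 A2 where A: "feval Ms a = Some A1" "feval Ms b = Some A2" "A = A1 + A2"
    using Add.prems by (auto split: option.splits)
  obtain B1 B2 where B: "feval Ms' a = Some B1" "feval Ms' b = Some B2" "B = B1 + B2"
    using Add.prems by (auto split: option.splits)
  have d: "fdims ds a = Some (r, c)" "fdims ds b = Some (r, c)"
    using Add.prems by (auto split: option.splits if_splits)
  note c1 = feval_carrier[OF assms(1) d(1) A(1)] feval_carrier[OF assms(1) d(2) A(2)]
  have dist: "distinct (leaves a)" "distinct (leaves b)" "set (leaves a) \<inter> set (leaves b) = {}"
    using Add.prems by auto
  show ?case
  proof (cases "l \<in> set (leaves a)")
    case True
    then have "l \<notin> set (leaves b)" using dist(3) by blast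
    then have "A2 = B2" using feval_list_update[OF d(2)[folded assms(1)]] A B Ms' by auto
    moreover obtain x y where "B1 = A1 + outer r c x y" using Add.IH(1)[OF dist(1) d(1) A(1) B(1)] by auto
    moreover have "A1 + outer r c x y + A2 = A1 + A2 + outer r c x y"
      using c1 by (intro eq_matI) auto
    ultimately show ?thesis using A B by auto
  next
    case False
    then have "A1 = B1" using feval_list_update[OF d(1)[folded assms(1)]] A B Ms' by auto
    moreover obtain x y where "B2 = A2 + outer r c x y" using Add.IH(2)[OF dist(2) d(2) A(2) B(2)] by auto
    moreover have "A1 + (A2 + outer r c x y) = A1 + A2 + outer r c x y"
      using c1 by (intro eq_matI) auto
    ultimately show ?thesis using A B by auto
  qed
next
  case (Sub a b)
  obtain A1 A2 where A: "feval Ms a = Some A1" "feval Ms b = Some A2" "A = A1 - A2"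
    using Sub.prems by (auto split: option.splits)
  obtain B1 B2 where B: "feval Ms' a = Some B1" "feval Ms' b = Some B2" "B = B1 - B2"
    using Sub.prems by (auto split: option.splits)
  have d: "fdims ds a = Some (r, c)" "fdims ds b = Some (r, c)"
    using Sub.prems by (auto split: option.splits if_splits)
  note c1 = feval_carrier[OF assms(1) d(1) A(1)] feval_carrier[OF assms(1) d(2) A(2)]
  have dist: "distinct (leaves a)" "distinct (leaves b)" "set (leaves a) \<inter> set (leaves b) = {}"
    using Sub.prems by auto
  show ?case
  proof (cases "l \<in> set (leaves a)")
    case True
    then have "l \<notin> set (leaves b)" using dist(3) by blast
    then have "A2 = B2" using feval_list_update[OF d(2)[folded assms(1)]] A B Ms' by auto
    moreover obtain x y where "B1 = A1 + outer r c x y" using Sub.IH(1)[OF dist(1) d(1) A(1) B(1)] by auto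
    moreover have "A1 + outer r c x y - A2 = A1 - A2 + outer r c x y"
      using c1 by (intro eq_matI) auto
    ultimately show ?thesis using A B by auto
  next
    case False
    then have "A1 = B1" using feval_list_update[OF d(1)[folded assms(1)]] A B Ms' by auto
    moreover obtain x y where "B2 = A2 + outer r c x y" using Sub.IH(2)[OF dist(2) d(2) A(2) B(2)] by auto
    moreover have "A1 - (A2 + outer r c x y) = A1 - A2 + outer r c (\<lambda>i. - x i) y"
      using c1 by (intro eq_matI) auto
    ultimately show ?thesis using A B by auto
  qed
next
  case (Mul a b)
  obtain A1 A2 where A: "feval Ms a = Some A1" "feval Ms b = Some A2" "A = A1 * A2"
    using Mul.prems by (auto split: option.splits)
  obtain B1 B2 where B: "feval Ms' a = Some B1" "feval Ms' b = Some B2" "B = B1 * B2"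
    using Mul.prems by (auto split: option.splits)
  obtain d' where d: "fdims ds a = Some (r, d')" "fdims ds b = Some (d', c)"
    using Mul.prems by (auto split: option.splits if_splits)
  note c1 = feval_carrier[OF assms(1) d(1) A(1)] feval_carrier[OF assms(1) d(2) A(2)]
  have dist: "distinct (leaves a)" "distinct (leaves b)" "set (leaves a) \<inter> set (leaves b) = {}"
    using Mul.prems by auto
  show ?case
  proof (cases "l \<in> set (leaves a)")
    case True
    then have "l \<notin> set (leaves b)" using dist(3) by blast
    then have "A2 = B2" using feval_list_update[OF d(2)[folded assms(1)]] A B Ms' by auto
    moreover obtain x y where "B1 = A1 + outer r d' x y" using Mul.IH(1)[OF dist(1) d(1) A(1) B(1)] by auto
    ultimately have "B = A1 * A2 + outer r d' x y * A2"
      using B(3) add_mult_distrib_mat[OF c1(1) outer_carrier c1(2)] by simp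
    then show ?thesis using A(3) by (auto simp: outer_mult[OF c1(2)])
  next
    case False
    then have "A1 = B1" using feval_list_update[OF d(1)[folded assms(1)]] A B Ms' by auto
    moreover obtain x y where "B2 = A2 + outer d' c x y" using Mul.IH(2)[OF dist(2) d(2) A(2) B(2)] by auto
    ultimately have "B = A1 * A2 + A1 * outer d' c x y"
      using B(3) mult_add_distrib_mat[OF c1(1) c1(2) outer_carrier] by simp
    then show ?thesis using A(3) by (auto simp: mult_outer[OF c1(1)])
  qed
next
  case (Inv a)
  obtain A1 where A: "feval Ms a = Some A1" "mat_inverse A1 = Some A"
    using Inv.prems by (auto split: option.splits)
  obtain B1 where B: "feval Ms' a = Some B1" "mat_inverse B1 = Some B"
    using Inv.prems by (auto split: option.splits)
  have d: "fdims ds a = Some (r, r)" "c = r"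
    using Inv.prems by (auto split: option.splits if_splits)
  have A1: "A1 \<in> carrier_mat r r" using feval_carrier[OF assms(1) d(1) A(1)] .
  obtain x y where xy: "B1 = A1 + outer r r x y" using Inv.IH[OF _ d(1) A(1) B(1)] Inv.prems by auto
  then have B1: "B1 \<in> carrier_mat r r" using A1 by simp
  have iA: "A1 * A = 1\<^sub>m r" "A * A1 = 1\<^sub>m r" and Ac: "A \<in> carrier_mat r r"
    using mat_inverse(2)[OF A1 A(2)] by auto
  have iB: "B1 * B = 1\<^sub>m r" "B * B1 = 1\<^sub>m r" and Bc: "B \<in> carrier_mat r r"
    using mat_inverse(2)[OF B1 B(2)] by auto
  \<comment> \<open>Resolvent identity: expanding \<open>B1\<close> as \<open>A1\<close> plus an
    outer product gives \<open>A = B + A * outer r r x y * B\<close>, and an outer product between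
    two matrices is again an outer product.\<close>
  have "A = A * (B1 * B)" using Ac iB by simp
  also have "\<dots> = A * (A1 * B) + A * (outer r r x y * B)"
    unfolding xy add_mult_distrib_mat[OF A1 outer_carrier Bc]
    using A1 Bc Ac by (intro mult_add_distrib_mat) (auto intro: mult_carrier_mat)
  also have "A * (A1 * B) = B"
    using A1 Bc Ac iA by (simp flip: assoc_mult_mat[OF Ac A1 Bc])
  also have "A * (outer r r x y * B) =
      outer r r (\<lambda>i. \<Sum>l<r. A $$ (i, l) * x l) (\<lambda>j. \<Sum>l<r. y l * B $$ (l, j))"
    (is "_ = outer r r ?x' ?y'")
    by (simp add: outer_mult[OF Bc] mult_outer[OF Ac])
  finally obtain x' y' where AB: "A = B + outer r r x' y'" by blast
  have "B = A + outer r r (\<lambda>i. - x' i) y'" by (simp add: AB add_outer_cancel[OF Bc])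
  then show ?case using d(2) by blast
qed

section \<open>Random tapes\<close>

text \<open>\<open>(t, a) \<mapsto> t(h t := a)\<close> is injective on \<open>B \<times> E\<close>: it does not change \<open>h t\<close>, and at most one
  value of the coordinate \<open>h t\<close> is bad.\<close>

lemma card_bad_coordinate:
  fixes E :: "'a::zero set"
  assumes fin: "finite E"
    and hm: "\<And>t. t \<in> B \<Longrightarrow> h t < m" and BO: "B \<subseteq> PiE_dflt {..<m} 0 (\<lambda>_. E)"
    and hinv: "\<And>t a. t \<in> B \<Longrightarrow> a \<in> E \<Longrightarrow> h (t(h t := a)) = h t"
    and uniq: "\<And>t a. t \<in> B \<Longrightarrow> t(h t := a) \<in> B \<Longrightarrow> a = t (h t)"
  shows "card B * card E \<le> card (PiE_dflt {..<m} 0 (\<lambda>_. E) :: (nat \<Rightarrow> 'a) set)"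
proof -
  have "inj_on (\<lambda>(t, a). t(h t := a)) (B \<times> E)"
  proof (rule inj_onI, clarify)
    fix t a t' a' assume *: "t \<in> B" "a \<in> E" "t' \<in> B" "a' \<in> E" and eq: "t(h t := a) = t'(h t' := a')"
    have h: "h t = h t'" using hinv[OF *(1,2)] hinv[OF *(3,4)] eq by simp
    have "t' = t(h t := t' (h t))"
    proof
      fix i show "t' i = (t(h t := t' (h t))) i"
        using fun_cong[OF eq, of i] h by (cases "i = h t") auto
    qed
    then have "t' (h t) = t (h t)" using uniq[OF *(1), of "t' (h t)"] *(3) by simp
    then have "t' = t" using \<open>t' = t(h t := t' (h t))\<close> by simp
    then show "t = t' \<and> a = a'" using fun_cong[OF eq, of "h t"] by simp
  qed
  moreover have "(\<lambda>(t, a). t(h t := a)) ` (B \<times> E) \<subseteq> PiE_dflt {..<m} 0 (\<lambda>_. E)"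
    using hm BO by (fastforce simp: PiE_dflt_def split: if_splits)
  moreover have "finite (PiE_dflt {..<m} 0 (\<lambda>_. E) :: (nat \<Rightarrow> 'a) set)"
    using fin by (intro finite_PiE_dflt) auto
  ultimately have "card (B \<times> E) \<le> card (PiE_dflt {..<m} 0 (\<lambda>_. E) :: (nat \<Rightarrow> 'a) set)"
    using card_inj_on_le by blast
  then show ?thesis by (simp add: card_cartesian_product)
qed

lemma random_tape_eq:
  assumes "finite E" "E \<noteq> {}"
  shows "random_tape E m = pmf_of_set (PiE_dflt {..<m} 0 (\<lambda>_. E))"
  unfolding random_tape_def using assms by (intro Pi_pmf_of_set) auto

lemma set_random_tape:
  assumes "finite E" "E \<noteq> {}"
  shows "set_pmf (random_tape E m) = PiE_dflt {..<m} 0 (\<lambda>_. E)"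
  unfolding random_tape_def using assms by (subst set_Pi_pmf) auto

text \<open>A bad tape solves an affine equation in the cells \<open>e i\<close> whose coefficients
  do not depend on these cells. The index \<open>g t\<close> of a nonzero coefficient is chosen as a
  function of \<open>c t\<close> alone, so it survives resampling of the cell
  \<open>e (g t)\<close>, and at most one value of that cell solves the equation.\<close>

lemma prob_linear_form:
  fixes E :: "'a::field set" and c :: "(nat \<Rightarrow> 'a) \<Rightarrow> nat \<Rightarrow> 'a"
  assumes E: "finite E" "E \<noteq> {}" and base: "\<And>i. i < n \<Longrightarrow> e i < m" and inj: "inj_on e {..<n}"
    and c: "\<And>t i a. i < n \<Longrightarrow> c (t(e i := a)) = c t" and d: "\<And>t i a. i < n \<Longrightarrow> d (t(e i := a)) = d t"
    and bad: "\<And>t. bad t \<Longrightarrow> (\<exists>i<n. c t i \<noteq> 0) \<and> (\<Sum>i<n. c t i * t (e i)) + d t = 0"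
  shows "measure_pmf.prob (random_tape E m) {t. bad t} \<le> 1 / real (card E)"
proof -
  let ?O = "PiE_dflt {..<m} 0 (\<lambda>_. E) :: (nat \<Rightarrow> 'a) set"
  define g where "g t = (SOME i. i < n \<and> c t i \<noteq> 0)" for t
  define h where "h t = e (g t)" for t
  define B where "B = {t \<in> ?O. bad t}"
  have g: "g t < n" "c t (g t) \<noteq> 0" if "bad t" for t
    using someI_ex[of "\<lambda>i. i < n \<and> c t i \<noteq> 0"] bad[OF that] by (auto simp: g_def)
  have "card B * card E \<le> card ?O"
  proof (rule card_bad_coordinate[OF E(1), of B h])
    show "h t < m" if "t \<in> B" for t using that g base by (auto simp: B_def h_def)
    show "B \<subseteq> ?O" by (auto simp: B_def)
    show "h (t(h t := a)) = h t" if "t \<in> B" "a \<in> E" for t a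
      using that g[of t] c[of "g t" t a] by (auto simp: B_def h_def g_def)
    show "a = t (h t)" if "t \<in> B" "t(h t := a) \<in> B" for t a
    proof -
      have b: "bad t" "bad (t(h t := a))" using that by (auto simp: B_def)
      let ?g = "g t"
      have gn: "?g < n" and cg: "c t ?g \<noteq> 0" using g[OF b(1)] by auto
      have e: "e i = h t \<longleftrightarrow> i = ?g" if "i < n" for i
        using inj that gn by (auto simp: h_def inj_on_def)
      have "(\<Sum>i<n. c t i * (t(h t := a)) (e i)) =
          (\<Sum>i<n. c t i * t (e i) + (if i = ?g then c t i * (a - t (e i)) else 0))"
        by (intro sum.cong) (auto simp: e algebra_simps)
      also have "\<dots> = (\<Sum>i<n. c t i * t (e i)) + c t ?g * (a - t (h t))"
        using gn by (simp add: sum.distrib h_def)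
      finally have eq: "(\<Sum>i<n. c t i * (t(h t := a)) (e i)) =
          (\<Sum>i<n. c t i * t (e i)) + c t ?g * (a - t (h t))" .
      have "(\<Sum>i<n. c t i * t (e i)) + d t = 0" using bad[OF b(1)] by blast
      moreover have "(\<Sum>i<n. c t i * (t(h t := a)) (e i)) + d t = 0"
        using bad[OF b(2)] c[OF gn, of t a] d[OF gn, of t a] unfolding h_def by metis
      ultimately have "c t ?g * (a - t (h t)) = 0"
        unfolding eq by (simp add: add_eq_0_iff)
      then show ?thesis using cg by simp
    qed
  qed
  then have le: "real (card B) * real (card E) \<le> real (card ?O)" by (metis of_nat_le_iff of_nat_mult)
  have fO: "finite ?O" "?O \<noteq> {}" using E by (auto intro: finite_PiE_dflt)
  have pos: "real (card E) > 0" "real (card ?O) > 0" using E fO by (auto simp: card_gt_0_iff)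
  have "measure_pmf.prob (random_tape E m) {t. bad t} = card B / card ?O"
    unfolding random_tape_eq[OF E] using fO by (subst measure_pmf_of_set) (auto simp: B_def Int_def)
  also have "\<dots> \<le> 1 / real (card E)"
    using le pos by (simp add: divide_le_eq le_divide_eq)
  finally show ?thesis .
qed

text \<open>Step \<open>j < k\<close> raises the rank unless \<open>x\<^sub>j\<close> is orthogonal to some fixed left kernel vector, or
  \<open>y\<^sub>j\<close> to some fixed right kernel vector, of the matrix after \<open>j\<close> steps.\<close>

definition tape_x :: "nat \<Rightarrow> (nat \<Rightarrow> 'a) \<Rightarrow> nat \<Rightarrow> nat \<Rightarrow> 'a" where "tape_x n t j i = t (i * n + j)"
definition tape_y :: "nat \<Rightarrow> (nat \<Rightarrow> 'a) \<Rightarrow> nat \<Rightarrow> nat \<Rightarrow> 'a" where "tape_y n t j i = t (n * n + (j * n + i))"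

abbreviation tape_pert :: "nat \<Rightarrow> 'a::field mat \<Rightarrow> (nat \<Rightarrow> 'a) \<Rightarrow> nat \<Rightarrow> 'a mat" where
  "tape_pert n M t k \<equiv> pert n M (tape_x n t) (tape_y n t) k"

text \<open>Choosing the kernel vector by \<open>SOME\<close> makes it a function of the matrix
  alone. Hence it does not change when cells that do not affect the matrix are resampled, as
  \<open>prob_linear_form\<close> requires of its coefficients.\<close>

definition left_ker :: "nat \<Rightarrow> 'a::field mat \<Rightarrow> nat \<Rightarrow> 'a" where
  "left_ker n A = (SOME u. (\<exists>i<n. u i \<noteq> 0) \<and> (\<forall>j<n. (\<Sum>i<n. u i * A $$ (i, j)) = 0))"
definition right_ker :: "nat \<Rightarrow> 'a::field mat \<Rightarrow> nat \<Rightarrow> 'a" where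
  "right_ker n A = (SOME w. (\<exists>i<n. w i \<noteq> 0) \<and> (\<forall>i<n. (\<Sum>j<n. A $$ (i, j) * w j) = 0))"

lemma left_ker:
  assumes "A \<in> carrier_mat n n" "Determinant.det A = 0"
  shows "\<exists>i<n. left_ker n A i \<noteq> 0" "j < n \<Longrightarrow> (\<Sum>i<n. left_ker n A i * A $$ (i, j)) = 0"
proof -
  have "\<exists>u. (\<exists>i<n. u i \<noteq> 0) \<and> (\<forall>j<n. (\<Sum>i<n. u i * A $$ (i, j)) = 0)"
    using det_eq_0_left_kernel[OF assms] by metis
  from someI_ex[OF this] show "\<exists>i<n. left_ker n A i \<noteq> 0" "j < n \<Longrightarrow> (\<Sum>i<n. left_ker n A i * A $$ (i, j)) = 0"
    by (auto simp: left_ker_def)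
qed

lemma right_ker:
  assumes "A \<in> carrier_mat n n" "Determinant.det A = 0"
  shows "\<exists>i<n. right_ker n A i \<noteq> 0" "i < n \<Longrightarrow> (\<Sum>j<n. A $$ (i, j) * right_ker n A j) = 0"
proof -
  have "\<exists>w. (\<exists>i<n. w i \<noteq> 0) \<and> (\<forall>i<n. (\<Sum>j<n. A $$ (i, j) * w j) = 0)"
    using assms det_eq_0_iff_kernel by metis
  from someI_ex[OF this] show "\<exists>i<n. right_ker n A i \<noteq> 0" "i < n \<Longrightarrow> (\<Sum>j<n. A $$ (i, j) * right_ker n A j) = 0"
    by (auto simp: right_ker_def)
qed

lemma row_major_less: "i * m + j < n * m" if "i < n" "j < m" for i j m n :: nat
proof -
  have "i * m + j < Suc i * m" using that by simp
  also have "\<dots> \<le> n * m" using that by (intro mult_le_mono1) simp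
  finally show ?thesis .
qed

lemma row_major_eq: "i * n + j = i' * n + j' \<longleftrightarrow> i = i' \<and> j = j'" if "j < n" "j' < n" for i i' j j' n :: nat
proof
  assume eq: "i * n + j = i' * n + j'"
  show "i = i' \<and> j = j'"
    using arg_cong[OF eq, of "\<lambda>x. x div n"] arg_cong[OF eq, of "\<lambda>x. x mod n"] that by simp
qed simp

text \<open>The tape holds \<open>X\<close> and then \<open>Y\<close>, both row by row, so column
  \<open>j\<close> of \<open>X\<close> and row \<open>j\<close> of \<open>Y\<close> occupy cells
  disjoint from each other and from those of any other index below \<open>n\<close>.\<close>

lemma tape_upd:
  assumes "i < n" "j < n" "i' < n" "l < n"
  shows "tape_x n (t(n * n + (j * n + i) := a)) l i' = tape_x n t l i'"
    "tape_y n (t(i * n + j := a)) l i' = tape_y n t l i'"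
    "l \<noteq> j \<Longrightarrow> tape_x n (t(i * n + j := a)) l i' = tape_x n t l i'"
    "l \<noteq> j \<Longrightarrow> tape_y n (t(n * n + (j * n + i) := a)) l i' = tape_y n t l i'"
  using row_major_less[of i n j n] row_major_less[of i' n l n] row_major_eq[of l n j i' i] row_major_eq[of i' n i l j] assms
  by (auto simp: tape_x_def tape_y_def)

text \<open>This is the independence behind all probability bounds: the matrix after
  \<open>k\<close> steps reads only the vectors with index below \<open>k\<close>, hence is
  unaffected by those with index \<open>j\<close> at least \<open>k\<close>.\<close>

lemma tape_pert_upd:
  assumes "i < n" "k \<le> j" "j < n"
  shows "tape_pert n M (t(i * n + j := a)) k = tape_pert n M t k"
    "tape_pert n M (t(n * n + (j * n + i) := a)) k = tape_pert n M t k"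
  by (intro eq_matI; use assms in \<open>auto simp: pert_def tape_upd intro!: sum.cong\<close>)+

lemma tape_index: "i < n \<Longrightarrow> j < n \<Longrightarrow> i * n + j < 2 * n\<^sup>2" "i < n \<Longrightarrow> j < n \<Longrightarrow> n * n + (i * n + j) < 2 * n\<^sup>2"
  for i j n :: nat
  using row_major_less[of i n j n] by (simp_all add: power2_eq_square)

abbreviation tape_prob :: "nat \<Rightarrow> 'a::zero set \<Rightarrow> (nat \<Rightarrow> 'a) set \<Rightarrow> real" where
  "tape_prob n E \<equiv> measure_pmf.prob (random_tape E (2 * n\<^sup>2))"

lemma prob_left:
  assumes E: "finite E" "E \<noteq> {}" and j: "j < n"
  shows "tape_prob n E
    {t. Determinant.det (tape_pert n M t j) = 0 \<and>
       (\<Sum>i<n. left_ker n (tape_pert n M t j) i * tape_x n t j i) = 0} \<le> 1 / real (card E)"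
proof (rule prob_linear_form[OF E, where e = "\<lambda>i. i * n + j" and n = n
      and c = "\<lambda>t. left_ker n (tape_pert n M t j)" and d = "\<lambda>_. 0"])
  show "inj_on (\<lambda>i. i * n + j) {..<n}" using j by (auto simp: inj_on_def)
  fix t assume "Determinant.det (tape_pert n M t j) = 0 \<and>
       (\<Sum>i<n. left_ker n (tape_pert n M t j) i * tape_x n t j i) = 0"
  then show "(\<exists>i<n. left_ker n (tape_pert n M t j) i \<noteq> 0) \<and>
      (\<Sum>i<n. left_ker n (tape_pert n M t j) i * t (i * n + j)) + 0 = 0"
    using left_ker(1)[OF pert_carrier] by (auto simp: tape_x_def)
qed (use j in \<open>auto simp: tape_pert_upd tape_index\<close>)

lemma prob_right:
  assumes E: "finite E" "E \<noteq> {}" and j: "j < n"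
  shows "tape_prob n E
    {t. Determinant.det (tape_pert n M t j) = 0 \<and>
       (\<Sum>i<n. right_ker n (tape_pert n M t j) i * tape_y n t j i) = 0} \<le> 1 / real (card E)"
proof (rule prob_linear_form[OF E, where e = "\<lambda>i. n * n + (j * n + i)" and n = n
      and c = "\<lambda>t. right_ker n (tape_pert n M t j)" and d = "\<lambda>_. 0"])
  show "inj_on (\<lambda>i. n * n + (j * n + i)) {..<n}" by (auto simp: inj_on_def)
  fix t assume "Determinant.det (tape_pert n M t j) = 0 \<and>
       (\<Sum>i<n. right_ker n (tape_pert n M t j) i * tape_y n t j i) = 0"
  then show "(\<exists>i<n. right_ker n (tape_pert n M t j) i \<noteq> 0) \<and>
      (\<Sum>i<n. right_ker n (tape_pert n M t j) i * t (n * n + (j * n + i))) + 0 = 0"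
    using right_ker(1)[OF pert_carrier] by (auto simp: tape_y_def)
qed (use j in \<open>auto simp: tape_pert_upd tape_index\<close>)

text \<open>If \<open>N\<close> is invertible and \<open>(N + x y\<^sup>T) v = 0\<close> with \<open>v \<noteq> 0\<close>, then \<open>v\<close> is a multiple of \<open>N\<^sup>-\<^sup>1 x\<close>, so
  the bad event is the affine equation \<open>1 + y (N\<^sup>-\<^sup>1 x) = 0\<close> in \<open>y\<close>.\<close>

definition solve :: "nat \<Rightarrow> 'a::field mat \<Rightarrow> (nat \<Rightarrow> 'a) \<Rightarrow> nat \<Rightarrow> 'a" where
  "solve n N x = (SOME z. \<forall>i<n. (\<Sum>j<n. N $$ (i, j) * z j) = x i)"

lemma solve:
  assumes N: "N \<in> carrier_mat n n" "Determinant.det N \<noteq> 0" and i: "i < n"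
  shows "(\<Sum>j<n. N $$ (i, j) * solve n N x j) = x i"
proof -
  let ?v = "(1 / Determinant.det N) \<cdot>\<^sub>v (adj_mat N *\<^sub>v vec n x)"
  have v: "?v \<in> carrier_vec n" using adj_mat(1)[OF N(1)] by auto
  have "N *\<^sub>v ?v = vec n x"
  proof -
    have "N *\<^sub>v ?v = (1 / Determinant.det N) \<cdot>\<^sub>v ((N * adj_mat N) *\<^sub>v vec n x)"
      using adj_mat(1)[OF N(1)] N(1) by (simp add: mult_mat_vec[of N n n] assoc_mult_mat_vec[of N n n])
    also have "\<dots> = vec n x"
      using adj_mat(2)[OF N(1)] N(2) by (auto simp: smult_smult_assoc)
    finally show ?thesis .
  qed
  then have "(N *\<^sub>v ?v) $ i = x i" if "i < n" for i using that by simp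
  then have "(\<Sum>j<n. N $$ (i, j) * ?v $ j) = x i" if "i < n" for i
    using N(1) that v by (simp add: scalar_prod_def lessThan_atLeast0 del: index_smult_vec)
  then have "\<exists>z. \<forall>i<n. (\<Sum>j<n. N $$ (i, j) * z j) = x i" by blast
  from someI_ex[OF this] show ?thesis using i by (simp add: solve_def)
qed

lemma det_add_outer_eq_0:
  assumes N: "N \<in> carrier_mat n n" "Determinant.det N \<noteq> 0" and 0: "Determinant.det (N + outer n n x y) = 0"
  shows "(\<Sum>j<n. solve n N x j * y j) + 1 = 0"
proof -
  define z where "z = solve n N x"
  have ker: "\<not> (\<exists>v. (\<exists>i<n. v i \<noteq> 0) \<and> (\<forall>i<n. (\<Sum>j<n. N $$ (i, j) * v j) = 0))"
    using N det_eq_0_iff_kernel by metis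
  obtain v where v: "\<exists>i<n. v i \<noteq> 0" "\<And>i. i < n \<Longrightarrow> (\<Sum>j<n. (N + outer n n x y) $$ (i, j) * v j) = 0"
    using 0 det_eq_0_iff_kernel[of "N + outer n n x y" n] N(1) by auto
  define s where "s = (\<Sum>j<n. y j * v j)"
  have Nv: "(\<Sum>j<n. N $$ (i, j) * v j) = - s * x i" if "i < n" for i
  proof -
    have "(\<Sum>j<n. (N + outer n n x y) $$ (i, j) * v j) = (\<Sum>j<n. N $$ (i, j) * v j) + x i * s"
      using N(1) that by (simp add: distrib_right sum.distrib s_def sum_distrib_left mult.assoc)
    then show ?thesis using v(2)[OF that] by (simp add: eq_neg_iff_add_eq_0 mult.commute)
  qed
  have "(\<Sum>j<n. N $$ (i, j) * (v j + s * z j)) = 0" if "i < n" for i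
  proof -
    have "(\<Sum>j<n. N $$ (i, j) * (v j + s * z j)) = (\<Sum>j<n. N $$ (i, j) * v j) + s * (\<Sum>j<n. N $$ (i, j) * z j)"
      by (simp add: distrib_left sum.distrib sum_distrib_left mult.left_commute)
    then show ?thesis using Nv[OF that] solve[OF N that, of x] by (simp add: z_def)
  qed
  then have vz: "v i = - s * z i" if "i < n" for i
    using ker[simplified, THEN spec, of "\<lambda>j. v j + s * z j"] that
    by (auto simp: eq_neg_iff_add_eq_0)
  then have s0: "s \<noteq> 0" using v(1) by auto
  \<comment> \<open>Substituting \<open>v = - s z\<close> into the definition of \<open>s\<close>
    turns it into an equation in \<open>s\<close>, which can be divided by \<open>s\<close>: with
    \<open>s = 0\<close> the vector \<open>v\<close> would vanish.\<close>
  have "s = - s * (\<Sum>j<n. z j * y j)"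
    unfolding sum_distrib_left by (subst s_def) (auto intro!: sum.cong simp: vz)
  then have "s + s * (\<Sum>j<n. z j * y j) = 0" by (simp add: eq_neg_iff_add_eq_0)
  then have "s * ((\<Sum>j<n. z j * y j) + 1) = 0" by (simp add: distrib_left add.commute)
  then show ?thesis using s0 by (simp add: z_def)
qed

text \<open>The random cells are those of row \<open>k\<close> of \<open>Y\<close>, on which neither
  the current matrix nor column \<open>k\<close> of \<open>X\<close> depends. The column is cut off
  at \<open>n\<close> because \<open>tape_x\<close> at larger indices reads cells of
  \<open>Y\<close>; with the cut, the arguments of \<open>solve\<close> agree as functions before
  and after resampling.\<close>

lemma prob_next:
  assumes E: "finite E" "E \<noteq> {}" and k: "k < n"
  shows "tape_prob n E
    {t. Determinant.det (tape_pert n M t k) \<noteq> 0 \<and> Determinant.det (tape_pert n M t (Suc k)) = 0}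
    \<le> 1 / real (card E)"
proof (rule prob_linear_form[OF E, where e = "\<lambda>i. n * n + (k * n + i)" and n = n
      and c = "\<lambda>t. solve n (tape_pert n M t k) (\<lambda>i. if i < n then tape_x n t k i else 0)" and d = "\<lambda>_. 1"])
  show "inj_on (\<lambda>i. n * n + (k * n + i)) {..<n}" by (auto simp: inj_on_def)
  show "n * n + (k * n + i) < 2 * n\<^sup>2" if "i < n" for i using tape_index(2) k that .
  show "solve n (tape_pert n M (t(n * n + (k * n + i) := a)) k)
      (\<lambda>i'. if i' < n then tape_x n (t(n * n + (k * n + i) := a)) k i' else 0)
    = solve n (tape_pert n M t k) (\<lambda>i. if i < n then tape_x n t k i else 0)" if "i < n" for t i a
    using that k by (simp add: tape_pert_upd tape_upd cong: if_cong)
  fix t assume "Determinant.det (tape_pert n M t k) \<noteq> 0 \<and> Determinant.det (tape_pert n M t (Suc k)) = 0"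
  moreover have "outer n n (tape_x n t k) (tape_y n t k) =
      outer n n (\<lambda>i. if i < n then tape_x n t k i else 0) (tape_y n t k)"
    by (intro eq_matI) auto
  ultimately have *: "(\<Sum>j<n. solve n (tape_pert n M t k) (\<lambda>i. if i < n then tape_x n t k i else 0) j
        * tape_y n t k j) + 1 = 0"
    by (intro det_add_outer_eq_0) (auto simp: pert_Suc)
  \<comment> \<open>If all coefficients vanished, the equation would read
    \<open>0 + 1 = 0\<close>.\<close>
  then have "\<exists>i<n. solve n (tape_pert n M t k) (\<lambda>i. if i < n then tape_x n t k i else 0) i \<noteq> 0"
    by (rule_tac ccontr) simp
  then show "(\<exists>i<n. solve n (tape_pert n M t k) (\<lambda>i. if i < n then tape_x n t k i else 0) i \<noteq> 0) \<and>
      (\<Sum>i<n. solve n (tape_pert n M t k) (\<lambda>i. if i < n then tape_x n t k i else 0) i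
        * t (n * n + (k * n + i))) + 1 = 0"
    using * by (simp add: tape_y_def)
qed simp

text \<open>The tape serves the matrix \<open>M\<close>: besides \<open>k = n - rank M\<close>, the value \<open>k + 1\<close> must give a nonzero
  determinant too, since the algorithm passes through it when the rank drops.\<close>

definition serves :: "nat \<Rightarrow> 'a::field mat \<Rightarrow> (nat \<Rightarrow> 'a) \<Rightarrow> bool" where
  "serves n M t \<longleftrightarrow> (let k = n - vec_space.rank n M in
     Determinant.det (tape_pert n M t k) \<noteq> 0 \<and>
     (k < n \<longrightarrow> Determinant.det (tape_pert n M t (Suc k)) \<noteq> 0))"

text \<open>Union bound: a left and a right failure for each of the \<open>k\<close> rank-raising
  steps, and one more event for passing from \<open>k\<close> to \<open>k + 1\<close>.\<close>

lemma prob_not_serves: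
  assumes E: "finite E" "E \<noteq> {}" and M: "(M :: 'a::field mat) \<in> carrier_mat n n"
  shows "tape_prob n E {t. \<not> serves n M t} \<le> 2 * real n / real (card E)"
proof -
  let ?P = "tape_prob n E"
  define k where "k = n - vec_space.rank n M"
  define BL where "BL j = {t. Determinant.det (tape_pert n M t j) = 0 \<and>
       (\<Sum>i<n. left_ker n (tape_pert n M t j) i * tape_x n t j i) = 0}" for j
  define BR where "BR j = {t. Determinant.det (tape_pert n M t j) = 0 \<and>
       (\<Sum>i<n. right_ker n (tape_pert n M t j) i * tape_y n t j i) = 0}" for j
  define BN where "BN = {t. k < n \<and> Determinant.det (tape_pert n M t k) \<noteq> 0 \<and> Determinant.det (tape_pert n M t (Suc k)) = 0}"
  have rn: "vec_space.rank n M \<le> n" using vec_space.rank_le_nc[OF M] .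
  have sub: "{t. \<not> serves n M t} \<subseteq> (\<Union>j<k. BL j \<union> BR j) \<union> BN"
  proof (rule ccontr)
    assume "\<not> {t. \<not> serves n M t} \<subseteq> (\<Union>j<k. BL j \<union> BR j) \<union> BN"
    then obtain t where ns: "\<not> serves n M t" and nb: "\<And>j. j < k \<Longrightarrow> t \<notin> BL j" "\<And>j. j < k \<Longrightarrow> t \<notin> BR j" "t \<notin> BN"
      by auto
    have "vec_space.rank n (tape_pert n M t j) \<ge> vec_space.rank n M + j" if "j \<le> k" for j
      using that
    proof (induction j)
      case (Suc j)
      let ?A = "tape_pert n M t j"
      show ?case
      proof (cases "Determinant.det ?A = 0")
        case True
        have "vec_space.rank n ?A + 1 \<le> vec_space.rank n (?A + outer n n (tape_x n t j) (tape_y n t j))"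
        proof (rule rank_add_outer_increase[OF pert_carrier])
          show "(\<Sum>i<n. left_ker n ?A i * ?A $$ (i, l)) = 0" if "l < n" for l
            using left_ker(2)[OF pert_carrier True that] .
          show "(\<Sum>l<n. ?A $$ (i, l) * right_ker n ?A l) = 0" if "i < n" for i
            using right_ker(2)[OF pert_carrier True that] .
          show "(\<Sum>i<n. left_ker n ?A i * tape_x n t j i) \<noteq> 0"
            using nb(1)[of j] Suc.prems True by (auto simp: BL_def)
          show "(\<Sum>l<n. right_ker n ?A l * tape_y n t j l) \<noteq> 0"
            using nb(2)[of j] Suc.prems True by (auto simp: BR_def)
        qed
        then show ?thesis using Suc by (simp add: pert_Suc)
      next
        case False
        \<comment> \<open>This case is contradictory: \<open>j\<close> rank-one summands reach rank
          at most \<open>rank M + j\<close>, which is still below \<open>n\<close> for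
          \<open>j < k\<close>.\<close>
        then have "vec_space.rank n ?A = n" using vec_space.det_rank_iff[OF pert_carrier] by metis
        moreover have "vec_space.rank n ?A \<le> vec_space.rank n M + j" by (rule rank_pert_le[OF M])
        ultimately show ?thesis using Suc.prems rn by (simp add: k_def)
      qed
    qed (simp add: pert_0 M)
    from this[of k] have "vec_space.rank n (tape_pert n M t k) \<ge> n" using rn by (simp add: k_def)
    then have "vec_space.rank n (tape_pert n M t k) = n"
      using vec_space.rank_le_nc[OF pert_carrier] by (metis le_antisym)
    then have "Determinant.det (tape_pert n M t k) \<noteq> 0" using vec_space.det_rank_iff[OF pert_carrier] by metis
    then show False using ns nb(3) by (auto simp: serves_def k_def BN_def Let_def)
  qed
  have 1: "?P (BL j) \<le> 1 / real (card E)" "?P (BR j) \<le> 1 / real (card E)" if "j < k" for j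
    unfolding BL_def BR_def using that by (auto intro!: prob_left prob_right E simp: k_def)
  have 2: "?P (BL j \<union> BR j) \<le> 2 / real (card E)" if "j < k" for j
  proof -
    have "?P (BL j \<union> BR j) \<le> ?P (BL j) + ?P (BR j)" by (rule measure_Un_le) auto
    then show ?thesis using 1[OF that] by simp
  qed
  have 3: "?P (\<Union>j<k. BL j \<union> BR j) \<le> 2 * real k / real (card E)"
  proof -
    have "?P (\<Union>j<k. BL j \<union> BR j) \<le> (\<Sum>j<k. ?P (BL j \<union> BR j))"
      by (rule measure_pmf.finite_measure_subadditive_finite) auto
    also have "\<dots> \<le> (\<Sum>j<k. 2 / real (card E))" by (intro sum_mono 2) simp
    finally show ?thesis by (simp add: mult.commute)
  qed
  \<comment> \<open>The extra event fits into what the steps leave of the budget \<open>2 n\<close>: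
    for \<open>k < n\<close> at least 2 units remain, and for \<open>k = n\<close> the event is
    empty.\<close>
  have 4: "?P BN \<le> (2 * real n - 2 * real k) / real (card E)"
  proof (cases "k < n")
    case True
    have "?P BN \<le> 1 / real (card E)" using prob_next[OF E True, of M] True by (simp add: BN_def)
    also have "\<dots> \<le> (2 * real n - 2 * real k) / real (card E)"
      using True by (intro divide_right_mono) auto
    finally show ?thesis .
  next
    case False
    then show ?thesis by (simp add: BN_def k_def)
  qed
  have "?P {t. \<not> serves n M t} \<le> ?P ((\<Union>j<k. BL j \<union> BR j) \<union> BN)"
    by (rule measure_pmf.finite_measure_mono[OF sub]) auto
  also have "\<dots> \<le> ?P (\<Union>j<k. BL j \<union> BR j) + ?P BN" by (rule measure_Un_le) auto
  also have "\<dots> \<le> 2 * real k / real (card E) + (2 * real n - 2 * real k) / real (card E)"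
    using 3 4 by linarith
  also have "\<dots> = 2 * real n / real (card E)" by (simp flip: add_divide_distrib)
  finally show ?thesis .
qed

section \<open>Programs\<close>

subsection \<open>Time-bounded execution\<close>

inductive_cases exec_InstrE: "exec inp (Instr i) s t s'"
inductive_cases exec_SeqE: "exec inp (Seq c c') s t s'"
inductive_cases exec_IfE: "exec inp (If b c c') s t s'"
inductive_cases exec_WhileE: "exec inp (While b c) s t s'"

lemma exec_det: "exec inp c s t s' \<Longrightarrow> exec inp c s t' s'' \<Longrightarrow> t' = t \<and> s'' = s'"
proof (induction arbitrary: t' s'' rule: exec.induct)
  case (exec_Instr i s)
  then show ?case by (auto elim: exec_InstrE)
next
  case exec_Seq
  show ?case by (rule exec_SeqE[OF exec_Seq.prems]) (auto simp: exec_Seq.hyps dest!: exec_Seq.IH)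
next
  case exec_If_True
  show ?case by (rule exec_IfE[OF exec_If_True.prems]) (auto simp: exec_If_True.hyps dest!: exec_If_True.IH)
next
  case exec_If_False
  show ?case by (rule exec_IfE[OF exec_If_False.prems]) (auto simp: exec_If_False.hyps dest!: exec_If_False.IH)
next
  case exec_While_False
  show ?case by (rule exec_WhileE[OF exec_While_False.prems]) (auto simp: exec_While_False.hyps)
next
  case exec_While_True
  show ?case by (rule exec_WhileE[OF exec_While_True.prems]) (auto simp: exec_While_True.hyps dest!: exec_While_True.IH)
qed

lemma exec_pos: "exec inp c s t s' \<Longrightarrow> 0 < t"
  by (induction rule: exec.induct) auto

definition runs :: "'a::field input \<Rightarrow> 'a com \<Rightarrow> 'a state \<Rightarrow> nat \<Rightarrow> ('a state \<Rightarrow> bool) \<Rightarrow> bool" where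
  "runs inp c S b Q \<longleftrightarrow> (\<exists>t S'. exec inp c S t S' \<and> t \<le> b \<and> Q S')"

lemma runs_mono: "runs inp c S b Q \<Longrightarrow> b \<le> b' \<Longrightarrow> (\<And>S'. Q S' \<Longrightarrow> Q' S') \<Longrightarrow> runs inp c S b' Q'"
  by (fastforce simp: runs_def)

lemma runs_Seq:
  "runs inp c S b P \<Longrightarrow> (\<And>S'. P S' \<Longrightarrow> runs inp c' S' b' Q) \<Longrightarrow> b + b' \<le> B \<Longrightarrow> runs inp (Seq c c') S B Q"
  unfolding runs_def by (meson add_mono exec_Seq le_trans)

lemma runs_Seq_det:
  "runs inp c' S1 b' Q \<Longrightarrow> runs inp c S b (\<lambda>S'. S' = S1) \<Longrightarrow> b + b' \<le> B \<Longrightarrow> runs inp (Seq c c') S B Q"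
  by (rule runs_Seq[where P = "\<lambda>S'. S' = S1"]) auto

lemma runs_If_True: "holds b S \<Longrightarrow> runs inp c S B Q \<Longrightarrow> Suc B \<le> B' \<Longrightarrow> runs inp (If b c c') S B' Q"
  unfolding runs_def by (metis Suc_eq_plus1 add_le_mono1 exec_If_True le_trans)

lemma runs_If_False: "\<not> holds b S \<Longrightarrow> runs inp c' S B Q \<Longrightarrow> Suc B \<le> B' \<Longrightarrow> runs inp (If b c c') S B' Q"
  unfolding runs_def by (metis Suc_eq_plus1 add_le_mono1 exec_If_False le_trans)

lemma runs_While_False: "\<not> holds b S \<Longrightarrow> Q S \<Longrightarrow> 1 \<le> B \<Longrightarrow> runs inp (While b c) S B Q"
  unfolding runs_def by (blast intro: exec_While_False)

lemma runs_While_True: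
  assumes "holds b S" "runs inp c S B P" "\<And>S'. P S' \<Longrightarrow> runs inp (While b c) S' B' Q" "B + B' + 1 \<le> B''"
  shows "runs inp (While b c) S B'' Q"
proof -
  obtain t S' where 1: "exec inp c S t S'" "t \<le> B" "P S'" using assms(2) by (auto simp: runs_def)
  obtain t' S'' where 2: "exec inp (While b c) S' t' S''" "t' \<le> B'" "Q S''"
    using assms(3)[OF 1(3)] by (auto simp: runs_def)
  have "exec inp (While b c) S (t + t' + 1) S''" by (rule exec_While_True[OF assms(1) 1(1) 2(1)])
  then show ?thesis using 1 2 assms(4) by (auto simp: runs_def intro!: exI[of _ "t + t' + 1"])
qed

lemma runs_For_sum:
  assumes "\<And>S i. J i S \<Longrightarrow> i \<le> N \<Longrightarrow> holds b S \<longleftrightarrow> i < N"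
    and "\<And>S i. J i S \<Longrightarrow> i < N \<Longrightarrow> runs inp c S (B i) (J (Suc i))"
    and "J 0 S" "(\<Sum>i<N. B i + 1) + 1 \<le> B'" "\<And>S'. J N S' \<Longrightarrow> Q S'"
  shows "runs inp (While b c) S B' Q"
proof -
  have "runs inp (While b c) S ((\<Sum>l\<in>{i..<N}. B l + 1) + 1) Q" if "i \<le> N" "J i S" for i S
    using that
  proof (induction "N - i" arbitrary: i S)
    case 0
    then show ?case using assms(1)[of i S] assms(5) by (auto intro!: runs_While_False)
  next
    case (Suc d)
    have "d = N - Suc i" using Suc.hyps(2) by simp
    have i: "i < N" using Suc.hyps(2) by auto
    show ?case
    proof (rule runs_While_True)
      show "holds b S" using assms(1)[OF Suc.prems(2)] i by simp
      show "runs inp c S (B i) (J (Suc i))" using assms(2)[OF Suc.prems(2)] i by simp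
      show "runs inp (While b c) S' ((\<Sum>l\<in>{Suc i..<N}. B l + 1) + 1) Q" if "J (Suc i) S'" for S'
        using Suc.hyps(1)[OF \<open>d = N - Suc i\<close> _ that] i by simp
      show "B i + ((\<Sum>l\<in>{Suc i..<N}. B l + 1) + 1) + 1 \<le> (\<Sum>l\<in>{i..<N}. B l + 1) + 1"
        using i by (simp add: sum.atLeast_Suc_lessThan)
    qed
  qed
  from this[of 0 S] show ?thesis using assms(3,4) by (auto intro: runs_mono simp: lessThan_atLeast0)
qed

lemma runs_For:
  assumes "\<And>S i. J i S \<Longrightarrow> i \<le> N \<Longrightarrow> holds b S \<longleftrightarrow> i < N"
    and "\<And>S i. J i S \<Longrightarrow> i < N \<Longrightarrow> runs inp c S B (J (Suc i))"
    and "J 0 S" "N * (B + 1) + 1 \<le> B'" "\<And>S'. J N S' \<Longrightarrow> Q S'"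
  shows "runs inp (While b c) S B' Q"
  by (rule runs_For_sum[where J = J and B = "\<lambda>_. B" and N = N]) (use assms in auto)

fun loop_free :: "'a com \<Rightarrow> bool" where
  "loop_free (Instr i) \<longleftrightarrow> True"
| "loop_free (Seq c c') \<longleftrightarrow> loop_free c \<and> loop_free c'"
| "loop_free (If b c c') \<longleftrightarrow> loop_free c \<and> loop_free c'"
| "loop_free (While b c) \<longleftrightarrow> False"

fun ev :: "'a::field input \<Rightarrow> 'a com \<Rightarrow> 'a state \<Rightarrow> 'a state" where
  "ev inp (Instr i) S = step inp i S"
| "ev inp (Seq c c') S = ev inp c' (ev inp c S)"
| "ev inp (If b c c') S = (if holds b S then ev inp c S else ev inp c' S)"
| "ev inp (While b c) S = S"

text \<open>An upper bound on the running time of loop-free code; adding both branches of a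
  conditional merely overestimates.\<close>

fun cost :: "'a com \<Rightarrow> nat" where
  "cost (Instr i) = 1"
| "cost (Seq c c') = cost c + cost c'"
| "cost (If b c c') = cost c + cost c' + 1"
| "cost (While b c) = 0"

lemma runs_ev: "loop_free c \<Longrightarrow> cost c \<le> B \<Longrightarrow> Q (ev inp c S) \<Longrightarrow> runs inp c S B Q"
proof -
  have "loop_free c \<Longrightarrow> \<exists>t. exec inp c S t (ev inp c S) \<and> t \<le> cost c" for c S
  proof (induction c arbitrary: S)
    case (Instr i) show ?case using exec_Instr by force
  next
    case (Seq c c') then show ?case by simp (meson add_mono exec_Seq)
  next
    case (If b c c')
    show ?case
    proof (cases "holds b S")
      case True
      then obtain t where "exec inp c S t (ev inp c S)" "t \<le> cost c" using If by auto
      then show ?thesis using exec_If_True[OF True] True by (auto intro!: exI[of _ "t + 1"])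
    next
      case False
      then obtain t where "exec inp c' S t (ev inp c' S)" "t \<le> cost c'" using If by auto
      then show ?thesis using exec_If_False[OF False] False by (auto intro!: exI[of _ "t + 1"])
    qed
  qed simp
  then show "loop_free c \<Longrightarrow> cost c \<le> B \<Longrightarrow> Q (ev inp c S) \<Longrightarrow> runs inp c S B Q"
    unfolding runs_def by (meson le_trans)
qed

fun seqs :: "'a com list \<Rightarrow> 'a com" where
  "seqs [] = Instr (NLit 8 0)"
| "seqs [c] = c"
| "seqs (c # d # cs) = Seq c (seqs (d # cs))"

subsection \<open>Memory layout\<close>

text \<open>Cells below \<open>64\<close> are registers; \<open>0, \<dots>, 15\<close> are scratch. The rest of each memory consists of
  four interleaved tracks. Integer memory: \<open>0\<close> simulated memory, \<open>1\<close> and \<open>2\<close> addresses and old values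
  of the log of integer writes, \<open>3\<close> addresses of the log of field writes. Field memory: \<open>0\<close>
  simulated memory, \<open>1\<close> old values of the log of field writes, \<open>2\<close> the field part of the instance
  for \<open>g\<close>. Registers \<open>1\<close> and \<open>2\<close> hold the lengths of the logs.\<close>

definition trk :: "nat \<Rightarrow> nat \<Rightarrow> nat" where
  "trk j a = 4 * a + (64 + j)"

lemma trk_eq [simp]: "j < 4 \<Longrightarrow> j' < 4 \<Longrightarrow> trk j a = trk j' a' \<longleftrightarrow> j = j' \<and> a = a'"
  unfolding trk_def by presburger

lemma trk_reg [simp]: "r < 64 \<Longrightarrow> trk j a \<noteq> r" "r < 64 \<Longrightarrow> r \<noteq> trk j a"
  by (auto simp: trk_def)

definition track :: "nat \<Rightarrow> (nat \<Rightarrow> 'b) \<Rightarrow> nat \<Rightarrow> 'b" where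
  "track j m = (\<lambda>i. m (trk j i))"

lemma mem_trk: "nmem S (trk j i) = track j (nmem S) i" "fmem S (trk j i) = track j (fmem S) i"
  by (simp_all add: track_def)

lemma track_trk [simp]:
  "j < 4 \<Longrightarrow> j' < 4 \<Longrightarrow> track j (m(trk j' x := v)) = (if j = j' then (track j m)(x := v) else track j m)"
  by (auto simp: track_def)

lemma track_reg [simp]: "r < 64 \<Longrightarrow> track j (m(r := v)) = track j m"
  by (auto simp: track_def)

definition keep :: "(nat \<Rightarrow> 'b::zero) \<Rightarrow> nat \<Rightarrow> 'b" where
  "keep m = (\<lambda>r. if 16 \<le> r \<and> r < 64 then m r else 0)"

lemma keep_scratch [simp]: "r < 16 \<Longrightarrow> keep (m(r := v)) = keep m"
  by (auto simp: keep_def)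

lemma keep_trk [simp]: "keep (m(trk j x := v)) = keep m"
  by (auto simp: keep_def)

text \<open>What a simulation must leave alone: the registers from 16 on and the table holding the
  field part of the instance of \<open>g\<close>. Scratch registers, simulated memory and logs may
  change.\<close>

definition frame :: "'a::zero state \<Rightarrow> (nat \<Rightarrow> nat) \<times> (nat \<Rightarrow> 'a) \<times> (nat \<Rightarrow> 'a)" where
  "frame S = (keep (nmem S), keep (fmem S), track 2 (fmem S))"

lemma frame_reg:
  "frame S = frame S' \<Longrightarrow> 16 \<le> r \<Longrightarrow> r < 64 \<Longrightarrow> nmem S r = nmem S' r"
  "frame S = frame S' \<Longrightarrow> 16 \<le> r \<Longrightarrow> r < 64 \<Longrightarrow> fmem S r = fmem S' r"
  by (auto simp: frame_def keep_def dest: fun_cong[of _ _ r])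

lemma frame_table: "frame S = frame S' \<Longrightarrow> fmem S (trk 2 i) = fmem S' (trk 2 i)"
  by (auto simp: frame_def track_def dest: fun_cong[of _ _ i])

definition view :: "'a state \<Rightarrow> 'a state" where
  "view S = \<lparr>nmem = track 0 (nmem S), fmem = track 0 (fmem S)\<rparr>"

text \<open>The newest entry is restored first, so a cell written several times ends with its oldest
  logged value.\<close>

fun undo :: "nat \<Rightarrow> (nat \<Rightarrow> nat) \<Rightarrow> (nat \<Rightarrow> 'b) \<Rightarrow> (nat \<Rightarrow> 'b) \<Rightarrow> nat \<Rightarrow> 'b" where
  "undo 0 la lv m = m"
| "undo (Suc n) la lv m = undo n la lv (m(la n := lv n))"

lemma undo_beyond [simp]: "n \<le> k \<Longrightarrow> undo n (la(k := a)) (lv(k := v)) m = undo n la lv m"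
  by (induction n arbitrary: m) auto

definition undone :: "'a state \<Rightarrow> 'a state" where
  "undone S = \<lparr>nmem = undo (nmem S 1) (track 1 (nmem S)) (track 2 (nmem S)) (track 0 (nmem S)),
     fmem = undo (nmem S 2) (track 3 (nmem S)) (track 1 (fmem S)) (track 0 (fmem S))\<rparr>"

text \<open>The machine cannot multiply, so the factor 4 of the track address comes from doubling
  twice. Register 8 holds the offset.\<close>

definition addr :: "nat \<Rightarrow> nat \<Rightarrow> nat \<Rightarrow> 'a com" where
  "addr r j src = seqs [Instr (NAdd r src src), Instr (NAdd r r r), Instr (NLit 8 (64 + j)), Instr (NAdd r r 8)]"

lemma addr_ev [simp]:
  "r \<noteq> 8 \<Longrightarrow> ev inp (addr r j src) S = S\<lparr>nmem := (nmem S)(r := trk j (nmem S src), 8 := 64 + j)\<rparr>"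
  by (auto simp: addr_def trk_def fun_eq_iff intro!: arg_cong[where f = "\<lambda>m. S\<lparr>nmem := m\<rparr>"])

lemma addr_loop_free [simp]: "loop_free (addr r j src)" "cost (addr r j src) = 4" "set_com (addr r j src) = {}"
  by (auto simp: addr_def)

subsection \<open>Simulation with a log\<close>

definition nwrite :: "'a com" where
  "nwrite = seqs [addr 6 0 5, Instr (NLoad 9 6), addr 7 1 1, Instr (NStore 7 5),
     addr 7 2 1, Instr (NStore 7 9), Instr (NStore 6 4), Instr (NLit 8 1), Instr (NAdd 1 1 8)]"

definition fwrite :: "'a com" where
  "fwrite = seqs [addr 6 0 5, Instr (FLoad 2 6), addr 7 3 2, Instr (NStore 7 5),
     addr 7 1 2, Instr (FStore 7 2), Instr (FStore 6 1), Instr (NLit 8 1), Instr (NAdd 2 2 8)]"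

text \<open>\<open>undone\<close> is invariant because the fresh log entry is the first to be undone
  and restores precisely the overwritten value.\<close>

lemma nwrite_ev [simp]:
  "view (ev inp nwrite S) = (view S)\<lparr>nmem := (nmem (view S))(nmem S 5 := nmem S 4)\<rparr>"
  "undone (ev inp nwrite S) = undone S" "frame (ev inp nwrite S) = frame S"
  "nmem (ev inp nwrite S) 1 = Suc (nmem S 1)" "nmem (ev inp nwrite S) 2 = nmem S 2"
  "loop_free nwrite" "cost nwrite = 18" "set_com nwrite = {}"
  by (simp_all add: nwrite_def view_def undone_def frame_def mem_trk)

lemma fwrite_ev [simp]:
  "view (ev inp fwrite S) = (view S)\<lparr>fmem := (fmem (view S))(nmem S 5 := fmem S 1)\<rparr>"
  "undone (ev inp fwrite S) = undone S" "frame (ev inp fwrite S) = frame S"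
  "nmem (ev inp fwrite S) 1 = nmem S 1" "nmem (ev inp fwrite S) 2 = Suc (nmem S 2)"
  "loop_free fwrite" "cost fwrite = 18" "set_com fwrite = {}"
  by (simp_all add: fwrite_def view_def undone_def frame_def mem_trk)

text \<open>The simplifier must not rewrite register number \<open>1\<close> to \<open>Suc 0\<close>.\<close>

declare One_nat_def [simp del]

text \<open>\<open>ni\<close> and \<open>fi\<close> serve the simulated input instructions: they read the index from register \<open>3\<close> and
  return the value in integer register \<open>4\<close> or field register \<open>1\<close>.\<close>

fun comp_instr :: "'a::field com \<Rightarrow> 'a com \<Rightarrow> 'a instr \<Rightarrow> 'a com" where
  "comp_instr ni fi (NLit d c) = seqs [Instr (NLit 4 c), Instr (NLit 5 d), nwrite]"
| "comp_instr ni fi (NAdd d a b) = seqs [Instr (NAdd 4 (trk 0 a) (trk 0 b)), Instr (NLit 5 d), nwrite]"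
| "comp_instr ni fi (NSub d a b) = seqs [Instr (NSub 4 (trk 0 a) (trk 0 b)), Instr (NLit 5 d), nwrite]"
| "comp_instr ni fi (NLoad d a) = seqs [addr 3 0 (trk 0 a), Instr (NLoad 4 3), Instr (NLit 5 d), nwrite]"
| "comp_instr ni fi (NStore d a) = seqs [Instr (NLit 8 0), Instr (NAdd 4 (trk 0 a) 8),
     Instr (NAdd 5 (trk 0 d) 8), nwrite]"
| "comp_instr ni fi (NInput d a) = seqs [Instr (NLit 8 0), Instr (NAdd 3 (trk 0 a) 8), ni, Instr (NLit 5 d), nwrite]"
| "comp_instr ni fi (FLit d c) = seqs [Instr (FLit 1 c), Instr (NLit 5 d), fwrite]"
| "comp_instr ni fi (FOp h d a b) = seqs [Instr (FOp h 1 (trk 0 a) (trk 0 b)), Instr (NLit 5 d), fwrite]"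
| "comp_instr ni fi (FLoad d a) = seqs [addr 3 0 (trk 0 a), Instr (FLoad 1 3), Instr (NLit 5 d), fwrite]"
| "comp_instr ni fi (FStore d a) = seqs [Instr (FLit 2 0), Instr (FOp FPlus 1 (trk 0 a) 2), Instr (NLit 8 0),
     Instr (NAdd 5 (trk 0 d) 8), fwrite]"
| "comp_instr ni fi (FInput d a) = seqs [Instr (NLit 8 0), Instr (NAdd 3 (trk 0 a) 8), fi, Instr (NLit 5 d), fwrite]"
| "comp_instr ni fi (FRandom d a) = seqs [Instr (FLit 1 0), Instr (NLit 5 d), fwrite]"

fun comp_cond :: "cond \<Rightarrow> cond" where
  "comp_cond (NLess a b) = NLess (trk 0 a) (trk 0 b)"
| "comp_cond (NEq a b) = NEq (trk 0 a) (trk 0 b)"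
| "comp_cond (FEq a b) = FEq (trk 0 a) (trk 0 b)"

fun comp :: "'a::field com \<Rightarrow> 'a com \<Rightarrow> 'a com \<Rightarrow> 'a com" where
  "comp ni fi (Instr i) = comp_instr ni fi i"
| "comp ni fi (Seq c c') = Seq (comp ni fi c) (comp ni fi c')"
| "comp ni fi (If b c c') = If (comp_cond b) (comp ni fi c) (comp ni fi c')"
| "comp ni fi (While b c) = While (comp_cond b) (comp ni fi c)"

text \<open>The integer registers that an input server may overwrite: index, result, and two for
  address computations.\<close>

definition io_regs :: "nat set" where
  "io_regs = {3, 4, 8, 10}"

definition served :: "'a state \<Rightarrow> nat \<Rightarrow> 'a state \<Rightarrow> bool" where
  "served S v S' \<longleftrightarrow> (\<exists>m. S' = S\<lparr>nmem := m\<rparr> \<and> m 4 = v \<and> (\<forall>r. r \<notin> io_regs \<longrightarrow> m r = nmem S r))"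

definition served_field :: "'a state \<Rightarrow> 'a \<Rightarrow> 'a state \<Rightarrow> bool" where
  "served_field S v S' \<longleftrightarrow>
     (\<exists>m. S' = S\<lparr>nmem := m, fmem := (fmem S)(1 := v)\<rparr> \<and> (\<forall>r. r \<notin> io_regs \<longrightarrow> m r = nmem S r))"

text \<open>The servers are called in the middle of a simulation, when nothing but the frame of the
  starting state is known to persist; hence the quantification over all states with that
  frame.\<close>

definition serves_inputs :: "'a::field input \<Rightarrow> 'a input \<Rightarrow> 'a com \<Rightarrow> 'a com \<Rightarrow> nat \<Rightarrow> 'a state \<Rightarrow> bool" where
  "serves_inputs inp' inp ni fi W S0 \<longleftrightarrow> (\<forall>S. frame S = frame S0 \<longrightarrow>
     runs inp' ni S W (served S (nin inp (nmem S 3))) \<and>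
     runs inp' fi S W (served_field S (fin inp (nmem S 3))))"

lemma serves_inputs_frame: "serves_inputs inp' inp ni fi W S \<Longrightarrow> frame S' = frame S \<Longrightarrow> serves_inputs inp' inp ni fi W S'"
  by (simp add: serves_inputs_def)

lemma holds_comp_cond [simp]: "holds (comp_cond b) S \<longleftrightarrow> holds b (view S)"
  by (cases b) (auto simp: view_def track_def)

lemma view_sel: "nmem (view S) a = nmem S (trk 0 a)" "fmem (view S) a = fmem S (trk 0 a)"
  by (simp_all add: view_def track_def)

text \<open>Each log grows by at most one entry per simulated step, which later bounds the time for
  undoing by the time of the simulated run.\<close>

definition simulates :: "'a::field state \<Rightarrow> nat \<Rightarrow> 'a state \<Rightarrow> 'a state \<Rightarrow> bool" where
  "simulates S t s' S' \<longleftrightarrow> view S' = s' \<and> undone S' = undone S \<and> frame S' = frame S \<and>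
     nmem S' 1 \<le> nmem S 1 + t \<and> nmem S' 2 \<le> nmem S 2 + t"

lemma io_regs_keep:
  assumes "\<forall>r. r \<notin> io_regs \<longrightarrow> m r = m' r"
  shows "track j m = track j m'" "keep m = keep m'" "m 1 = m' 1" "m 2 = m' 2" "m 5 = m' 5"
  using assms by (auto simp: track_def keep_def io_regs_def fun_eq_iff)

lemma io_regs_frame:
  assumes "S' = S\<lparr>nmem := m\<rparr> \<or> S' = S\<lparr>nmem := m, fmem := (fmem S)(1 := v)\<rparr>" "\<forall>r. r \<notin> io_regs \<longrightarrow> m r = nmem S r"
  shows "view S' = view S" "undone S' = undone S" "frame S' = frame S" "nmem S' 1 = nmem S 1" "nmem S' 2 = nmem S 2"
  using assms(1) io_regs_keep[OF assms(2)] by (auto simp: view_def undone_def frame_def)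

lemma runs_input:
  assumes "runs inp (srv :: 'a::field com) (S\<lparr>nmem := (nmem S)(8 := 0, 3 := nmem S (trk 0 a))\<rparr>) W P"
    and "\<And>S'. P S' \<Longrightarrow> Q (ev inp wr (S'\<lparr>nmem := (nmem S')(5 := d)\<rparr>))" "loop_free wr" "cost wr = 18"
  shows "runs inp (seqs [Instr (NLit 8 0), Instr (NAdd 3 (trk 0 a) 8), srv, Instr (NLit 5 d), wr]) S (W + 26) Q"
proof -
  have "runs inp (Seq srv (Seq (Instr (NLit 5 d)) wr)) (S\<lparr>nmem := (nmem S)(8 := 0, 3 := nmem S (trk 0 a))\<rparr>) (W + 19) Q"
    by (rule runs_Seq[OF assms(1), where b' = 19]) (use assms(2-4) in \<open>auto intro!: runs_ev\<close>)
  then have "runs inp (Seq (Instr (NAdd 3 (trk 0 a) 8)) (Seq srv (Seq (Instr (NLit 5 d)) wr)))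
      (S\<lparr>nmem := (nmem S)(8 := 0)\<rparr>) (W + 20) Q"
    by (rule runs_Seq_det[where b = 1]) (auto intro!: runs_ev)
  then show ?thesis
    unfolding seqs.simps by (rule runs_Seq_det[where b = 1]) (auto intro!: runs_ev)
qed

text \<open>\<open>A\<close> is deterministic and runs on the zero tape, hence
  \<open>FRandom\<close> compiles to the literal 0; the real tape supplies \<open>X\<close> and
  \<open>Y\<close> only. Besides an input server the longest translation takes 24 steps, so
  \<open>W + 26\<close> covers every instruction.\<close>

lemma comp_instr_sim:
  assumes serve: "serves_inputs inp' inp ni fi W S" and rnd: "rnd inp = (\<lambda>_. 0)"
  shows "runs inp' (comp_instr ni fi i) S (W + 26) (simulates S 1 (step inp i (view S)))"
proof -
  let ?S = "\<lambda>a. S\<lparr>nmem := (nmem S)(8 := 0, 3 := nmem S (trk 0 a))\<rparr>"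
  have "frame (?S a) = frame S" for a by (simp add: frame_def)
  then have srv: "runs inp' ni (?S a) W (served (?S a) (nin inp (nmem (?S a) 3)))"
      "runs inp' fi (?S a) W (served_field (?S a) (fin inp (nmem (?S a) 3)))" for a
    using serve unfolding serves_inputs_def by blast+
  have reg: "view (S'\<lparr>nmem := (nmem S')(5 := d)\<rparr>) = view S'" "undone (S'\<lparr>nmem := (nmem S')(5 := d)\<rparr>) = undone S'"
    "frame (S'\<lparr>nmem := (nmem S')(5 := d)\<rparr>) = frame S'" for S' :: "'a state" and d
    by (simp_all add: view_def undone_def frame_def)
  show ?thesis
  proof (cases i)
    case (NInput d a)
    show ?thesis
      unfolding NInput comp_instr.simps
    proof (rule runs_input[OF srv(1)])
      fix S' assume "served (?S a) (nin inp (nmem (?S a) 3)) S'"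
      then obtain m where m: "S' = S\<lparr>nmem := m\<rparr>" "m 4 = nin inp (nmem S (trk 0 a))" "\<forall>r. r \<notin> io_regs \<longrightarrow> m r = nmem S r"
        by (auto simp: served_def io_regs_def)
      then have "nmem S' 4 = nin inp (nmem S (trk 0 a))" by simp
      then show "simulates S 1 (step inp (NInput d a) (view S)) (ev inp' nwrite (S'\<lparr>nmem := (nmem S')(5 := d)\<rparr>))"
        using io_regs_frame[OF disjI1[OF m(1)] m(3)] by (simp add: simulates_def view_sel reg)
    qed simp_all
  next
    case (FInput d a)
    show ?thesis
      unfolding FInput comp_instr.simps
    proof (rule runs_input[OF srv(2)])
      fix S' assume "served_field (?S a) (fin inp (nmem (?S a) 3)) S'"
      then obtain m where m: "S' = S\<lparr>nmem := m, fmem := (fmem S)(1 := fin inp (nmem S (trk 0 a)))\<rparr>"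
          "\<forall>r. r \<notin> io_regs \<longrightarrow> m r = nmem S r"
        by (auto simp: served_field_def io_regs_def)
      then have "fmem S' 1 = fin inp (nmem S (trk 0 a))" by simp
      then show "simulates S 1 (step inp (FInput d a) (view S)) (ev inp' fwrite (S'\<lparr>nmem := (nmem S')(5 := d)\<rparr>))"
        using io_regs_frame[OF disjI2[OF m(1)] m(2)] by (simp add: simulates_def view_sel reg)
    qed simp_all
  qed ((rule runs_ev; simp add: simulates_def rnd), (simp add: view_def undone_def frame_def mem_trk)?)+
qed

text \<open>Conditions are tested directly on the cells of track 0 and control flow is copied, so
  costs and log lengths simply add up along the derivation of the execution.\<close>

lemma comp_sim:
  assumes "exec inp c s t s'" "rnd inp = (\<lambda>_. 0)" "serves_inputs inp' inp ni fi W S" "view S = s"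
  shows "runs inp' (comp ni fi c) S ((W + 26) * t) (simulates S t s')"
  using assms
proof (induction arbitrary: S rule: exec.induct)
  case (exec_Instr i s)
  then show ?case using comp_instr_sim[of inp' inp ni fi W S i] by simp
next
  case (exec_Seq c s t s1 c' t' s2)
  have "runs inp' (comp ni fi c) S ((W + 26) * t) (simulates S t s1)"
    using exec_Seq.IH(1) exec_Seq.prems by auto
  note first = this
  show ?case
    unfolding comp.simps
  proof (rule runs_Seq[OF first, where b' = "(W + 26) * t'"])
    fix S1 assume S1: "simulates S t s1 S1"
    then have "runs inp' (comp ni fi c') S1 ((W + 26) * t') (simulates S1 t' s2)"
      using exec_Seq.prems by (intro exec_Seq.IH(2)) (auto simp: simulates_def intro: serves_inputs_frame)
    then show "runs inp' (comp ni fi c') S1 ((W + 26) * t') (simulates S (t + t') s2)"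
      by (rule runs_mono) (use S1 in \<open>auto simp: simulates_def\<close>)
  qed (simp add: algebra_simps)
next
  case (exec_If_True b s c t s' c')
  show ?case
    by (simp, rule runs_If_True, use exec_If_True in simp, rule runs_mono[OF exec_If_True.IH])
      (use exec_If_True.prems in \<open>auto simp: simulates_def algebra_simps\<close>)
next
  case (exec_If_False b s c' t s' c)
  show ?case
    by (simp, rule runs_If_False, use exec_If_False in simp, rule runs_mono[OF exec_If_False.IH])
      (use exec_If_False.prems in \<open>auto simp: simulates_def algebra_simps\<close>)
next
  case (exec_While_False b s c)
  then show ?case by (auto intro!: runs_While_False simp: simulates_def)
next
  case (exec_While_True b s c t s1 t' s2)
  have "runs inp' (comp ni fi c) S ((W + 26) * t) (simulates S t s1)"
    using exec_While_True.IH(1) exec_While_True.prems by auto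
  note first = this
  show ?case
    unfolding comp.simps
  proof (rule runs_While_True[OF _ first, where B' = "(W + 26) * t'"])
    fix S1 assume S1: "simulates S t s1 S1"
    then have "runs inp' (comp ni fi (While b c)) S1 ((W + 26) * t') (simulates S1 t' s2)"
      using exec_While_True.prems by (intro exec_While_True.IH(2)) (auto simp: simulates_def intro: serves_inputs_frame)
    then show "runs inp' (While (comp_cond b) (comp ni fi c)) S1 ((W + 26) * t') (simulates S (t + t' + 1) s2)"
      unfolding comp.simps by (rule runs_mono) (use S1 in \<open>auto simp: simulates_def\<close>)
  qed (use exec_While_True in \<open>auto simp: algebra_simps\<close>)
qed

text \<open>Emptying the logs makes the present simulated memory the checkpoint to which
  \<open>undo_prog\<close> returns.\<close>

definition attempt :: "'a::field com \<Rightarrow> 'a com \<Rightarrow> 'a com \<Rightarrow> 'a com" where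
  "attempt ni fi c = seqs [Instr (NLit 1 0), Instr (NLit 2 0), comp ni fi c]"

lemma attempt:
  assumes "exec inp c (view S) t s'" "rnd inp = (\<lambda>_. 0)" "serves_inputs inp' inp ni fi W S"
  shows "runs inp' (attempt ni fi c) S ((W + 26) * t + 2)
    (\<lambda>S'. view S' = s' \<and> undone S' = view S \<and> frame S' = frame S \<and> nmem S' 1 + nmem S' 2 \<le> 2 * t)"
proof -
  let ?S = "S\<lparr>nmem := (nmem S)(1 := 0, 2 := 0)\<rparr>"
  have f: "frame ?S = frame S" and v: "view ?S = view S" and u: "undone ?S = view S"
    by (simp_all add: frame_def view_def undone_def)
  have "runs inp' (comp ni fi c) ?S ((W + 26) * t) (simulates ?S t s')"
    using assms serves_inputs_frame[OF assms(3) f] v by (intro comp_sim) auto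
  then have *: "runs inp' (comp ni fi c) ?S ((W + 26) * t)
    (\<lambda>S'. view S' = s' \<and> undone S' = view S \<and> frame S' = frame S \<and> nmem S' 1 + nmem S' 2 \<le> 2 * t)"
    by (rule runs_mono) (auto simp: simulates_def f u)
  show ?thesis
    unfolding attempt_def seqs.simps
  proof (rule runs_Seq[where b = 1 and b' = "(W + 26) * t + 1"])
    show "runs inp' (Instr (NLit 1 0)) S 1 (\<lambda>S'. S' = S\<lparr>nmem := (nmem S)(1 := 0)\<rparr>)"
      by (rule runs_ev) auto
    fix S1 assume S1: "S1 = S\<lparr>nmem := (nmem S)(1 := 0)\<rparr>"
    show "runs inp' (Seq (Instr (NLit 2 0)) (comp ni fi c)) S1 ((W + 26) * t + 1)
      (\<lambda>S'. view S' = s' \<and> undone S' = view S \<and> frame S' = frame S \<and> nmem S' 1 + nmem S' 2 \<le> 2 * t)"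
    proof (rule runs_Seq[where b = 1 and b' = "(W + 26) * t"])
      show "runs inp' (Instr (NLit 2 0)) S1 1 (\<lambda>S'. S' = ?S)"
        by (rule runs_ev) (auto simp: S1)
    qed (use * in auto)
  qed auto
qed

definition pop_nat :: "'a::field com" where
  "pop_nat = seqs [Instr (NLit 8 1), Instr (NSub 1 1 8), addr 6 1 1, Instr (NLoad 5 6),
     addr 6 2 1, Instr (NLoad 4 6), addr 6 0 5, Instr (NStore 6 4)]"

definition pop_field :: "'a::field com" where
  "pop_field = seqs [Instr (NLit 8 1), Instr (NSub 2 2 8), addr 6 3 2, Instr (NLoad 5 6),
     addr 6 1 2, Instr (FLoad 1 6), addr 6 0 5, Instr (FStore 6 1)]"

definition undo_prog :: "'a::field com" where
  "undo_prog = seqs [Instr (NLit 10 0), While (NLess 10 1) pop_nat, While (NLess 10 2) pop_field]"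

text \<open>Popping an entry leaves \<open>undone\<close> unchanged; once both logs are empty,
  \<open>undone\<close> coincides with \<open>view\<close>.\<close>

lemma undo_prog:
  "runs inp undo_prog S (20 * (nmem S 1 + nmem S 2) + 3) (\<lambda>S'. view S' = undone S \<and> frame S' = frame S)"
proof -
  let ?P = "\<lambda>S S'. undone S' = undone S \<and> frame S' = frame S \<and> nmem S' 10 = 0"
  have n: "runs inp (While (NLess 10 1) pop_nat) S (20 * nmem S 1 + 1) (\<lambda>S'. ?P S S' \<and> nmem S' 1 = 0 \<and> nmem S' 2 = nmem S 2)"
    if "nmem S 10 = 0" for S
    using that
  proof (induction "nmem S 1" arbitrary: S)
    case 0
    then show ?case by (intro runs_While_False) auto
  next
    case (Suc k)
    show ?case
    proof (rule runs_While_True[where B' = "20 * k + 1" and B = 18])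
      show "runs inp pop_nat S 18 (\<lambda>S'. ?P S S' \<and> nmem S' 1 = k \<and> nmem S' 2 = nmem S 2)"
        by (rule runs_ev) (use Suc.hyps(2)[symmetric] Suc.prems in \<open>auto simp: pop_nat_def pop_field_def undone_def frame_def mem_trk\<close>)
      fix S' assume "?P S S' \<and> nmem S' 1 = k \<and> nmem S' 2 = nmem S 2"
      then show "runs inp (While (NLess 10 1) pop_nat) S' (20 * k + 1) (\<lambda>S'. ?P S S' \<and> nmem S' 1 = 0 \<and> nmem S' 2 = nmem S 2)"
        using Suc.hyps(1)[of S'] by auto
    qed (use Suc in \<open>auto simp flip: Suc.hyps(2)\<close>)
  qed
  have f: "runs inp (While (NLess 10 2) pop_field) S (20 * nmem S 2 + 1) (\<lambda>S'. ?P S S' \<and> nmem S' 2 = 0 \<and> nmem S' 1 = nmem S 1)"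
    if "nmem S 10 = 0" for S
    using that
  proof (induction "nmem S 2" arbitrary: S)
    case 0
    then show ?case by (intro runs_While_False) auto
  next
    case (Suc k)
    show ?case
    proof (rule runs_While_True[where B' = "20 * k + 1" and B = 18])
      show "runs inp pop_field S 18 (\<lambda>S'. ?P S S' \<and> nmem S' 2 = k \<and> nmem S' 1 = nmem S 1)"
        by (rule runs_ev) (use Suc.hyps(2)[symmetric] Suc.prems in \<open>auto simp: pop_nat_def pop_field_def undone_def frame_def mem_trk\<close>)
      fix S' assume "?P S S' \<and> nmem S' 2 = k \<and> nmem S' 1 = nmem S 1"
      then show "runs inp (While (NLess 10 2) pop_field) S' (20 * k + 1) (\<lambda>S'. ?P S S' \<and> nmem S' 2 = 0 \<and> nmem S' 1 = nmem S 1)"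
        using Suc.hyps(1)[of S'] by auto
    qed (use Suc in \<open>auto simp flip: Suc.hyps(2)\<close>)
  qed
  show ?thesis
    unfolding undo_prog_def seqs.simps(2,3)
  proof (rule runs_Seq[where b = 1 and b' = "20 * (nmem S 1 + nmem S 2) + 2"])
    show "runs inp (Instr (NLit 10 0)) S 1 (\<lambda>S'. ?P S S' \<and> nmem S' 1 = nmem S 1 \<and> nmem S' 2 = nmem S 2)"
      by (rule runs_ev) (auto simp: undone_def frame_def)
    fix S1 assume S1: "?P S S1 \<and> nmem S1 1 = nmem S 1 \<and> nmem S1 2 = nmem S 2"
    show "runs inp (Seq (While (NLess 10 1) pop_nat) (While (NLess 10 2) pop_field)) S1 (20 * (nmem S 1 + nmem S 2) + 2)
        (\<lambda>S'. view S' = undone S \<and> frame S' = frame S)"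
    proof (rule runs_Seq[OF n[of S1], where b' = "20 * nmem S 2 + 1"])
      fix S2 assume S2: "?P S1 S2 \<and> nmem S2 1 = 0 \<and> nmem S2 2 = nmem S1 2"
      show "runs inp (While (NLess 10 2) pop_field) S2 (20 * nmem S 2 + 1) (\<lambda>S'. view S' = undone S \<and> frame S' = frame S)"
      proof (rule runs_mono[OF f[of S2]])
        fix S3 assume "?P S2 S3 \<and> nmem S3 2 = 0 \<and> nmem S3 1 = nmem S2 1"
        then show "view S3 = undone S \<and> frame S3 = frame S"
          using S1 S2 undone_def[of S3] by (auto simp: view_def)
      qed (use S1 S2 in auto)
    qed (use S1 in auto)
  qed simp
qed

subsection \<open>Serving the inputs of the simulated algorithm\<close>

text \<open>\<open>R\<close> gives the contents of the registers from \<open>16\<close> on.\<close>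

definition serves_list :: "'a::field input \<Rightarrow> 'a com \<Rightarrow> (nat \<Rightarrow> nat) \<Rightarrow> nat list \<Rightarrow> bool" where
  "serves_list inp c R L \<longleftrightarrow> loop_free c \<and>
     (\<forall>S. (\<forall>r. 16 \<le> r \<and> r < 64 \<longrightarrow> nmem S r = R r) \<longrightarrow> served S (nth_default 0 L (nmem S 3)) (ev inp c S))"

lemma served_trans:
  "served S1 v S' \<Longrightarrow> S1 = S\<lparr>nmem := m\<rparr> \<Longrightarrow> (\<And>r. r \<notin> io_regs \<Longrightarrow> m r = nmem S r) \<Longrightarrow> served S v S'"
  by (auto simp: served_def)

definition serve_nil :: "'a com" where
  "serve_nil = Instr (NLit 4 0)"

lemma serves_nil: "serves_list inp serve_nil R []"
  by (auto simp: serves_list_def serve_nil_def served_def io_regs_def)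

text \<open>A virtual input whose leading entries are contents of registers: the index in register 3
  is counted down until it is 0. Registers 27 and 35 hold the constants 0 and 1.\<close>

fun sel :: "nat list \<Rightarrow> 'a com \<Rightarrow> 'a com" where
  "sel [] c = c"
| "sel (r # rs) c = If (NEq 3 27) (Instr (NAdd 4 r 27)) (Seq (Instr (NSub 3 3 35)) (sel rs c))"

lemma serves_sel:
  assumes "serves_list inp c R L" "R 27 = 0" "R 35 = 1" "\<forall>r\<in>set rs. 16 \<le> r \<and> r < 64"
  shows "serves_list inp (sel rs c) R (map R rs @ L)"
  using assms(4)
proof (induction rs)
  case (Cons r rs)
  then have IH: "serves_list inp (sel rs c) R (map R rs @ L)" and r: "16 \<le> r" "r < 64" by auto
  show ?case
    unfolding serves_list_def
  proof (intro conjI allI impI)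
    show "loop_free (sel (r # rs) c)" using IH by (auto simp: serves_list_def)
    fix S :: "'a state" assume S: "\<forall>r. 16 \<le> r \<and> r < 64 \<longrightarrow> nmem S r = R r"
    then have z: "nmem S 27 = 0" "nmem S 35 = 1" using assms(2,3) by auto
    show "served S (nth_default 0 (map R (r # rs) @ L) (nmem S 3)) (ev inp (sel (r # rs) c) S)"
    proof (cases "nmem S 3")
      case 0
      then show ?thesis using z S r by (auto simp: served_def io_regs_def)
    next
      case (Suc i)
      let ?S = "S\<lparr>nmem := (nmem S)(3 := i)\<rparr>"
      have "served ?S (nth_default 0 (map R rs @ L) i) (ev inp (sel rs c) ?S)"
        using IH S unfolding serves_list_def by (auto dest!: spec[of _ ?S])
      then have "served S (nth_default 0 (map R rs @ L) i) (ev inp (sel rs c) ?S)"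
        by (rule served_trans[OF _ refl]) (auto simp: io_regs_def)
      then show ?thesis using z Suc by (simp add: nth_default_Cons_Suc)
    qed
  qed
qed (use assms in simp)

text \<open>A stretch of the virtual input that is copied from the real integer input, with its
  length and its offset there taken from registers.\<close>

definition seg :: "nat \<Rightarrow> nat \<Rightarrow> 'a com \<Rightarrow> 'a com" where
  "seg len off c = If (NLess 3 len) (Seq (Instr (NAdd 3 3 off)) (Instr (NInput 4 3)))
     (Seq (Instr (NSub 3 3 len)) c)"

lemma serves_seg:
  assumes c: "serves_list inp c R L" and regs: "16 \<le> len" "len < 64" "16 \<le> off" "off < 64"
    and D: "R len = length D" "\<And>i. i < length D \<Longrightarrow> nin inp (i + R off) = D ! i"
  shows "serves_list inp (seg len off c) R (D @ L)"
  unfolding serves_list_def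
proof (intro conjI allI impI)
  show "loop_free (seg len off c)" using c by (auto simp: serves_list_def seg_def)
  fix S :: "'a state" assume S: "\<forall>r. 16 \<le> r \<and> r < 64 \<longrightarrow> nmem S r = R r"
  show "served S (nth_default 0 (D @ L) (nmem S 3)) (ev inp (seg len off c) S)"
  proof (cases "nmem S 3 < length D")
    case True
    then show ?thesis using S regs D
      by (auto simp: seg_def served_def io_regs_def nth_default_def nth_append)
  next
    case False
    let ?S = "S\<lparr>nmem := (nmem S)(3 := nmem S 3 - length D)\<rparr>"
    have "served ?S (nth_default 0 L (nmem S 3 - length D)) (ev inp c ?S)"
      using c S unfolding serves_list_def by (auto dest!: spec[of _ ?S])
    then have "served S (nth_default 0 L (nmem S 3 - length D)) (ev inp c ?S)"
      by (rule served_trans[OF _ refl]) (auto simp: io_regs_def)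
    then show ?thesis using False S regs D(1) by (simp add: seg_def nth_default_append)
  qed
qed

abbreviation entries :: "'a mat list \<Rightarrow> 'a list" where
  "entries Ms \<equiv> concat (concat (map mat_to_list Ms))"

text \<open>The listing spells out the encoding of \<open>g\<close>: \<open>3 n\<close>,
  \<open>p + 3\<close>, \<open>q + 6\<close>; the given dimensions; those of \<open>P\<close>,
  \<open>Q\<close>, \<open>R\<close>; the prefix \<open>Add Mul Mul\<close> with leaf
  \<open>p\<close>; the tokens of \<open>f\<close>; and the leaves \<open>p + 1\<close> and
  \<open>p + 2\<close>. Token codes exceed leaf indices by 4.\<close>

definition ni_pre :: "'a com" where
  "ni_pre = sel [19, 20, 21] (seg 22 29 (sel [19, 16, 16, 19, 19, 19, 27, 28, 28, 23] (seg 18 36 (sel [24, 25] serve_nil))))"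
definition fi_pre :: "'a com" where
  "fi_pre = Seq (addr 10 2 3) (Instr (FLoad 1 10))"
definition ni_k :: "'a com" where
  "ni_k = sel [29, 26, 31, 31] serve_nil"
text \<open>Field register 17 holds 0, so adding it copies register 16; indices other than 0 yield
  0, as \<open>nth_default\<close> does.\<close>

definition fi_k :: "'a com" where
  "fi_k = If (NEq 3 27) (Instr (FOp FPlus 1 16 17)) (Instr (FOp FPlus 1 17 17))"
definition ni_upd :: "'a com" where
  "ni_upd = Instr (NInput 4 3)"
definition fi_upd :: "'a com" where
  "fi_upd = Instr (FInput 1 3)"

text \<open>\<open>p\<close> is the number of inputs and \<open>q\<close> the number of tokens of the formula \<open>f\<close>. The variable
  registers are \<open>30\<close> for \<open>k\<close>, \<open>32\<close> for the bound of \<open>k\<close> in the preprocessing loop, and integer register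
  \<open>31\<close> and field register \<open>16\<close> for the index and the new value of a diagonal entry of \<open>I\<^sub>k\<close>.\<close>

definition const_regs :: "nat \<Rightarrow> nat \<Rightarrow> nat \<Rightarrow> 'a::field state \<Rightarrow> bool" where
  "const_regs n p q S \<longleftrightarrow> nmem S 16 = n \<and> nmem S 17 = p \<and> nmem S 18 = q \<and> nmem S 19 = 3 * n \<and>
     nmem S 20 = p + 3 \<and> nmem S 21 = q + 6 \<and> nmem S 22 = 2 * p \<and> nmem S 23 = p + 4 \<and> nmem S 24 = p + 5 \<and>
     nmem S 25 = p + 6 \<and> nmem S 26 = p + 2 \<and> nmem S 27 = 0 \<and> nmem S 28 = 2 \<and> nmem S 29 = 3 \<and>
     nmem S 33 = n + 1 \<and> nmem S 34 = 2 * n \<and> nmem S 35 = 1 \<and> nmem S 36 = 2 * p + 3 \<and> fmem S 17 = 0"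

lemma const_regs_frame: "const_regs n p q S \<Longrightarrow> frame S' = frame S \<Longrightarrow> const_regs n p q S'"
  unfolding const_regs_def by (simp add: frame_reg[of S' S])

lemma serves_inputsI:
  assumes ni: "serves_list inp' ni (nmem S0) L" "cost ni \<le> W" "nin inp = nth_default 0 L"
    and fi: "\<And>S. frame S = frame S0 \<Longrightarrow> runs inp' fi S W (served_field S (fin inp (nmem S 3)))"
  shows "serves_inputs inp' inp ni fi W S0"
  unfolding serves_inputs_def
proof (intro allI impI conjI)
  fix S assume S: "frame S = frame S0"
  then have "served S (nth_default 0 L (nmem S 3)) (ev inp' ni S)"
    using ni(1) frame_reg[OF S] by (auto simp: serves_list_def)
  then show "runs inp' ni S W (served S (nin inp (nmem S 3)))"
    using ni by (intro runs_ev) (auto simp: serves_list_def)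
qed (rule fi)

lemma fin_update_state: "S\<lparr>fmem := g\<rparr> = S\<lparr>nmem := nmem S, fmem := g\<rparr>" for S :: "'a state"
  by (cases S) simp

lemma runs_fi:
  "loop_free c \<Longrightarrow> cost c \<le> W \<Longrightarrow> ev inp c S = S\<lparr>fmem := (fmem S)(1 := v)\<rparr> \<Longrightarrow> runs inp c S W (served_field S v)"
  by (rule runs_ev) (auto simp: served_field_def intro!: exI[of _ "nmem S"] fin_update_state)

lemma serves_pre:
  fixes Ms :: "'a::field mat list"
  assumes "const_regs n (length Ms) (length (tokens f)) S"
    and "\<And>i. fmem S (trk 2 i) = nth_default 0 (entries (g_inputs n X Y Ms k)) i"
  shows "serves_inputs (init_input t n f Ms)
    (init_input (\<lambda>_. 0) (3 * n) (g_formula (length Ms) f) (g_inputs n X Y Ms k)) ni_pre fi_pre 100 S"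
proof (rule serves_inputsI)
  let ?p = "length Ms" and ?q = "length (tokens f)"
  let ?D = "concat (map (\<lambda>M. [dim_row M, dim_col M]) Ms)"
  have lD: "length ?D = 2 * ?p" by (induction Ms) auto
  note c = assms(1)[unfolded const_regs_def]
  have "serves_list (init_input t n f Ms) (sel [24, 25] serve_nil) (nmem S) (map (nmem S) [24, 25] @ [])"
    by (rule serves_sel[OF serves_nil]) (use c in auto)
  then have "serves_list (init_input t n f Ms) (seg 18 36 (sel [24, 25] serve_nil)) (nmem S)
      (tokens f @ map (nmem S) [24, 25] @ [])"
  proof (rule serves_seg)
    fix i assume "i < length (tokens f)"
    then show "nin (init_input t n f Ms) (i + nmem S 36) = tokens f ! i"
      using c lD by (simp add: init_input_def nth_default_def nth_append)
  qed (use c in auto)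
  then have "serves_list (init_input t n f Ms) (sel [19, 16, 16, 19, 19, 19, 27, 28, 28, 23] (seg 18 36 (sel [24, 25] serve_nil))) (nmem S)
      (map (nmem S) [19, 16, 16, 19, 19, 19, 27, 28, 28, 23] @ tokens f @ map (nmem S) [24, 25] @ [])"
    by (rule serves_sel) (use c in auto)
  then have "serves_list (init_input t n f Ms) (seg 22 29 (sel [19, 16, 16, 19, 19, 19, 27, 28, 28, 23] (seg 18 36 (sel [24, 25] serve_nil)))) (nmem S)
      (?D @ map (nmem S) [19, 16, 16, 19, 19, 19, 27, 28, 28, 23] @ tokens f @ map (nmem S) [24, 25] @ [])"
  proof (rule serves_seg)
    fix i assume "i < length ?D"
    then show "nin (init_input t n f Ms) (i + nmem S 29) = ?D ! i"
      using c by (simp add: init_input_def nth_default_def nth_append)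
  qed (use c lD in auto)
  then show "serves_list (init_input t n f Ms) ni_pre (nmem S) (map (nmem S) [19, 20, 21] @ ?D @
      map (nmem S) [19, 16, 16, 19, 19, 19, 27, 28, 28, 23] @ tokens f @ map (nmem S) [24, 25] @ [])"
    unfolding ni_pre_def by (rule serves_sel) (use c in auto)
  show "nin (init_input (\<lambda>_. 0) (3 * n) (g_formula ?p f) (g_inputs n X Y Ms k)) = nth_default 0 (map (nmem S) [19, 20, 21] @ ?D @
      map (nmem S) [19, 16, 16, 19, 19, 19, 27, 28, 28, 23] @ tokens f @ map (nmem S) [24, 25] @ [])"
    using c by (auto simp: init_input_def g_formula_def g_inputs_def P_mat_def Q_mat_def R_mat_def
        intro!: arg_cong[where f = "nth_default 0"])
  fix S' assume S': "frame S' = frame S"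
  show "runs (init_input t n f Ms) fi_pre S' 100 (served_field S' (fin (init_input (\<lambda>_. 0) (3 * n) (g_formula ?p f) (g_inputs n X Y Ms k)) (nmem S' 3)))"
    using frame_table[OF S'] assms(2)
    by (intro runs_ev) (auto simp: fi_pre_def init_input_def io_regs_def served_field_def)
qed (simp add: ni_pre_def seg_def serve_nil_def)

lemma serves_k:
  assumes "const_regs n p q S" "nmem S 31 = j" "fmem S 16 = v"
  shows "serves_inputs inp (upd_input (\<lambda>_. 0) (Entry_Upd (p + 2) j j v)) ni_k fi_k 100 S"
proof (rule serves_inputsI)
  note c = assms[unfolded const_regs_def]
  show "serves_list inp ni_k (nmem S) (map (nmem S) [29, 26, 31, 31] @ [])"
    unfolding ni_k_def by (rule serves_sel[OF serves_nil]) (use c in auto)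
  show "nin (upd_input (\<lambda>_. 0) (Entry_Upd (p + 2) j j v)) = nth_default 0 (map (nmem S) [29, 26, 31, 31] @ [])"
    using c by (simp add: upd_input_def)
  fix S' assume S': "frame S' = frame S"
  have c': "const_regs n p q S'" "fmem S' 16 = v" using const_regs_frame[OF assms(1) S'] frame_reg[OF S'] assms by auto
  show "runs inp fi_k S' 100 (served_field S' (fin (upd_input (\<lambda>_. 0) (Entry_Upd (p + 2) j j v)) (nmem S' 3)))"
    using c'[unfolded const_regs_def]
    by (intro runs_fi) (auto simp: fi_k_def upd_input_def nth_default_def)
qed (simp add: ni_k_def serve_nil_def)

text \<open>\<open>P\<close>, \<open>Q\<close> and \<open>R\<close> are appended behind the inputs
  of \<open>f\<close>, so an update of \<open>f\<close> is literally an update of \<open>g\<close>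
  and can be passed on untranslated.\<close>

lemma serves_upd: "serves_inputs (upd_input t u) (upd_input (\<lambda>_. 0) u) ni_upd fi_upd 100 S"
  unfolding serves_inputs_def
proof (intro allI impI conjI)
  fix S' :: "'a state"
  show "runs (upd_input t u) ni_upd S' 100 (served S' (nin (upd_input (\<lambda>_. 0) u) (nmem S' 3)))"
    by (rule runs_ev) (auto simp: ni_upd_def upd_input_def io_regs_def served_def)
  show "runs (upd_input t u) fi_upd S' 100 (served_field S' (fin (upd_input (\<lambda>_. 0) u) (nmem S' 3)))"
    by (rule runs_fi) (auto simp: fi_upd_def upd_input_def)
qed

subsection \<open>Writing down the instance for $g$\<close>

text \<open>Starting from \<open>S0\<close>, the list \<open>L\<close> has been written to the instance track; register \<open>1\<close> counts its
  entries.\<close>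

definition emitted :: "'a::field state \<Rightarrow> 'a list \<Rightarrow> 'a state \<Rightarrow> bool" where
  "emitted S0 L S \<longleftrightarrow> nmem S 1 = length L \<and>
     (\<forall>i. fmem S (trk 2 i) = (if i < length L then L ! i else fmem S0 (trk 2 i))) \<and>
     (\<forall>a\<ge>16. nmem S a = nmem S0 a) \<and> (\<forall>a\<ge>16. (\<forall>i. a \<noteq> trk 2 i) \<longrightarrow> fmem S a = fmem S0 a)"

definition emit :: "'a com" where
  "emit = seqs [addr 9 2 1, Instr (FStore 9 1), Instr (NAdd 1 1 35)]"

lemma emit_simps [simp]: "loop_free emit" "cost emit = 6" "set_com emit = {}"
  by (simp_all add: emit_def)

lemma emit_ev:
  "emitted S0 L S \<Longrightarrow> nmem S0 35 = 1 \<Longrightarrow> emitted S0 (L @ [fmem S 1]) (ev inp emit S)"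
  unfolding emit_def emitted_def by (auto simp: nth_append less_Suc_eq)

lemma emit_nmem: "r \<notin> {1, 8, 9} \<Longrightarrow> nmem (ev inp emit S) r = nmem S r"
  by (simp add: emit_def)

text \<open>An entry program computes entry \<open>(i, j)\<close> of \<open>A\<close> into field register \<open>1\<close>, given \<open>i\<close>, \<open>j\<close> and
  \<open>i n\<close> in registers \<open>2\<close>, \<open>3\<close>, \<open>4\<close>; \<open>b\<close> entries precede the matrix \<open>A\<close> in the instance.\<close>

definition entry_prog :: "'a::field input \<Rightarrow> 'a state \<Rightarrow> nat \<Rightarrow> nat \<Rightarrow> 'a mat \<Rightarrow> 'a com \<Rightarrow> bool" where
  "entry_prog inp S0 n b A c \<longleftrightarrow> loop_free c \<and> cost c \<le> 40 \<and>
     (\<forall>S i j. nmem S 2 = i \<and> nmem S 3 = j \<and> nmem S 4 = i * n \<and> nmem S 1 = b + i * dim_col A + j \<and>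
        (\<forall>r. 16 \<le> r \<and> r < 64 \<longrightarrow> nmem S r = nmem S0 r) \<and> i < dim_row A \<and> j < dim_col A \<longrightarrow>
        (\<exists>m. ev inp c S = S\<lparr>nmem := m, fmem := (fmem S)(1 := A $$ (i, j))\<rparr> \<and> (\<forall>r. r \<noteq> 10 \<longrightarrow> m r = nmem S r)))"

definition emit_row :: "'a com \<Rightarrow> 'a com" where
  "emit_row c = While (NLess 3 6) (seqs [c, emit, Instr (NAdd 3 3 35)])"

text \<open>Register 4 advances by \<open>n\<close> per row, whatever the width of the matrix: it
  supplies \<open>i * n\<close>, which the machine cannot multiply out, for tape addresses in
  \<open>r_entry\<close>.\<close>

definition emit_mat :: "'a com \<Rightarrow> 'a com" where
  "emit_mat c = seqs [Instr (NLit 2 0), Instr (NLit 4 0),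
     While (NLess 2 5) (seqs [Instr (NLit 3 0), emit_row c, Instr (NAdd 2 2 35), Instr (NAdd 4 4 16)])]"

text \<open>\<open>x\<close> and \<open>y\<close> are the contents of registers 7 and 11, the input
  counter and the position in the dimension list of the enclosing loop
  \<open>emit_inputs\<close>.\<close>

definition row_state :: "'a::field state \<Rightarrow> nat \<Rightarrow> nat \<Rightarrow> nat \<Rightarrow> nat \<Rightarrow> 'a list \<Rightarrow> nat \<Rightarrow> nat \<Rightarrow> 'a state \<Rightarrow> bool" where
  "row_state S0 n nr nc i L x y S \<longleftrightarrow> emitted S0 L S \<and> nmem S 2 = i \<and> nmem S 4 = i * n \<and>
     nmem S 5 = nr \<and> nmem S 6 = nc \<and> nmem S 7 = x \<and> nmem S 11 = y"

lemma emit_row: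
  assumes c: "entry_prog inp S0 n b A c" and S0: "nmem S0 35 = 1"
    and i: "i < dim_row A" and b: "length L = b + i * dim_col A"
    and S: "row_state S0 n (dim_row A) (dim_col A) i L x y S" "nmem S 3 = 0"
  shows "runs inp (emit_row c) S (dim_col A * 48 + 1)
    (row_state S0 n (dim_row A) (dim_col A) i (L @ map (\<lambda>j. A $$ (i, j)) [0..<dim_col A]) x y)"
  unfolding emit_row_def
proof (rule runs_For[where N = "dim_col A" and B = 47 and
      J = "\<lambda>j S. row_state S0 n (dim_row A) (dim_col A) i (L @ map (\<lambda>j. A $$ (i, j)) [0..<j]) x y S \<and> nmem S 3 = j"])
  fix S j assume *: "row_state S0 n (dim_row A) (dim_col A) i (L @ map (\<lambda>j. A $$ (i, j)) [0..<j]) x y S \<and> nmem S 3 = j"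
    and j: "j < dim_col A"
  let ?L = "L @ map (\<lambda>j. A $$ (i, j)) [0..<j]"
  have "\<exists>m. ev inp c S = S\<lparr>nmem := m, fmem := (fmem S)(1 := A $$ (i, j))\<rparr> \<and> (\<forall>r. r \<noteq> 10 \<longrightarrow> m r = nmem S r)"
    using c[unfolded entry_prog_def, THEN conjunct2, THEN conjunct2, rule_format, of S i j] * i j b
    by (auto simp: row_state_def emitted_def)
  then obtain m where m: "ev inp c S = S\<lparr>nmem := m, fmem := (fmem S)(1 := A $$ (i, j))\<rparr>"
    "\<And>r. r \<noteq> 10 \<Longrightarrow> m r = nmem S r" by auto
  define S1 where "S1 = ev inp c S"
  have e1: "emitted S0 ?L S1" using * by (auto simp: S1_def m row_state_def emitted_def)
  have f1: "fmem S1 1 = A $$ (i, j)" by (simp add: S1_def m)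
  define S2 where "S2 = ev inp emit S1"
  have e2: "emitted S0 (L @ map (\<lambda>j. A $$ (i, j)) [0..<Suc j]) S2"
    using emit_ev[OF e1 S0, of inp] f1 by (simp add: S2_def)
  have r2: "nmem S2 r = nmem S r" if "r \<in> {2, 3, 4, 5, 6, 7, 11}" for r
    using that by (auto simp: S2_def emit_nmem S1_def m)
  have "nmem S2 35 = 1" using e2 S0 by (simp add: emitted_def)
  then have "emitted S0 (L @ map (\<lambda>j. A $$ (i, j)) [0..<Suc j]) (S2\<lparr>nmem := (nmem S2)(3 := nmem S2 3 + nmem S2 35)\<rparr>)"
    using e2 by (simp add: emitted_def)
  then show "runs inp (seqs [c, emit, Instr (NAdd 3 3 35)]) S 47
    (\<lambda>S. row_state S0 n (dim_row A) (dim_col A) i (L @ map (\<lambda>j. A $$ (i, j)) [0..<Suc j]) x y S \<and> nmem S 3 = Suc j)"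
    using c * r2 \<open>nmem S2 35 = 1\<close>
    by (intro runs_ev) (auto simp: entry_prog_def row_state_def S2_def[symmetric] S1_def[symmetric] simp del: upt_Suc)
qed (use S in \<open>auto simp: row_state_def\<close>)

lemma emit_mat:
  assumes c: "entry_prog inp S0 n (length L) A c" and S0: "nmem S0 35 = 1" "nmem S0 16 = n"
    and S: "emitted S0 L S" "nmem S 5 = dim_row A" "nmem S 6 = dim_col A" "nmem S 7 = x" "nmem S 11 = y"
  shows "runs inp (emit_mat c) S (dim_row A * (dim_col A * 48 + 5) + 3)
    (\<lambda>S'. emitted S0 (L @ concat (mat_to_list A)) S' \<and> nmem S' 7 = x \<and> nmem S' 11 = y)"
proof -
  let ?L = "\<lambda>i. L @ concat (map (\<lambda>i. map (\<lambda>j. A $$ (i, j)) [0..<dim_col A]) [0..<i])"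
  have len: "length (?L i) = length L + i * dim_col A" for i by (induction i) auto
  let ?S = "S\<lparr>nmem := (nmem S)(2 := 0, 4 := 0)\<rparr>"
  have S1: "row_state S0 n (dim_row A) (dim_col A) 0 (?L 0) x y ?S"
    using S by (auto simp: row_state_def emitted_def)
  have loop: "runs inp (While (NLess 2 5) (seqs [Instr (NLit 3 0), emit_row c, Instr (NAdd 2 2 35), Instr (NAdd 4 4 16)])) ?S
    (dim_row A * (dim_col A * 48 + 5) + 1)
    (\<lambda>S'. emitted S0 (L @ concat (mat_to_list A)) S' \<and> nmem S' 7 = x \<and> nmem S' 11 = y)"
  proof (rule runs_For[where N = "dim_row A" and B = "dim_col A * 48 + 4" and
      J = "\<lambda>i. row_state S0 n (dim_row A) (dim_col A) i (?L i) x y"])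
    fix S i assume *: "row_state S0 n (dim_row A) (dim_col A) i (?L i) x y S" and i: "i < dim_row A"
    let ?S' = "S\<lparr>nmem := (nmem S)(3 := 0)\<rparr>"
    have "row_state S0 n (dim_row A) (dim_col A) i (?L i) x y ?S'"
      using * by (auto simp: row_state_def emitted_def)
    then have row: "runs inp (emit_row c) ?S' (dim_col A * 48 + 1)
        (row_state S0 n (dim_row A) (dim_col A) i (?L i @ map (\<lambda>j. A $$ (i, j)) [0..<dim_col A]) x y)"
      by (intro emit_row[OF c S0(1) i len]) simp_all
    show "runs inp (seqs [Instr (NLit 3 0), emit_row c, Instr (NAdd 2 2 35), Instr (NAdd 4 4 16)]) S (dim_col A * 48 + 4)
       (row_state S0 n (dim_row A) (dim_col A) (Suc i) (?L (Suc i)) x y)"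
      unfolding seqs.simps
    proof (rule runs_Seq[where b = 1 and b' = "dim_col A * 48 + 3"])
      show "runs inp (Instr (NLit 3 0)) S 1 (\<lambda>S1. S1 = ?S')" by (rule runs_ev) auto
      fix S1 assume S1: "S1 = ?S'"
      show "runs inp (Seq (emit_row c) (Seq (Instr (NAdd 2 2 35)) (Instr (NAdd 4 4 16)))) S1 (dim_col A * 48 + 3)
       (row_state S0 n (dim_row A) (dim_col A) (Suc i) (?L (Suc i)) x y)"
        unfolding S1
      proof (rule runs_Seq[OF row, where b' = 2])
        fix S2 assume S2: "row_state S0 n (dim_row A) (dim_col A) i (?L i @ map (\<lambda>j. A $$ (i, j)) [0..<dim_col A]) x y S2"
        then have "nmem S2 35 = 1" "nmem S2 16 = n" using S0 by (auto simp: row_state_def emitted_def)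
        then show "runs inp (Seq (Instr (NAdd 2 2 35)) (Instr (NAdd 4 4 16))) S2 2
           (row_state S0 n (dim_row A) (dim_col A) (Suc i) (?L (Suc i)) x y)"
          using S2 by (intro runs_ev) (auto simp: row_state_def emitted_def)
      qed simp
    qed simp
  next
    fix S' assume "row_state S0 n (dim_row A) (dim_col A) (dim_row A) (?L (dim_row A)) x y S'"
    then show "emitted S0 (L @ concat (mat_to_list A)) S' \<and> nmem S' 7 = x \<and> nmem S' 11 = y"
      by (simp add: row_state_def mat_to_list_def)
  qed (use S1 in \<open>auto simp: row_state_def\<close>)
  show ?thesis
    unfolding emit_mat_def seqs.simps
  proof (rule runs_Seq[where b = 1 and b' = "dim_row A * (dim_col A * 48 + 5) + 2"])
    show "runs inp (Instr (NLit 2 0)) S 1 (\<lambda>S1. S1 = S\<lparr>nmem := (nmem S)(2 := 0)\<rparr>)" by (rule runs_ev) auto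
    fix S1 assume S1: "S1 = S\<lparr>nmem := (nmem S)(2 := 0)\<rparr>"
    show "runs inp (Seq (Instr (NLit 4 0)) (While (NLess 2 5) (Seq (Instr (NLit 3 0)) (Seq (emit_row c) (Seq (Instr (NAdd 2 2 35)) (Instr (NAdd 4 4 16))))))) S1
       (dim_row A * (dim_col A * 48 + 5) + 2)
       (\<lambda>S'. emitted S0 (L @ concat (mat_to_list A)) S' \<and> nmem S' 7 = x \<and> nmem S' 11 = y)"
    proof (rule runs_Seq[where b = 1 and b' = "dim_row A * (dim_col A * 48 + 5) + 1"])
      show "runs inp (Instr (NLit 4 0)) S1 1 (\<lambda>S1. S1 = ?S)" by (rule runs_ev) (auto simp: S1)
    qed (use loop in auto)
  qed auto
qed

section \<open>Row-by-row listings and the entry programs for the inputs, \<open>P\<close>,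
  \<open>Q\<close> and \<open>R\<close>\<close>

lemma length_concat_mat_to_list [simp]: "length (concat (mat_to_list A)) = dim_row A * dim_col A"
proof -
  have "length (concat (map (\<lambda>i. map (\<lambda>j. A $$ (i, j)) [0..<m]) [0..<k])) = k * m" for m k
    by (induction k) auto
  then show ?thesis by (simp add: mat_to_list_def)
qed

lemma concat_mat_to_list_nth:
  assumes "i < dim_row A" "j < dim_col A"
  shows "concat (mat_to_list A) ! (i * dim_col A + j) = A $$ (i, j)"
proof -
  have len: "length (concat (map (\<lambda>i. map (\<lambda>j. A $$ (i, j)) [0..<m]) [0..<k])) = k * m" for m k
    by (induction k) auto
  have "concat (map (\<lambda>i. map (\<lambda>j. A $$ (i, j)) [0..<m]) [0..<k]) ! (i * m + j) = A $$ (i, j)"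
    if "i < k" "j < m" for m k
    using that(1)
  proof (induction k)
    case (Suc k)
    show ?case
    proof (cases "i = k")
      case True
      then show ?thesis using that(2) by (simp add: nth_append len)
    next
      case False
      then have "i < k" using Suc.prems by simp
      then show ?thesis using Suc.IH row_major_less[OF _ that(2)] by (simp add: nth_append len)
    qed
  qed simp
  then show ?thesis using assms by (simp add: mat_to_list_def)
qed

lemma concat_pairs_nth:
  assumes "l < length Ms"
  shows "concat (map (\<lambda>M. [a M, b M]) Ms) ! (2 * l) = a (Ms ! l)"
    "concat (map (\<lambda>M. [a M, b M]) Ms) ! Suc (2 * l) = b (Ms ! l)"
    "length (concat (map (\<lambda>M. [a M, b M]) Ms)) = 2 * length Ms"
proof -
  show "concat (map (\<lambda>M. [a M, b M]) Ms) ! (2 * l) = a (Ms ! l)"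
    using assms by (induction Ms arbitrary: l) (auto simp: nth_Cons split: nat.splits)
  show "concat (map (\<lambda>M. [a M, b M]) Ms) ! Suc (2 * l) = b (Ms ! l)"
    using assms by (induction Ms arbitrary: l) (auto simp: nth_Cons split: nat.splits)
  show "length (concat (map (\<lambda>M. [a M, b M]) Ms)) = 2 * length Ms"
    by (induction Ms) auto
qed

definition copy_entry :: "'a com" where
  "copy_entry = Instr (FInput 1 1)"

definition unit_entry :: "'a::field com" where
  "unit_entry = If (NEq 2 3) (Instr (FLit 1 1)) (Instr (FLit 1 0))"

text \<open>Entry \<open>(i, n + j)\<close> of the \<open>X\<close> block is tape cell
  \<open>i * n + j\<close>, hence the subtraction of \<open>n\<close>. The \<open>Y\<close> block
  needs no correction: its row \<open>n + i\<close> yields \<open>(n + i) * n + j\<close>, which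
  already skips the \<open>n * n\<close> cells of \<open>X\<close>.\<close>

definition r_entry :: "'a::field com" where
  "r_entry = If (NLess 2 16)
     (If (NLess 3 16) (Instr (FLit 1 0))
       (If (NLess 3 34) (seqs [Instr (NAdd 10 4 3), Instr (NSub 10 10 16), Instr (FRandom 1 10)]) (Instr (FLit 1 0))))
     (If (NLess 2 34)
       (If (NLess 3 16) (seqs [Instr (NAdd 10 4 3), Instr (FRandom 1 10)])
         (If (NLess 3 34) (Instr (FLit 1 0))
           (seqs [Instr (NAdd 10 2 16), If (NEq 10 3) (Instr (FLit 1 1)) (Instr (FLit 1 0))])))
       (If (NLess 3 16) (Instr (FLit 1 0))
         (If (NLess 3 34) (seqs [Instr (NAdd 10 3 16), If (NEq 10 2) (Instr (FLit 1 1)) (Instr (FLit 1 0))])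
           (If (NEq 2 3) (seqs [Instr (NAdd 10 34 30), If (NLess 2 10) (Instr (FLit 1 1)) (Instr (FLit 1 0))])
              (Instr (FLit 1 0))))))"

lemma entry_progI:
  fixes inp :: "'a::field input"
  assumes "loop_free c" "cost c \<le> 40"
    "\<And>S i j. nmem S 2 = i \<Longrightarrow> nmem S 3 = j \<Longrightarrow> nmem S 4 = i * n \<Longrightarrow> nmem S 1 = b + i * dim_col A + j \<Longrightarrow>
        (\<And>r. 16 \<le> r \<Longrightarrow> r < 64 \<Longrightarrow> nmem S r = nmem S0 r) \<Longrightarrow> i < dim_row A \<Longrightarrow> j < dim_col A \<Longrightarrow>
        \<exists>x. ev inp c S = S\<lparr>nmem := (nmem S)(10 := x), fmem := (fmem S)(1 := A $$ (i, j))\<rparr>"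
  shows "entry_prog inp S0 n b A c"
  unfolding entry_prog_def
proof (intro conjI assms(1,2) allI impI)
  fix S :: "'a state" and i j
  assume "nmem S 2 = i \<and> nmem S 3 = j \<and> nmem S 4 = i * n \<and> nmem S 1 = b + i * dim_col A + j \<and>
        (\<forall>r. 16 \<le> r \<and> r < 64 \<longrightarrow> nmem S r = nmem S0 r) \<and> i < dim_row A \<and> j < dim_col A"
  then obtain x where "ev inp c S = S\<lparr>nmem := (nmem S)(10 := x), fmem := (fmem S)(1 := A $$ (i, j))\<rparr>"
    using assms(3)[of S i j] by auto
  then show "\<exists>m. ev inp c S = S\<lparr>nmem := m, fmem := (fmem S)(1 := A $$ (i, j))\<rparr> \<and> (\<forall>r. r \<noteq> 10 \<longrightarrow> m r = nmem S r)"
    by (intro exI[of _ "(nmem S)(10 := x)"]) simp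
qed

lemma fmem_only: "S\<lparr>fmem := g\<rparr> = S\<lparr>nmem := (nmem S)(10 := nmem S 10), fmem := g\<rparr>" for S :: "'a state"
  by (cases S) simp

lemma copy_entry:
  fixes inp :: "'a::field input"
  assumes "\<And>i j. i < dim_row A \<Longrightarrow> j < dim_col A \<Longrightarrow> fin inp (b + i * dim_col A + j) = A $$ (i, j)"
  shows "entry_prog inp S0 n b A copy_entry"
proof (rule entry_progI)
  fix S :: "'a state" and i j assume *: "nmem S 1 = b + i * dim_col A + j" "i < dim_row A" "j < dim_col A"
  then have "ev inp copy_entry S = S\<lparr>fmem := (fmem S)(1 := A $$ (i, j))\<rparr>"
    using assms by (simp add: copy_entry_def)
  then show "\<exists>x. ev inp copy_entry S = S\<lparr>nmem := (nmem S)(10 := x), fmem := (fmem S)(1 := A $$ (i, j))\<rparr>"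
    using fmem_only by metis
qed (simp_all add: copy_entry_def)

lemma unit_entry:
  fixes inp :: "'a::field input"
  assumes "\<And>i j. i < dim_row A \<Longrightarrow> j < dim_col A \<Longrightarrow> A $$ (i, j) = (if i = j then 1 else 0)"
  shows "entry_prog inp S0 n b A unit_entry"
proof (rule entry_progI)
  fix S :: "'a state" and i j assume *: "nmem S 2 = i" "nmem S 3 = j" "i < dim_row A" "j < dim_col A"
  then have "ev inp unit_entry S = S\<lparr>fmem := (fmem S)(1 := A $$ (i, j))\<rparr>"
    using assms by (auto simp: unit_entry_def)
  then show "\<exists>x. ev inp unit_entry S = S\<lparr>nmem := (nmem S)(10 := x), fmem := (fmem S)(1 := A $$ (i, j))\<rparr>"
    using fmem_only by metis
qed (simp_all add: unit_entry_def)

definition tape_X :: "nat \<Rightarrow> (nat \<Rightarrow> 'a) \<Rightarrow> 'a mat" where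
  "tape_X n t = mat n n (\<lambda>(i, j). t (i * n + j))"
definition tape_Y :: "nat \<Rightarrow> (nat \<Rightarrow> 'a) \<Rightarrow> 'a mat" where
  "tape_Y n t = mat n n (\<lambda>(i, j). t (n * n + (i * n + j)))"

lemma tape_XY_carrier [simp]: "tape_X n t \<in> carrier_mat n n" "tape_Y n t \<in> carrier_mat n n"
  by (simp_all add: tape_X_def tape_Y_def)

lemma R_mat_tape_index:
  assumes "i < 3 * n" "j < 3 * n"
  shows "R_mat n (tape_X n t) (tape_Y n t) k $$ (i, j) =
    (if i < n then (if j < n then 0 else if j < 2 * n then t (i * n + j - n) else 0)
     else if i < 2 * n then (if j < n then t (i * n + j) else if j < 2 * n then 0 else if i + n = j then 1 else 0)
     else (if j < n then 0 else if j < 2 * n then (if j + n = i then 1 else 0)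
       else if i = j then (if i < 2 * n + k then 1 else 0) else 0))"
proof -
  note R = R_mat_index[OF tape_XY_carrier(1)[of n t] tape_XY_carrier(2)[of n t]]
  have c: "x < n \<or> (\<exists>y<n. x = n + y) \<or> (\<exists>y<n. x = 2 * n + y)" if "x < 3 * n" for x
  proof -
    have "x < n \<or> (x - n < n \<and> x = n + (x - n)) \<or> (x - 2 * n < n \<and> x = 2 * n + (x - 2 * n))"
      using that by linarith
    then show ?thesis by blast
  qed
  have X: "tape_X n t $$ (x, y) = t (x * n + y)" "tape_Y n t $$ (x, y) = t ((n + x) * n + y)" if "x < n" "y < n" for x y
    using that by (simp_all add: tape_X_def tape_Y_def algebra_simps)
  consider "i < n" | i' where "i' < n" "i = n + i'" | i' where "i' < n" "i = 2 * n + i'"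
    using c[OF assms(1)] by blast
  then show ?thesis
  proof cases
    case 1
    consider "j < n" | j' where "j' < n" "j = n + j'" | j' where "j' < n" "j = 2 * n + j'"
      using c[OF assms(2)] by blast
    then show ?thesis using 1 by cases (simp_all add: R X)
  next
    case 2
    consider "j < n" | j' where "j' < n" "j = n + j'" | j' where "j' < n" "j = 2 * n + j'"
      using c[OF assms(2)] by blast
    then show ?thesis using 2 by cases (simp_all add: R X)
  next
    case 3
    consider "j < n" | j' where "j' < n" "j = n + j'" | j' where "j' < n" "j = 2 * n + j'"
      using c[OF assms(2)] by blast
    then show ?thesis using 3 by cases (simp_all add: R X)
  qed
qed

lemma r_entry:
  fixes inp :: "'a::field input"
  assumes "rnd inp = t" "nmem S0 16 = n" "nmem S0 34 = 2 * n" "nmem S0 30 = k"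
  shows "entry_prog inp S0 n b (R_mat n (tape_X n t) (tape_Y n t) k) r_entry"
proof (rule entry_progI)
  fix S :: "'a state" and i j
  assume *: "nmem S 2 = i" "nmem S 3 = j" "nmem S 4 = i * n" "\<And>r. 16 \<le> r \<Longrightarrow> r < 64 \<Longrightarrow> nmem S r = nmem S0 r"
    "i < dim_row (R_mat n (tape_X n t) (tape_Y n t) k)" "j < dim_col (R_mat n (tape_X n t) (tape_Y n t) k)"
  then have ij: "i < 3 * n" "j < 3 * n" by (simp_all add: R_mat_def)
  have r: "nmem S 16 = n" "nmem S 34 = 2 * n" "nmem S 30 = k" using *(4) assms by simp_all
  show "\<exists>x. ev inp r_entry S = S\<lparr>nmem := (nmem S)(10 := x),
      fmem := (fmem S)(1 := R_mat n (tape_X n t) (tape_Y n t) k $$ (i, j))\<rparr>"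
    unfolding R_mat_tape_index[OF ij]
  proof (intro exI)
    let ?x = "if i < n then (if j < n then nmem S 10 else if j < 2 * n then i * n + j - n else nmem S 10)
     else if i < 2 * n then (if j < n then i * n + j else if j < 2 * n then nmem S 10 else i + n)
     else (if j < n then nmem S 10 else if j < 2 * n then j + n
       else if i = j then 2 * n + k else nmem S 10)"
    show "ev inp r_entry S = S\<lparr>nmem := (nmem S)(10 := ?x), fmem := (fmem S)(1 :=
      (if i < n then (if j < n then 0 else if j < 2 * n then t (i * n + j - n) else 0)
     else if i < 2 * n then (if j < n then t (i * n + j) else if j < 2 * n then 0 else if i + n = j then 1 else 0)
     else (if j < n then 0 else if j < 2 * n then (if j + n = i then 1 else 0)
       else if i = j then (if i < 2 * n + k then 1 else 0) else 0)))\<rparr>"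
      by (intro state.equality) (use *(1-3) r assms(1) in \<open>auto simp: r_entry_def\<close>)
  qed
qed (simp_all add: r_entry_def)

definition read_dims :: "'a com" where
  "read_dims = seqs [Instr (NInput 5 11), Instr (NAdd 11 11 35), Instr (NInput 6 11), Instr (NAdd 11 11 35)]"

definition emit_inputs :: "'a com" where
  "emit_inputs = While (NLess 7 17) (Seq read_dims (Seq (emit_mat copy_entry) (Instr (NAdd 7 7 35))))"

definition emit_block :: "nat \<Rightarrow> nat \<Rightarrow> 'a com \<Rightarrow> 'a com" where
  "emit_block a b e = Seq (seqs [Instr (NAdd 5 a 27), Instr (NAdd 6 b 27)]) (emit_mat e)"

definition emit_all :: "'a::field com" where
  "emit_all = Seq (seqs [Instr (NLit 1 0), Instr (NLit 7 0), Instr (NLit 11 3)])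
     (Seq emit_inputs (Seq (emit_block 19 16 unit_entry) (Seq (emit_block 16 19 unit_entry) (emit_block 19 19 r_entry))))"

lemma emit_inputs:
  fixes Ms :: "'a::field mat list" and t n f
  defines "inp \<equiv> init_input t n f Ms"
  assumes S0: "const_regs n (length Ms) q S0" and S: "emitted S0 [] S" "nmem S 7 = 0" "nmem S 11 = 3"
  shows "runs inp emit_inputs S ((\<Sum>M\<leftarrow>Ms. dim_row M * (dim_col M * 48 + 5) + 9) + 1)
    (emitted S0 (entries Ms))"
  unfolding emit_inputs_def
proof (rule runs_For_sum[where N = "length Ms" and B = "\<lambda>l. dim_row (Ms ! l) * (dim_col (Ms ! l) * 48 + 5) + 8" and
      J = "\<lambda>l S. emitted S0 (entries (take l Ms)) S \<and> nmem S 7 = l \<and> nmem S 11 = 3 + 2 * l"])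
  note c = S0[unfolded const_regs_def]
  fix S :: "'a state" and l assume *: "emitted S0 (entries (take l Ms)) S \<and> nmem S 7 = l \<and> nmem S 11 = 3 + 2 * l"
    and l: "l < length Ms"
  let ?L = "entries (take l Ms)" and ?A = "Ms ! l"
  have nin: "nin inp (3 + 2 * l) = dim_row ?A" "nin inp (Suc (3 + 2 * l)) = dim_col ?A"
    using concat_pairs_nth[OF l, of dim_row dim_col] l
    by (simp_all add: inp_def init_input_def nth_default_def nth_append numeral_3_eq_3)
  have r: "nmem S 35 = 1" using * c by (auto simp: emitted_def)
  have Ms: "Ms = take l Ms @ ?A # drop (Suc l) Ms" using l by (rule id_take_nth_drop)
  have split: "entries Ms =
      ?L @ concat (mat_to_list ?A) @ entries (drop (Suc l) Ms)"
    using arg_cong[OF Ms, of "\<lambda>Ms. entries Ms"]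
    by (simp only: map_append concat_append list.map concat.simps)
  have "entry_prog inp S0 n (length ?L) ?A copy_entry"
  proof (rule copy_entry)
    fix i j assume ij: "i < dim_row ?A" "j < dim_col ?A"
    have b: "i * dim_col ?A + j < dim_row ?A * dim_col ?A" by (rule row_major_less[OF ij])
    have "fin inp (length ?L + i * dim_col ?A + j) =
        nth_default 0 (?L @ concat (mat_to_list ?A) @ entries (drop (Suc l) Ms)) (length ?L + (i * dim_col ?A + j))"
      by (simp add: inp_def init_input_def add.assoc split)
    also have "\<dots> = ?A $$ (i, j)"
      using b by (simp add: nth_default_append nth_default_nth concat_mat_to_list_nth[OF ij])
    finally show "fin inp (length ?L + i * dim_col ?A + j) = ?A $$ (i, j)" .
  qed
  note em = emit_mat[OF this]
  define S1 where "S1 = ev inp read_dims S"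
  have S1: "emitted S0 ?L S1" "nmem S1 5 = dim_row ?A" "nmem S1 6 = dim_col ?A" "nmem S1 7 = l" "nmem S1 11 = 3 + 2 * Suc l"
    using * r nin by (simp_all add: S1_def read_dims_def emitted_def)
  have em1: "runs inp (emit_mat copy_entry) S1 (dim_row ?A * (dim_col ?A * 48 + 5) + 3)
    (\<lambda>S'. emitted S0 (?L @ concat (mat_to_list ?A)) S' \<and> nmem S' 7 = l \<and> nmem S' 11 = 3 + 2 * Suc l)"
    by (rule em) (use S1 c in auto)
  have em2: "runs inp (Seq (emit_mat copy_entry) (Instr (NAdd 7 7 35))) S1 (dim_row ?A * (dim_col ?A * 48 + 5) + 4)
    (\<lambda>S. emitted S0 (entries (take (Suc l) Ms)) S \<and> nmem S 7 = Suc l \<and> nmem S 11 = 3 + 2 * Suc l)"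
  proof (rule runs_Seq[OF em1, where b' = 1])
    fix S2 assume S2: "emitted S0 (?L @ concat (mat_to_list ?A)) S2 \<and> nmem S2 7 = l \<and> nmem S2 11 = 3 + 2 * Suc l"
    then have "nmem S2 35 = 1" using c by (auto simp: emitted_def)
    then show "runs inp (Instr (NAdd 7 7 35)) S2 1
      (\<lambda>S. emitted S0 (entries (take (Suc l) Ms)) S \<and> nmem S 7 = Suc l \<and> nmem S 11 = 3 + 2 * Suc l)"
      using S2 l by (intro runs_ev) (auto simp: emitted_def take_Suc_conv_app_nth)
  qed simp
  have "runs inp read_dims S 4 (\<lambda>T. T = S1)"
    by (rule runs_ev) (auto simp: S1_def read_dims_def)
  then show "runs inp (Seq read_dims (Seq (emit_mat copy_entry) (Instr (NAdd 7 7 35)))) S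
     (dim_row (Ms ! l) * (dim_col (Ms ! l) * 48 + 5) + 8)
     (\<lambda>S. emitted S0 (entries (take (Suc l) Ms)) S \<and> nmem S 7 = Suc l \<and> nmem S 11 = 3 + 2 * Suc l)"
    by (rule runs_Seq) (use em2 in auto)
next
  show "(\<Sum>i<length Ms. dim_row (Ms ! i) * (dim_col (Ms ! i) * 48 + 5) + 8 + 1) + 1
    \<le> (\<Sum>M\<leftarrow>Ms. dim_row M * (dim_col M * 48 + 5) + 9) + 1"
    by (simp add: sum_list_sum_nth lessThan_atLeast0 sum.distrib)
qed (use S S0 in \<open>auto simp: const_regs_def emitted_def\<close>)

lemma emit_all:
  fixes Ms :: "'a::field mat list"
  assumes ds: "inputs_over F ds Ms" "\<forall>(r, c)\<in>set ds. 0 < r \<and> 0 < c" "0 < n"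
    and S0: "const_regs n (length Ms) q S0" "nmem S0 30 = k"
  shows "runs (init_input t n f Ms) emit_all S0 (70 * instance_size (g_dims ds n) (g_formula (length ds) f))
    (emitted S0 (entries (g_inputs n (tape_X n t) (tape_Y n t) Ms k)))"
proof -
  let ?inp = "init_input t n f Ms"
  let ?L0 = "entries Ms"
  let ?P = "P_mat n :: 'a mat" and ?Q = "Q_mat n :: 'a mat" and ?R = "R_mat n (tape_X n t) (tape_Y n t) k"
  let ?L1 = "?L0 @ concat (mat_to_list ?P)"
  let ?L2 = "?L1 @ concat (mat_to_list ?Q)"
  let ?L3 = "?L2 @ concat (mat_to_list ?R)"
  let ?TI = "(\<Sum>M\<leftarrow>Ms. dim_row M * (dim_col M * 48 + 5) + 9) + 1"
  note c = S0(1)[unfolded const_regs_def]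
  have dims: "dim_row ?P = 3 * n" "dim_col ?P = n" "dim_row ?Q = n" "dim_col ?Q = 3 * n"
    "dim_row ?R = 3 * n" "dim_col ?R = 3 * n"
    by (simp_all add: P_mat_def Q_mat_def R_mat_def)
  have set_dims: "runs ?inp (seqs [Instr (NAdd 5 a 27), Instr (NAdd 6 b 27)]) S 2
      (\<lambda>S'. emitted S0 L S' \<and> nmem S' 5 = nmem S0 a \<and> nmem S' 6 = nmem S0 b \<and> nmem S' 7 = nmem S 7 \<and> nmem S' 11 = nmem S 11)"
    if "emitted S0 L S" "a = 16 \<or> a = 19" "b = 16 \<or> b = 19" for L S a b
    using that c by (intro runs_ev) (auto simp: emitted_def)
  have stage: "runs ?inp (emit_block a b e) S
      (dim_row A * (dim_col A * 48 + 5) + 5) (emitted S0 (L @ concat (mat_to_list A)))"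
    if "emitted S0 L S" "a = 16 \<or> a = 19" "b = 16 \<or> b = 19" "entry_prog ?inp S0 n (length L) A e"
      "nmem S0 a = dim_row A" "nmem S0 b = dim_col A" for L S a b A e
    unfolding emit_block_def
  proof (rule runs_Seq[OF set_dims[OF that(1-3)], where b' = "dim_row A * (dim_col A * 48 + 5) + 3"])
    fix S' assume S': "emitted S0 L S' \<and> nmem S' 5 = nmem S0 a \<and> nmem S' 6 = nmem S0 b \<and> nmem S' 7 = nmem S 7 \<and> nmem S' 11 = nmem S 11"
    have "runs ?inp (emit_mat e) S' (dim_row A * (dim_col A * 48 + 5) + 3)
      (\<lambda>S''. emitted S0 (L @ concat (mat_to_list A)) S'' \<and> nmem S'' 7 = nmem S' 7 \<and> nmem S'' 11 = nmem S' 11)"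
      by (rule emit_mat[OF that(4)]) (use c S' that in auto)
    then show "runs ?inp (emit_mat e) S' (dim_row A * (dim_col A * 48 + 5) + 3) (emitted S0 (L @ concat (mat_to_list A)))"
      by (rule runs_mono) auto
  qed simp
  let ?T2 = "3 * n * (n * 48 + 5) + 5" and ?T3 = "n * (3 * n * 48 + 5) + 5" and ?T4 = "3 * n * (3 * n * 48 + 5) + 5"
  have s0: "runs ?inp (seqs [Instr (NLit 1 0), Instr (NLit 7 0), Instr (NLit 11 3)]) S0 3
      (\<lambda>S. emitted S0 [] S \<and> nmem S 7 = 0 \<and> nmem S 11 = 3)"
    by (rule runs_ev) (auto simp: emitted_def)
  have s1: "runs ?inp emit_inputs S ?TI (emitted S0 ?L0)" if "emitted S0 [] S \<and> nmem S 7 = 0 \<and> nmem S 11 = 3" for S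
    using emit_inputs[OF S0(1)] that by blast
  have s2: "runs ?inp (emit_block 19 16 unit_entry) S ?T2 (emitted S0 ?L1)" if "emitted S0 ?L0 S" for S
    using stage[OF that, of 19 16 ?P unit_entry] c dims unit_entry[of ?P] by (simp add: P_mat_def)
  have s3: "runs ?inp (emit_block 16 19 unit_entry) S ?T3 (emitted S0 ?L2)" if "emitted S0 ?L1 S" for S
    using stage[OF that, of 16 19 ?Q unit_entry] c dims unit_entry[of ?Q] by (simp add: Q_mat_def)
  have s4: "runs ?inp (emit_block 19 19 r_entry) S ?T4 (emitted S0 ?L3)" if "emitted S0 ?L2 S" for S
    using stage[OF that, of 19 19 ?R r_entry] c dims r_entry[of ?inp t S0 n k] S0(2) by (simp add: init_input_def)
  have time: "3 + (?TI + (?T2 + (?T3 + ?T4))) \<le> 70 * instance_size (g_dims ds n) (g_formula (length ds) f)"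
  proof -
    have ds': "ds = map (\<lambda>M. (dim_row M, dim_col M)) Ms" using ds(1) by (simp add: inputs_over_def)
    \<comment> \<open>\<open>62 = 48 + 5 + 9\<close>: as dimensions are positive, both 1 and the
      number of rows are at most the number of entries.\<close>
    have "dim_row M * (dim_col M * 48 + 5) + 9 \<le> 62 * (dim_row M * dim_col M)" if "M \<in> set Ms" for M
    proof -
      have "0 < dim_row M" "0 < dim_col M" using ds(2) that by (auto simp: ds')
      then have "1 \<le> dim_row M * dim_col M" "dim_row M \<le> dim_row M * dim_col M" by (simp_all add: One_nat_def)
      moreover have "dim_row M * (dim_col M * 48 + 5) = 48 * (dim_row M * dim_col M) + 5 * dim_row M"
        by (simp add: algebra_simps)
      ultimately show ?thesis by linarith
    qed
    then have "?TI \<le> (\<Sum>M\<leftarrow>Ms. 62 * (dim_row M * dim_col M)) + 1"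
      by (intro add_mono sum_list_mono) auto
    also have "\<dots> = 62 * (\<Sum>(r, c)\<leftarrow>ds. r * c) + 1"
      by (simp add: ds' sum_list_const_mult comp_def)
    finally have TI: "?TI \<le> 62 * (\<Sum>(r, c)\<leftarrow>ds. r * c) + 1" .
    have "n \<le> n * n" using ds(3) by simp
    moreover have "?T2 + (?T3 + ?T4) = 720 * (n * n) + 35 * n + 15" by (simp add: algebra_simps)
    \<comment> \<open>The \<open>15 * (n * n)\<close> are the entries of \<open>P\<close>,
      \<open>Q\<close> and \<open>R\<close>, namely 3, 3 and 9 times \<open>n * n\<close>.\<close>
    moreover have "instance_size (g_dims ds n) (g_formula (length ds) f) \<ge> 9 + (\<Sum>(r, c)\<leftarrow>ds. r * c) + 15 * (n * n)"
      by (simp add: instance_size_def g_dims_def)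
    ultimately show ?thesis using TI by linarith
  qed
  have "runs ?inp emit_all S0 (3 + (?TI + (?T2 + (?T3 + ?T4)))) (emitted S0 ?L3)"
    unfolding emit_all_def
    by (rule runs_Seq[OF s0 runs_Seq[OF s1 runs_Seq[OF s2 runs_Seq[OF s3 s4]]]]) auto
  then have "runs ?inp emit_all S0 (3 + (?TI + (?T2 + (?T3 + ?T4))))
      (emitted S0 (entries (g_inputs n (tape_X n t) (tape_Y n t) Ms k)))"
    by (simp add: g_inputs_def)
  then show ?thesis by (rule runs_mono) (use time in auto)
qed

section \<open>The simulated algorithm\<close>

lemma alg_run_snocE:
  assumes "alg_run D t N f Ms a b (us @ [u]) s'"
  obtains s x where "alg_run D t N f Ms a b us s" "exec (upd_input t u) (process_upd D) s x s'" "x \<le> b"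
  using assms by (cases rule: alg_run.cases) auto

text \<open>\<open>maintains_g_det\<close> provides a run for each update sequence separately.
  Determinism identifies the memory after a prefix with the one inside a longer run, so a simulated
  state can be extended by one more update.\<close>

lemma alg_run_det: "alg_run D t N f Ms a b us s \<Longrightarrow> alg_run D t N f Ms a b us s' \<Longrightarrow> s' = s"
proof (induction arbitrary: s' rule: alg_run.induct)
  case (alg_run_init x s)
  from alg_run_init.prems obtain y where "exec (init_input t N f Ms) (preprocess D) blank y s'"
    by (cases rule: alg_run.cases) auto
  then show ?case using exec_det alg_run_init.hyps by blast
next
  case (alg_run_upd us s u x s1)
  from alg_run_upd.prems obtain s2 y where "alg_run D t N f Ms a b us s2"
    "exec (upd_input t u) (process_upd D) s2 y s'" by (elim alg_run_snocE)
  then show ?case using alg_run_upd.IH exec_det alg_run_upd.hyps by metis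
qed

lemma length_apply_upd [simp]: "length (apply_upd u Ms) = length Ms"
  by (cases u) auto

lemma inputs_over_apply_upd:
  assumes F: "finite_subfield F" and Ms: "inputs_over F ds Ms" and u: "valid_upd F Ms u"
  shows "inputs_over F ds (apply_upd u Ms)"
proof -
  have clos: "\<And>x y. x \<in> F \<Longrightarrow> y \<in> F \<Longrightarrow> x + y \<in> F" "\<And>x y. x \<in> F \<Longrightarrow> y \<in> F \<Longrightarrow> x * y \<in> F"
    using F by (auto simp: finite_subfield_def)
  have change: "inputs_over F ds (Ms[l := change_mat (Ms ! l) h])"
    if l: "l < length Ms" and h: "\<And>i j a. i < dim_row (Ms ! l) \<Longrightarrow> j < dim_col (Ms ! l) \<Longrightarrow> a \<in> F \<Longrightarrow> h i j a \<in> F" for l h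
  proof -
    have el: "Ms ! l $$ (i, j) \<in> F" if "i < dim_row (Ms ! l)" "j < dim_col (Ms ! l)" for i j
      using Ms l that elements_matI[of "Ms ! l" "dim_row (Ms ! l)" "dim_col (Ms ! l)" i j]
      by (auto simp: inputs_over_def)
    have "elements_mat (change_mat (Ms ! l) h) \<subseteq> F"
    proof
      fix z assume "z \<in> elements_mat (change_mat (Ms ! l) h)"
      then obtain i j where "i < dim_row (Ms ! l)" "j < dim_col (Ms ! l)" "z = h i j (Ms ! l $$ (i, j))"
        by (auto simp: change_mat_def dest!: elements_matD)
      then show "z \<in> F" using h el by auto
    qed
    moreover have "map (\<lambda>M. (dim_row M, dim_col M)) (Ms[l := change_mat (Ms ! l) h]) = map (\<lambda>M. (dim_row M, dim_col M)) Ms"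
      using l by (intro nth_equalityI) (auto simp: nth_list_update change_mat_def)
    moreover have "\<forall>M\<in>set Ms. elements_mat M \<subseteq> F" "map (\<lambda>M. (dim_row M, dim_col M)) Ms = ds"
      using Ms by (auto simp: inputs_over_def)
    ultimately show ?thesis using set_update_subset_insert[of Ms l "change_mat (Ms ! l) h"]
      unfolding inputs_over_def by blast
  qed
  have vs: "vec_index v i \<in> F" if "vec_set v \<subseteq> F" "i < dim_vec v" for v i
    using that by (auto simp: vec_set_def)
  show ?thesis
  proof (cases u)
    case (Rank1_Upd l a b)
    then show ?thesis using u vs by (auto intro!: change clos)
  next
    case (Col_Upd l j v)
    then show ?thesis using u vs by (auto intro!: change)
  next
    case (Row_Upd l i v)
    then show ?thesis using u vs by (auto intro!: change)
  next
    case (Entry_Upd l i j a)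
    then show ?thesis using u by (auto intro!: change)
  qed
qed

lemma f_run_snocE:
  assumes "f_run F K f Ms (us @ [u]) Ms''"
  obtains Ms' where "f_run F K f Ms us Ms'" "valid_upd F Ms' u" "upd_kind u \<in> K"
    "feval (apply_upd u Ms') f \<noteq> None" "Ms'' = apply_upd u Ms'"
  using assms by (cases rule: f_run.cases) auto

lemma f_run_det: "f_run F K f Ms us Ms' \<Longrightarrow> f_run F K f Ms us Ms'' \<Longrightarrow> Ms'' = Ms'"
proof (induction arbitrary: Ms'' rule: f_run.induct)
  case f_run_Nil
  from f_run_Nil.prems show ?case by (cases rule: f_run.cases) auto
next
  case (f_run_snoc us Ms' u)
  from f_run_snoc.prems show ?case by (rule f_run_snocE) (use f_run_snoc.IH in auto)
qed

lemma f_run_take: "f_run F K f Ms us Ms' \<Longrightarrow> i \<le> length us \<Longrightarrow> \<exists>Ms''. f_run F K f Ms (take i us) Ms''"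
proof (induction rule: f_run.induct)
  case f_run_Nil
  then show ?case by (auto intro: f_run.intros)
next
  case (f_run_snoc us Ms' u)
  show ?case
  proof (cases "i \<le> length us")
    case True
    then show ?thesis using f_run_snoc.IH by simp
  next
    case False
    then have "take i (us @ [u]) = us @ [u]" using f_run_snoc.prems by simp
    then show ?thesis using f_run.f_run_snoc[OF f_run_snoc.hyps] by metis
  qed
qed

lemma f_run_inputs_over:
  assumes "finite_subfield F" "inputs_over F ds Ms" "f_run F K f Ms us Ms'"
  shows "inputs_over F ds Ms'"
  using assms(3) by (induction rule: f_run.induct) (auto intro: assms inputs_over_apply_upd)

lemma f_run_feval: "f_run F K f Ms us Ms' \<Longrightarrow> feval Ms' f \<noteq> None"
  by (induction rule: f_run.induct) auto

locale reduction =
  fixes F :: "'a::field set" and Fex :: "nat \<Rightarrow> 'a set" and K :: "update_kind set" and A :: "'a dyn_alg"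
    and I U :: "mformula \<Rightarrow> (nat \<times> nat) list \<Rightarrow> nat"
    and f :: mformula and ds :: "(nat \<times> nat) list" and n :: nat
  assumes F: "finite_subfield F" and ext: "extension_field F (Fex n)"
    and A: "maintains_g_det F Fex K A I U" and f: "matrix_formula ds f n"
begin

definition val :: "'a mat list \<Rightarrow> 'a mat" where
  "val Ms = the (feval Ms f)"

definition admissible :: "'a mat list \<Rightarrow> bool" where
  "admissible Ms \<longleftrightarrow> inputs_over F ds Ms \<and> feval Ms f \<noteq> None"

lemma admissibleD:
  assumes "admissible Ms"
  shows "map (\<lambda>M. (dim_row M, dim_col M)) Ms = ds" "length Ms = length ds" "feval Ms f = Some (val Ms)"
    "val Ms \<in> carrier_mat n n" "elements_mat (val Ms) \<subseteq> F" "set (leaves f) \<subseteq> {..<length Ms}"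
proof -
  show d: "map (\<lambda>M. (dim_row M, dim_col M)) Ms = ds" using assms by (auto simp: admissible_def inputs_over_def)
  then show l: "length Ms = length ds" using length_map by metis
  show v: "feval Ms f = Some (val Ms)" using assms by (auto simp: admissible_def val_def)
  have fd: "fdims ds f = Some (n, n)" using f by (simp add: matrix_formula_def)
  show "val Ms \<in> carrier_mat n n" by (rule feval_carrier[OF d fd v])
  show "elements_mat (val Ms) \<subseteq> F"
    by (rule feval_over[OF F d _ fd v]) (use assms in \<open>auto simp: admissible_def inputs_over_def\<close>)
  show "set (leaves f) \<subseteq> {..<length Ms}" using f l by (simp add: matrix_formula_def)
qed

lemma n_pos: "0 < n"
proof -
  have "0 < r \<and> 0 < c" if "fdims ds h = Some (r, c)" for h r c
    using that
  proof (induction h arbitrary: r c)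
    case (Leaf l)
    then have "l < length ds" "ds ! l = (r, c)" by (auto split: if_splits)
    then have "(r, c) \<in> set ds" by (metis nth_mem)
    then show ?case using f by (auto simp: matrix_formula_def)
  qed (auto split: option.splits if_splits)
  then show ?thesis using f by (auto simp: matrix_formula_def)
qed

lemma admissible_apply_upd:
  "admissible Ms \<Longrightarrow> valid_upd F Ms u \<Longrightarrow> feval (apply_upd u Ms) f \<noteq> None \<Longrightarrow> admissible (apply_upd u Ms)"
  using inputs_over_apply_upd[OF F] by (simp add: admissible_def)

lemma f_run_admissible: "admissible Ms \<Longrightarrow> f_run F K f Ms us Ms' \<Longrightarrow> admissible Ms'"
  using f_run_inputs_over[OF F] f_run_feval by (auto simp: admissible_def)

lemma rank_apply_upd:
  assumes "admissible Ms" "valid_upd F Ms u" "feval (apply_upd u Ms) f \<noteq> None"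
  shows "vec_space.rank n (val (apply_upd u Ms)) \<le> vec_space.rank n (val Ms) + 1"
    "vec_space.rank n (val Ms) \<le> vec_space.rank n (val (apply_upd u Ms)) + 1"
proof -
  note ad = admissibleD[OF assms(1)] and ad' = admissibleD[OF admissible_apply_upd[OF assms]]
  obtain l x y where l: "l < length Ms"
    "apply_upd u Ms = Ms[l := Ms ! l + outer (dim_row (Ms ! l)) (dim_col (Ms ! l)) x y]"
    using apply_upd_outer[OF assms(2)] .
  have "distinct (leaves f)" "fdims ds f = Some (n, n)" using f by (auto simp: matrix_formula_def)
  then obtain x' y' where "val (apply_upd u Ms) = val Ms + outer n n x' y'"
    using feval_add_outer[OF ad(1) l _ _ ad(3) ad'(3)] by blast
  then show "vec_space.rank n (val (apply_upd u Ms)) \<le> vec_space.rank n (val Ms) + 1"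
    "vec_space.rank n (val Ms) \<le> vec_space.rank n (val (apply_upd u Ms)) + 1"
    using rank_add_outer_le[OF ad(4)] rank_le_add_outer[OF ad(4)] by auto
qed

text \<open>The overhead of the rank algorithm fits into a multiple of \<open>U\<close> only if
  \<open>U\<close> is positive. For \<open>X = 1\<close>, \<open>Y = 1 - M\<close> and
  \<open>k = n\<close> the perturbed matrix is the identity, so \<open>A\<close> must actually
  process \<open>u\<close>, and no program runs in 0 steps.\<close>

lemma U_pos:
  assumes Ms: "admissible Ms" "valid_upd F Ms u" "upd_kind u \<in> K" "feval (apply_upd u Ms) f \<noteq> None"
  shows "1 \<le> U f ds"
proof -
  note ad = admissibleD[OF Ms(1)]
  let ?X = "1\<^sub>m n :: 'a mat" and ?Y = "1\<^sub>m n - val Ms"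
  have XY: "?X \<in> carrier_mat n n" "?Y \<in> carrier_mat n n" using ad(4) by (simp_all add: minus_carrier_mat)
  have Ex: "0 \<in> Fex n" "1 \<in> Fex n" "F \<subseteq> Fex n" "\<And>x y. x \<in> Fex n \<Longrightarrow> y \<in> Fex n \<Longrightarrow> x - y \<in> Fex n"
    using ext unfolding extension_field_def finite_subfield_def by (auto simp flip: add_uminus_conv_diff)
  have elX: "elements_mat ?X \<subseteq> Fex n" using Ex by (auto dest!: elements_matD simp: one_mat_def)
  have elY: "elements_mat ?Y \<subseteq> Fex n"
  proof
    fix z assume "z \<in> elements_mat ?Y"
    then obtain i j where ij: "i < n" "j < n" "z = ?X $$ (i, j) - val Ms $$ (i, j)"
      using ad(4) by (auto dest!: elements_matD)
    then have "val Ms $$ (i, j) \<in> F" using ad(5) elements_matI[OF ad(4), of i j] by auto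
    moreover have "?X $$ (i, j) \<in> Fex n" using ij Ex by simp
    ultimately show "z \<in> Fex n" using ij Ex(3,4) by blast
  qed
  have "pert n (val Ms) (col_fun ?X) (row_fun ?Y) n = 1\<^sub>m n"
  proof (rule eq_matI)
    fix i l assume "i < dim_row (1\<^sub>m n :: 'a mat)" "l < dim_col (1\<^sub>m n :: 'a mat)"
    then have il: "i < n" "l < n" by auto
    have "(\<Sum>j<n. ?X $$ (i, j) * ?Y $$ (j, l)) = (\<Sum>j<n. (if i = j then 1 else 0) * ?Y $$ (j, l))"
      using il by (intro sum.cong) (auto simp: one_mat_def)
    also have "\<dots> = ?Y $$ (i, l)" using sum_delta_mult[OF il(1)] .
    finally show "pert n (val Ms) (col_fun ?X) (row_fun ?Y) n $$ (i, l) = 1\<^sub>m n $$ (i, l)"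
      using il ad(4) by (simp add: pert_def col_fun_def row_fun_def)
  qed (simp_all add: pert_def)
  then have nz: "g_det f n ?X ?Y Ms n \<noteq> 0"
    using g_det_eq_0_iff[OF XY le_refl ad(6) ad(3,4)] by simp
  have run: "g_run F K f n ?X ?Y Ms n ([] @ [u]) (apply_upd u Ms) n"
    by (intro g_run.intros) (use nz Ms ad(3) in auto)
  obtain s where "alg_run A (\<lambda>_. 0) (3 * n) (g_formula (length Ms) f) (g_inputs n ?X ?Y Ms n) (I f ds) (U f ds) ([] @ [u]) s"
    using A run f Ms(1) XY elX elY unfolding maintains_g_det_def admissible_def by blast
  then show ?thesis by (rule alg_run_snocE) (use exec_pos in fastforce)
qed

end

locale reduction_run = reduction +
  fixes X Y :: "'a mat" and Ms0 :: "'a mat list"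
  assumes X: "X \<in> carrier_mat n n" "elements_mat X \<subseteq> Fex n" and Y: "Y \<in> carrier_mat n n" "elements_mat Y \<subseteq> Fex n"
    and Ms0: "admissible Ms0"
begin

abbreviation A_alg :: "nat \<Rightarrow> 'a update list \<Rightarrow> 'a state \<Rightarrow> bool" where
  "A_alg k \<equiv> alg_run A (\<lambda>_. 0) (3 * n) (g_formula (length Ms0) f) (g_inputs n X Y Ms0 k) (I f ds) (U f ds)"

abbreviation A_input :: "nat \<Rightarrow> 'a input" where
  "A_input k \<equiv> init_input (\<lambda>_. 0) (3 * n) (g_formula (length Ms0) f) (g_inputs n X Y Ms0 k)"

text \<open>\<open>s\<close> is the memory of \<open>A\<close> after processing some update sequence for \<open>g\<close> that leads to \<open>Ms\<close>, \<open>k\<close>.\<close>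

definition A_state :: "'a state \<Rightarrow> 'a mat list \<Rightarrow> nat \<Rightarrow> bool" where
  "A_state s Ms k \<longleftrightarrow> (\<exists>k0 us. k0 \<le> n \<and> g_run F K f n X Y Ms0 k0 us Ms k \<and>
     A_alg k0 us s)"

abbreviation gdet :: "'a mat list \<Rightarrow> nat \<Rightarrow> 'a" where
  "gdet Ms k \<equiv> g_det f n X Y Ms k"

lemma A_run:
  assumes "k0 \<le> n" "g_run F K f n X Y Ms0 k0 us Ms k"
  obtains s where "A_alg k0 us s"
    "fmem s 0 = gdet Ms k"
  using A[unfolded maintains_g_det_def, THEN conjunct2, THEN spec[of _ f], THEN spec[of _ ds], THEN spec[of _ n],
      THEN spec[of _ X], THEN spec[of _ Y], THEN spec[of _ Ms0], THEN spec[of _ k0], THEN spec[of _ us],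
      THEN spec[of _ Ms], THEN spec[of _ k]] f X Y Ms0 assms that
  unfolding admissible_def by blast

lemma A_state_det:
  assumes "A_state s Ms k"
  shows "fmem s 0 = gdet Ms k"
proof -
  obtain k0 us where k0: "k0 \<le> n" and run: "g_run F K f n X Y Ms0 k0 us Ms k"
    and alg: "A_alg k0 us s"
    using assms by (auto simp: A_state_def)
  show ?thesis by (rule A_run[OF k0 run]) (use alg_run_det[OF alg] in auto)
qed

lemma A_init:
  assumes "k \<le> n"
  obtains x s where "exec (A_input k) (preprocess A) blank x s"
    "x \<le> I f ds" "A_state s Ms0 k"
proof -
  have run: "g_run F K f n X Y Ms0 k [] Ms0 k" using Ms0 by (auto intro: g_run.intros simp: admissible_def)
  then obtain s where s: "A_alg k [] s"
    using A_run[OF assms] by blast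
  then obtain x where "exec (A_input k) (preprocess A) blank x s" "x \<le> I f ds"
    by (cases rule: alg_run.cases) auto
  then show thesis using that s run assms by (auto simp: A_state_def)
qed

lemma A_extend:
  assumes "A_state s Ms k"
    and "\<And>k0 us. g_run F K f n X Y Ms0 k0 us Ms k \<Longrightarrow> g_run F K f n X Y Ms0 k0 (us @ [u]) Ms' k'"
  obtains x s' where "exec (upd_input (\<lambda>_. 0) u) (process_upd A) s x s'" "x \<le> U f ds" "A_state s' Ms' k'"
proof -
  obtain k0 us where k0: "k0 \<le> n" and run: "g_run F K f n X Y Ms0 k0 us Ms k"
    and alg: "A_alg k0 us s"
    using assms(1) by (auto simp: A_state_def)
  obtain s' where s': "A_alg k0 (us @ [u]) s'"
    using A_run[OF k0 assms(2)[OF run]] by blast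
  then obtain s1 x where "A_alg k0 us s1"
    "exec (upd_input (\<lambda>_. 0) u) (process_upd A) s1 x s'" "x \<le> U f ds"
    by (elim alg_run_snocE)
  moreover from this have "s1 = s" using alg_run_det[OF alg] by blast
  ultimately show thesis using that s' k0 assms(2)[OF run] by (auto simp: A_state_def)
qed

lemma A_upd:
  assumes "A_state s Ms k" "gdet Ms k \<noteq> 0" "valid_upd F Ms u" "upd_kind u \<in> K" "feval (apply_upd u Ms) f \<noteq> None"
  obtains x s' where "exec (upd_input (\<lambda>_. 0) u) (process_upd A) s x s'" "x \<le> U f ds" "A_state s' (apply_upd u Ms) k"
  by (rule A_extend[OF assms(1)]) (use assms in \<open>auto intro: g_run.intros\<close>)

lemma A_inc:
  assumes "A_state s Ms k" "gdet Ms k \<noteq> 0" "k < n"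
  obtains x s' where "exec (upd_input (\<lambda>_. 0) (Entry_Upd (length ds + 2) (2 * n + k) (2 * n + k) 1)) (process_upd A) s x s'"
    "x \<le> U f ds" "A_state s' Ms (k + 1)"
  by (rule A_extend[OF assms(1)]) (use assms admissibleD(2)[OF Ms0, symmetric] in \<open>auto intro: g_run.intros\<close>)

lemma A_dec:
  assumes "A_state s Ms (k + 1)" "gdet Ms (k + 1) \<noteq> 0"
  obtains x s' where "exec (upd_input (\<lambda>_. 0) (Entry_Upd (length ds + 2) (2 * n + k) (2 * n + k) 0)) (process_upd A) s x s'"
    "x \<le> U f ds" "A_state s' Ms k"
  by (rule A_extend[OF assms(1)]) (use assms admissibleD(2)[OF Ms0, symmetric] in \<open>auto intro: g_run.intros\<close>)

end

subsection \<open>Tracking the critical value of $k$\<close>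

text \<open>The new value of \<open>k\<close> after an update from \<open>M\<close> to \<open>M'\<close>, where \<open>D k\<close> and \<open>D' k\<close> say that \<open>g\<close> has
  a nonzero determinant for \<open>M\<close> and \<open>M'\<close>; \<open>n + 1\<close> means failure.\<close>

definition next_k :: "nat \<Rightarrow> (nat \<Rightarrow> bool) \<Rightarrow> (nat \<Rightarrow> bool) \<Rightarrow> nat \<Rightarrow> nat" where
  "next_k n D D' k = (if D' k then (if 0 < k \<and> D' (k - 1) then k - 1 else k)
     else if k < n \<and> D (k + 1) \<and> D' (k + 1) then k + 1 else n + 1)"

text \<open>\<open>k'\<close> is minimal for \<open>D'\<close> and differs from \<open>k\<close> by
  at most one. If it is smaller, \<open>D'\<close> holds at \<open>k = k' + 1\<close>, so the test
  at \<open>k - 1\<close> is reached; if equal, that test fails by minimality; if larger,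
  \<open>D\<close> at \<open>k + 1\<close> lets the algorithm raise \<open>k\<close> before the
  update.\<close>

lemma next_k_eq:
  assumes "\<And>j. D' j \<Longrightarrow> k' \<le> j" "D' k'" "k' < n \<Longrightarrow> D' (k' + 1)" "k < n \<Longrightarrow> D (k + 1)"
    and "k \<le> n" "k' \<le> n" "k' \<le> k + 1" "k \<le> k' + 1"
  shows "next_k n D D' k = k'"
proof (cases "D' k")
  case True
  then have "k' \<le> k" using assms(1) by blast
  show ?thesis
  proof (cases "0 < k \<and> D' (k - 1)")
    case True
    then have "k' \<le> k - 1" using assms(1) by blast
    then show ?thesis using \<open>D' k\<close> True assms(8) by (simp add: next_k_def)
  next
    case False
    then have "k' = k" using \<open>k' \<le> k\<close> assms(2,8) by (cases "k' = k") (auto simp: le_Suc_eq One_nat_def)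
    then show ?thesis using \<open>D' k\<close> False by (auto simp: next_k_def)
  qed
next
  case False
  then have "k' \<noteq> k" using assms(2) by auto
  moreover have "k \<noteq> k' + 1" using assms(3,5) False by auto
  ultimately have "k' = k + 1" using assms(7,8) by linarith
  then show ?thesis using False assms(2,4,6) by (simp add: next_k_def)
qed

lemma tape_pert_eq:
  "k \<le> n \<Longrightarrow> pert n M (col_fun (tape_X n t)) (row_fun (tape_Y n t)) k = tape_pert n M t k"
  by (intro eq_matI) (auto simp: pert_def col_fun_def row_fun_def tape_X_def tape_Y_def tape_x_def tape_y_def intro!: sum.cong)

lemma servesD:
  assumes M: "M \<in> carrier_mat n n" and "serves n M t" and D: "\<And>k. k \<le> n \<Longrightarrow> D k \<longleftrightarrow> Determinant.det (tape_pert n M t k) \<noteq> 0"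
  shows "D (n - vec_space.rank n M)" "n - vec_space.rank n M < n \<Longrightarrow> D (n - vec_space.rank n M + 1)"
    "j \<le> n \<Longrightarrow> D j \<Longrightarrow> n - vec_space.rank n M \<le> j"
proof -
  show "D (n - vec_space.rank n M)" "n - vec_space.rank n M < n \<Longrightarrow> D (n - vec_space.rank n M + 1)"
    using assms(2) D by (auto simp: serves_def Let_def One_nat_def)
  show "n - vec_space.rank n M \<le> j" if "j \<le> n" "D j"
    using det_pert_eq_0[OF M, of j "tape_x n t" "tape_y n t"] that D by fastforce
qed

section \<open>The rank algorithm\<close>

definition init_regs :: "'a::field com" where
  "init_regs = seqs [Instr (NLit 27 0), Instr (NLit 35 1), Instr (NLit 28 2), Instr (NLit 29 3),
     Instr (NInput 16 27), Instr (NInput 17 35), Instr (NInput 18 28),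
     Instr (NAdd 34 16 16), Instr (NAdd 19 34 16), Instr (NAdd 20 17 29), Instr (NAdd 21 18 29), Instr (NAdd 21 21 29),
     Instr (NAdd 22 17 17), Instr (NAdd 23 20 35), Instr (NAdd 24 23 35), Instr (NAdd 25 24 35), Instr (NAdd 26 17 28),
     Instr (NAdd 33 16 35), Instr (NAdd 36 22 29), Instr (NLit 30 0), Instr (NAdd 32 33 27), Instr (FLit 17 0)]"

abbreviation skip :: "'a com" where
  "skip \<equiv> Instr (NLit 8 0)"

abbreviation fail :: "'a com" where
  "fail \<equiv> Instr (NAdd 30 33 27)"

abbreviation det_zero :: cond where
  "det_zero \<equiv> FEq (trk 0 0) 17"

text \<open>Success sets the loop bound in register 32 to \<open>k\<close>, which ends the loop and
  leaves \<open>k\<close> in register 30. Otherwise the simulated memory is blank again for the next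
  candidate.\<close>

definition try_k :: "'a::field com \<Rightarrow> 'a com" where
  "try_k c = Seq emit_all (Seq (attempt ni_pre fi_pre c)
     (If det_zero (Seq undo_prog (Instr (NAdd 30 30 35))) (Instr (NAdd 32 30 27))))"

definition rank_pre :: "'a::field com \<Rightarrow> 'a com" where
  "rank_pre c = Seq init_regs (Seq (While (NLess 30 32) (try_k c)) (Instr (NSub 0 16 30)))"

text \<open>The new matrices are regular at \<open>k\<close>, so the rank has not dropped; whether
  it rose is decided by trying \<open>k - 1\<close>, with a rollback if that is too small.\<close>

definition raise_rank :: "'a::field com \<Rightarrow> 'a com" where
  "raise_rank c = If (NLess 27 30)
     (Seq (seqs [Instr (NSub 10 30 35), Instr (NAdd 31 34 10), Instr (FLit 16 0)])
       (Seq (attempt ni_k fi_k c) (If det_zero undo_prog (Instr (NSub 30 30 35)))))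
     skip"

text \<open>The order is forced by \<open>A\<close> being stuck at a zero determinant: the update is
  rolled back, \<open>k\<close> is raised on the old matrices, and the update is replayed. No
  rollback follows a failure, as that state is final.\<close>

definition lower_rank :: "'a::field com \<Rightarrow> 'a com" where
  "lower_rank c = Seq undo_prog (If (NLess 30 16)
     (Seq (seqs [Instr (NAdd 31 34 30), Instr (FLit 16 1)])
       (Seq (attempt ni_k fi_k c) (Seq (Instr (NAdd 30 30 35))
         (If det_zero fail (Seq (attempt ni_upd fi_upd c) (If det_zero fail skip))))))
     fail)"

definition rank_upd :: "'a::field com \<Rightarrow> 'a com" where
  "rank_upd c = Seq
     (If (NLess 30 33) (Seq (attempt ni_upd fi_upd c) (If det_zero (lower_rank c) (raise_rank c))) skip)
     (Instr (NSub 0 16 30))"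

definition rank_alg :: "'a::field dyn_alg \<Rightarrow> 'a dyn_alg" where
  "rank_alg D = \<lparr>preprocess = rank_pre (preprocess D), process_upd = rank_upd (process_upd D)\<rparr>"

lemma set_com_comp: "set_com (comp ni fi c) \<subseteq> set_com c \<union> {0} \<union> set_com ni \<union> set_com fi"
proof (induction c)
  case (Instr i)
  show ?case by (cases i) auto
qed auto

lemma set_com_sel: "set_com (sel rs c) = set_com c"
  by (induction rs) auto

lemma rank_alg_over:
  assumes "alg_over F D" "0 \<in> F" "1 \<in> F"
  shows "alg_over F (rank_alg D)"
proof -
  have att: "set_com (attempt ni fi c) \<subseteq> F" if "set_com ni \<subseteq> F" "set_com fi \<subseteq> F" "set_com c \<subseteq> F" for ni fi c
    using set_com_comp[of ni fi c] that assms(2) by (auto simp: attempt_def)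
  have io: "set_com ni_pre \<subseteq> F" "set_com fi_pre \<subseteq> F" "set_com ni_k \<subseteq> F" "set_com fi_k \<subseteq> F" "set_com ni_upd \<subseteq> F" "set_com fi_upd \<subseteq> F"
    by (simp_all add: ni_pre_def fi_pre_def ni_k_def fi_k_def ni_upd_def fi_upd_def set_com_sel seg_def serve_nil_def)
  have emit: "set_com emit_all \<subseteq> F"
    using assms(2,3) by (auto simp: emit_all_def emit_inputs_def read_dims_def emit_block_def emit_mat_def emit_row_def
        copy_entry_def unit_entry_def r_entry_def)
  have undo: "set_com undo_prog \<subseteq> F" by (simp add: undo_prog_def pop_nat_def pop_field_def)
  have D: "set_com (preprocess D) \<subseteq> F" "set_com (process_upd D) \<subseteq> F" using assms(1) by (auto simp: alg_over_def)
  have "set_com (rank_pre (preprocess D)) \<subseteq> F"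
    using att[OF io(1,2) D(1)] emit undo assms(2) by (simp add: rank_pre_def init_regs_def try_k_def)
  moreover have "set_com (rank_upd (process_upd D)) \<subseteq> F"
    using att[OF io(3,4) D(2)] att[OF io(5,6) D(2)] undo assms(2,3)
    by (simp add: rank_upd_def lower_rank_def raise_rank_def)
  ultimately show ?thesis by (simp add: alg_over_def rank_alg_def)
qed

lemma view_emitted: "emitted S0 L S \<Longrightarrow> view S = view S0"
proof -
  assume "emitted S0 L S"
  moreover have "16 \<le> trk 0 i" "trk 0 i \<noteq> trk 2 i'" for i i' by (simp_all add: trk_def) presburger
  ultimately show ?thesis by (simp add: emitted_def view_def track_def)
qed

lemma view_regs: "r < 64 \<Longrightarrow> view (S\<lparr>nmem := (nmem S)(r := x)\<rparr>) = view S" "r < 64 \<Longrightarrow> view (S\<lparr>fmem := (fmem S)(r := y)\<rparr>) = view S"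
  by (simp_all add: view_def)

locale tape_run = reduction +
  fixes t :: "nat \<Rightarrow> 'a" and Ms0 :: "'a mat list"
  assumes t: "t \<in> set_pmf (random_tape (Fex n) (2 * n\<^sup>2))" and adm0: "admissible Ms0"

sublocale tape_run \<subseteq> reduction_run F Fex K A I U f ds n "tape_X n t" "tape_Y n t" Ms0
proof
  have E: "finite (Fex n)" "Fex n \<noteq> {}"
    using ext by (auto simp: extension_field_def finite_subfield_def)
  have "t i \<in> Fex n" if "i < 2 * n\<^sup>2" for i
    using t that unfolding set_random_tape[OF E] by (auto simp: PiE_dflt_def)
  then show "elements_mat (tape_X n t) \<subseteq> Fex n" "elements_mat (tape_Y n t) \<subseteq> Fex n"
    by (auto simp: tape_X_def tape_Y_def tape_index dest!: elements_matD)
qed (simp_all add: adm0)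

context tape_run
begin

section \<open>Invariants and running time of the rank algorithm\<close>

definition regs_ok :: "'a state \<Rightarrow> bool" where
  "regs_ok S \<longleftrightarrow> const_regs n (length ds) (length (tokens f)) S"

lemma regs_okD:
  assumes "regs_ok S"
  shows "nmem S 16 = n" "nmem S 27 = 0" "nmem S 33 = n + 1" "nmem S 34 = 2 * n" "nmem S 35 = 1" "fmem S 17 = 0"
  using assms by (simp_all add: regs_ok_def const_regs_def)

lemma regs_ok_upd [simp]:
  "r \<in> {0, 8, 10, 30, 31, 32} \<Longrightarrow> regs_ok (S\<lparr>nmem := (nmem S)(r := x)\<rparr>) = regs_ok S"
  "r \<noteq> 17 \<Longrightarrow> regs_ok (S\<lparr>fmem := (fmem S)(r := y)\<rparr>) = regs_ok S"
proof -
  assume "r \<in> {0, 8, 10, 30, 31, 32}"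
  then have "((nmem S)(r := x)) i = nmem S i" if "i \<in> {16..29} \<union> {33..36}" for i
    using that by auto
  then show "regs_ok (S\<lparr>nmem := (nmem S)(r := x)\<rparr>) = regs_ok S"
    by (simp add: regs_ok_def const_regs_def del: fun_upd_apply)
qed (simp add: regs_ok_def const_regs_def)

lemma regs_ok_frame: "frame S' = frame S \<Longrightarrow> regs_ok S \<Longrightarrow> regs_ok S'"
  unfolding regs_ok_def using const_regs_frame by blast

lemma det_zero: "regs_ok S \<Longrightarrow> A_state (view S) Ms k \<Longrightarrow> holds det_zero S \<longleftrightarrow> gdet Ms k = 0"
  using A_state_det[of "view S" Ms k] by (simp add: regs_okD view_sel)

text \<open>\<open>k = n + 1\<close> means failure.\<close>

definition B_state :: "'a state \<Rightarrow> 'a mat list \<Rightarrow> nat \<Rightarrow> bool" where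
  "B_state S Ms k \<longleftrightarrow> regs_ok S \<and> nmem S 30 = k \<and> (k \<le> n \<and> A_state (view S) Ms k \<and> gdet Ms k \<noteq> 0 \<or> k = n + 1)"

abbreviation att_k :: "'a com" where
  "att_k \<equiv> attempt ni_k fi_k (process_upd A)"

abbreviation att_upd :: "'a com" where
  "att_upd \<equiv> attempt ni_upd fi_upd (process_upd A)"

definition after_attempt :: "'a state \<Rightarrow> 'a state \<Rightarrow> nat \<Rightarrow> 'a state \<Rightarrow> bool" where
  "after_attempt S s' b S' \<longleftrightarrow> view S' = s' \<and> undone S' = view S \<and> frame S' = frame S \<and> nmem S' 1 + nmem S' 2 \<le> 2 * b"

text \<open>\<open>126 = 100 + 26\<close>, where 100 bounds every input server. The two logs
  together hold at most \<open>2 * b\<close> entries at 20 steps each, whence the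
  \<open>40 * b\<close> of \<open>run_undo\<close>.\<close>

lemma run_attempt:
  assumes "exec inp c (view S) x s'" "x \<le> b" "rnd inp = (\<lambda>_. 0)" "serves_inputs inp' inp ni fi 100 S"
  shows "runs inp' (attempt ni fi c) S (126 * b + 2) (after_attempt S s' b)"
  by (rule runs_mono[OF attempt[OF assms(1,3,4)]]) (use assms(2) in \<open>auto simp: after_attempt_def\<close>)

lemma run_undo:
  assumes "nmem S 1 + nmem S 2 \<le> 2 * b"
  shows "runs inp undo_prog S (40 * b + 3) (\<lambda>S'. view S' = undone S \<and> frame S' = frame S)"
  by (rule runs_mono[OF undo_prog]) (use assms in auto)

definition g_list :: "nat \<Rightarrow> 'a list" where
  "g_list k = entries (g_inputs n (tape_X n t) (tape_Y n t) Ms0 k)"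

lemma length_g_list: "length (g_list k) = length (g_list 0)"
  by (simp add: g_list_def g_inputs_def R_mat_def)

definition isize :: nat where
  "isize = instance_size (g_dims ds n) (g_formula (length ds) f)"

text \<open>The instances for all \<open>k\<close> have equal length. So each candidate overwrites
  the previous table completely, and the zeros behind it persist, making reads beyond the end agree
  with \<open>nth_default 0\<close>.\<close>

definition loop_inv :: "nat \<Rightarrow> 'a state \<Rightarrow> bool" where
  "loop_inv k S \<longleftrightarrow> regs_ok S \<and> nmem S 30 = k \<and> nmem S 32 = n + 1 \<and> view S = blank \<and>
     (\<forall>i\<ge>length (g_list 0). fmem S (trk 2 i) = 0) \<and> (\<forall>j<k. gdet Ms0 j = 0)"

definition loop_post :: "'a state \<Rightarrow> bool" where
  "loop_post S \<longleftrightarrow> (\<exists>k. B_state S Ms0 k \<and> (\<forall>j<k. gdet Ms0 j = 0))"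

lemma try_k:
  assumes S: "loop_inv k S" and k: "k \<le> n"
  shows "runs (init_input t n f Ms0) (try_k (preprocess A)) S (200 * (I f ds + isize))
    (\<lambda>S'. loop_inv (k + 1) S' \<or> loop_post S' \<and> nmem S' 32 = nmem S' 30)"
proof -
  let ?inp = "init_input t n f Ms0" and ?Q = "\<lambda>S'. loop_inv (k + 1) S' \<or> loop_post S' \<and> nmem S' 32 = nmem S' 30"
  let ?if = "If det_zero (Seq undo_prog (Instr (NAdd 30 30 35))) (Instr (NAdd 32 30 27)) :: 'a com"
  have l: "length Ms0 = length ds" using admissibleD(2)[OF adm0] .
  have S': "regs_ok S" "nmem S 30 = k" "nmem S 32 = n + 1" "view S = blank"
    "\<And>i. i \<ge> length (g_list 0) \<Longrightarrow> fmem S (trk 2 i) = 0" "\<And>j. j < k \<Longrightarrow> gdet Ms0 j = 0"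
    using S by (auto simp: loop_inv_def)
  have em: "runs ?inp emit_all S (70 * isize) (emitted S (g_list k))"
    unfolding isize_def g_list_def
    by (rule emit_all[where F = F and q = "length (tokens f)"])
      (use S' adm0 f n_pos l in \<open>auto simp: admissible_def matrix_formula_def regs_ok_def\<close>)
  obtain x s where x: "exec (A_input k) (preprocess A) blank x s" "x \<le> I f ds" "A_state s Ms0 k"
    using A_init[OF k] by blast
  show ?thesis
    unfolding try_k_def
  proof (rule runs_Seq[OF em, where b' = "166 * I f ds + 7"])
    fix S1 assume S1: "emitted S (g_list k) S1"
    then have eq: "nmem S1 r = nmem S r" if "16 \<le> r" for r using that by (auto simp: emitted_def)
    have feq: "fmem S1 17 = fmem S 17" using S1 by (auto simp: emitted_def)
    have r1: "regs_ok S1" using S'(1) eq feq by (simp add: regs_ok_def const_regs_def)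
    have v1: "view S1 = blank" using view_emitted[OF S1] S'(4) by simp
    have tab: "fmem S1 (trk 2 i) = nth_default 0 (g_list k) i" for i
      using S1 S'(5)[of i] length_g_list[of k] by (auto simp: emitted_def nth_default_def)
    have sv: "serves_inputs ?inp (A_input k) ni_pre fi_pre 100 S1"
      by (rule serves_pre) (use r1 l tab in \<open>auto simp: regs_ok_def g_list_def\<close>)
    have att: "runs ?inp (attempt ni_pre fi_pre (preprocess A)) S1 (126 * I f ds + 2) (after_attempt S1 s (I f ds))"
      by (rule run_attempt[OF _ x(2) _ sv]) (use x(1) v1 in \<open>simp_all add: init_input_def\<close>)
    show "runs ?inp (Seq (attempt ni_pre fi_pre (preprocess A)) ?if) S1 (166 * I f ds + 7) ?Q"
    proof (rule runs_Seq[OF att, where b' = "40 * I f ds + 5"])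
      fix S2 assume S2: "after_attempt S1 s (I f ds) S2"
      then have fr: "frame S2 = frame S1" and v2: "view S2 = s" and u2: "undone S2 = blank"
        and lg: "nmem S2 1 + nmem S2 2 \<le> 2 * I f ds"
        using v1 by (auto simp: after_attempt_def)
      have r2: "regs_ok S2" using regs_ok_frame[OF fr r1] .
      have k2: "nmem S2 30 = k" "nmem S2 32 = n + 1" using frame_reg[OF fr] eq S'(2,3) by auto
      show "runs ?inp ?if S2 (40 * I f ds + 5) ?Q"
      proof (cases "gdet Ms0 k = 0")
        case True
        then have h: "holds det_zero S2" using det_zero[OF r2] v2 x(3) by auto
        have "runs ?inp (Seq undo_prog (Instr (NAdd 30 30 35))) S2 (40 * I f ds + 4) ?Q"
        proof (rule runs_Seq[OF run_undo[OF lg], where b' = 1])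
          fix S3 assume S3: "view S3 = undone S2 \<and> frame S3 = frame S2"
          then have fr3: "frame S3 = frame S1" using fr by simp
          have r3: "regs_ok S3" using regs_ok_frame[OF fr3 r1] .
          have k3: "nmem S3 30 = k" "nmem S3 32 = n + 1" using frame_reg[of S3 S2] S3 k2 by auto
          have "fmem S3 (trk 2 i) = 0" if "i \<ge> length (g_list 0)" for i
            using frame_table[OF fr3, of i] tab[of i] that length_g_list[of k] by (simp add: nth_default_def)
          moreover have "gdet Ms0 j = 0" if "j < k + 1" for j using that True S'(6) by (cases "j = k") auto
          ultimately have "loop_inv (k + 1) (S3\<lparr>nmem := (nmem S3)(30 := nmem S3 30 + nmem S3 35)\<rparr>)"
            using r3 k3 S3 u2 by (auto simp: loop_inv_def regs_okD view_regs)
          then show "runs ?inp (Instr (NAdd 30 30 35)) S3 1 ?Q" by (intro runs_ev) auto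
        qed simp
        then show ?thesis by (rule runs_If_True[OF h]) simp
      next
        case False
        then have h: "\<not> holds det_zero S2" using det_zero[OF r2] v2 x(3) by auto
        let ?S = "S2\<lparr>nmem := (nmem S2)(32 := nmem S2 30 + nmem S2 27)\<rparr>"
        have "B_state ?S Ms0 k" using r2 k2 k v2 x(3) False by (simp add: B_state_def view_regs)
        then have "loop_post ?S" using S'(6) by (auto simp: loop_post_def)
        then have "runs ?inp (Instr (NAdd 32 30 27)) S2 1 ?Q"
          using r2 by (intro runs_ev) (auto simp: regs_okD)
        then show ?thesis by (rule runs_If_False[OF h]) simp
      qed
    qed simp
  qed (simp add: isize_def instance_size_def)
qed

lemma try_loop:
  assumes "loop_inv k S" "k \<le> n + 1"
  shows "runs (init_input t n f Ms0) (While (NLess 30 32) (try_k (preprocess A))) S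
    ((n + 1 - k) * (200 * (I f ds + isize) + 1) + 1) loop_post"
  using assms
proof (induction "n + 1 - k" arbitrary: k S)
  \<comment> \<open>All candidates have failed, and \<open>k = n + 1\<close> is already the failure
    value.\<close>
  case 0
  then have "k = n + 1" by simp
  then have "B_state S Ms0 (n + 1)" "\<forall>j<n + 1. gdet Ms0 j = 0"
    using 0 by (auto simp: loop_inv_def B_state_def)
  then have "loop_post S" by (auto simp: loop_post_def)
  then show ?case using 0 \<open>k = n + 1\<close> by (intro runs_While_False) (auto simp: loop_inv_def)
next
  case (Suc d)
  then have k: "k \<le> n" and d: "d = n + 1 - (k + 1)" and d': "n + 1 - k = Suc d" by auto
  show ?case
  proof (rule runs_While_True[OF _ try_k[OF Suc.prems(1) k], where B' = "d * (200 * (I f ds + isize) + 1) + 1"])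
    show "holds (NLess 30 32) S" using Suc.prems(1) k by (simp add: loop_inv_def)
    fix S' assume "loop_inv (k + 1) S' \<or> loop_post S' \<and> nmem S' 32 = nmem S' 30"
    then show "runs (init_input t n f Ms0) (While (NLess 30 32) (try_k (preprocess A))) S'
        (d * (200 * (I f ds + isize) + 1) + 1) loop_post"
    proof
      assume "loop_inv (k + 1) S'"
      then show ?thesis using Suc.hyps(1)[OF d] k d by simp
    next
      assume "loop_post S' \<and> nmem S' 32 = nmem S' 30"
      then show ?thesis by (intro runs_While_False) auto
    qed
  next
    show "200 * (I f ds + isize) + (d * (200 * (I f ds + isize) + 1) + 1) + 1 \<le> (n + 1 - k) * (200 * (I f ds + isize) + 1) + 1"
      unfolding d' by simp
  qed
qed

lemma rank_pre:
  "runs (init_input t n f Ms0) (rank_pre (preprocess A)) blank (300 * ((n + 1) * (I f ds + isize)))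
    (\<lambda>S. loop_post S \<and> nmem S 0 = n - nmem S 30)"
proof -
  let ?inp = "init_input t n f Ms0"
  have l: "length Ms0 = length ds" using admissibleD(2)[OF adm0] .
  have in3: "nin ?inp 0 = n" "nin ?inp 1 = length ds" "nin ?inp 2 = length (tokens f)"
    using l by (simp_all add: init_input_def nth_default_def One_nat_def numeral_2_eq_2)
  define S1 where "S1 = ev ?inp init_regs blank"
  have "regs_ok S1 \<and> nmem S1 30 = 0 \<and> nmem S1 32 = n + 1"
    using in3 by (simp add: S1_def init_regs_def regs_ok_def const_regs_def)
  moreover have "view S1 = blank" "\<forall>i. fmem S1 (trk 2 i) = 0"
    by (simp_all add: S1_def init_regs_def view_def blank_def track_def)
  ultimately have S1: "loop_inv 0 S1" by (simp add: loop_inv_def)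
  have s: "runs ?inp init_regs blank 22 (\<lambda>S. S = S1)"
    by (rule runs_ev) (auto simp: S1_def init_regs_def)
  show ?thesis
    unfolding rank_pre_def
  proof (rule runs_Seq[OF s, where b' = "(n + 1) * (200 * (I f ds + isize) + 1) + 2"])
    fix S assume "S = S1"
    then have lp: "runs ?inp (While (NLess 30 32) (try_k (preprocess A))) S ((n + 1) * (200 * (I f ds + isize) + 1) + 1) loop_post"
      using try_loop[OF S1] by simp
    show "runs ?inp (Seq (While (NLess 30 32) (try_k (preprocess A))) (Instr (NSub 0 16 30))) S
      ((n + 1) * (200 * (I f ds + isize) + 1) + 2) (\<lambda>S. loop_post S \<and> nmem S 0 = n - nmem S 30)"
    proof (rule runs_Seq[OF lp, where b' = 1])
      fix S2 assume S2: "loop_post S2"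
      then have "nmem S2 16 = n" by (auto simp: loop_post_def B_state_def regs_okD)
      then show "runs ?inp (Instr (NSub 0 16 30)) S2 1 (\<lambda>S. loop_post S \<and> nmem S 0 = n - nmem S 30)"
        using S2 by (intro runs_ev) (auto simp: loop_post_def B_state_def view_regs)
    qed simp
  next
    have "3 \<le> isize" by (simp add: isize_def instance_size_def)
    then have "1 * 3 \<le> (n + 1) * (I f ds + isize)" "(n + 1) * 3 \<le> (n + 1) * (I f ds + isize)"
      by (intro mult_le_mono; simp)+
    moreover have "(n + 1) * (200 * (I f ds + isize) + 1) = 200 * ((n + 1) * (I f ds + isize)) + (n + 1)"
      by (simp add: algebra_simps)
    moreover have "22 + (W + 2) \<le> 300 * Z" if "1 * 3 \<le> Z" "(n + 1) * 3 \<le> Z" "W = 200 * Z + (n + 1)" for W Z :: nat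
      using that by simp
    ultimately show "22 + ((n + 1) * (200 * (I f ds + isize) + 1) + 2) \<le> 300 * ((n + 1) * (I f ds + isize))"
      by blast
  qed
qed

lemma run_attempt_upd:
  assumes "exec (upd_input (\<lambda>_. 0) u) c (view S) x s'" "x \<le> b"
  shows "runs (upd_input t u) (attempt ni_upd fi_upd c) S (126 * b + 2) (after_attempt S s' b)"
  by (rule run_attempt[OF assms _ serves_upd]) (simp add: upd_input_def)

lemma run_attempt_k:
  assumes "exec (upd_input (\<lambda>_. 0) (Entry_Upd (length ds + 2) j j v)) c (view S) x s'" "x \<le> b"
    and "regs_ok S" "nmem S 31 = j" "fmem S 16 = v"
  shows "runs inp (attempt ni_k fi_k c) S (126 * b + 2) (after_attempt S s' b)"
  by (rule run_attempt[OF assms(1,2) _ serves_k[OF assms(3)[unfolded regs_ok_def] assms(4,5)]]) (simp add: upd_input_def)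

lemma after_attemptD:
  assumes "after_attempt S s' b S'" "regs_ok S"
  shows "regs_ok S'" "view S' = s'" "undone S' = view S" "nmem S' 30 = nmem S 30" "nmem S' 1 + nmem S' 2 \<le> 2 * b"
  using assms frame_reg[of S' S 30] regs_ok_frame by (auto simp: after_attempt_def)

lemma run_undo_state:
  assumes "nmem S 1 + nmem S 2 \<le> 2 * b" "regs_ok S"
  shows "runs inp undo_prog S (40 * b + 3) (\<lambda>S'. view S' = undone S \<and> regs_ok S' \<and> nmem S' 30 = nmem S 30)"
proof (rule runs_mono[OF run_undo[OF assms(1)]])
  fix S' assume "view S' = undone S \<and> frame S' = frame S"
  then show "view S' = undone S \<and> regs_ok S' \<and> nmem S' 30 = nmem S 30"
    using assms(2) regs_ok_frame frame_reg(1)[of S' S 30] by auto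
qed simp

lemma run_fail: "regs_ok S \<Longrightarrow> runs inp fail S 1 (\<lambda>S'. B_state S' Ms (n + 1))"
  by (rule runs_ev) (auto simp: B_state_def regs_okD)

lemma run_skip: "B_state S Ms k \<Longrightarrow> runs inp skip S 1 (\<lambda>S'. B_state S' Ms k)"
  by (rule runs_ev) (auto simp: B_state_def view_regs)

lemma raise_rank:
  assumes S: "regs_ok S" "nmem S 30 = k" "A_state (view S) Ms k" "gdet Ms k \<noteq> 0" "k \<le> n"
  shows "runs inp (raise_rank (process_upd A)) S (166 * U f ds + 11)
    (\<lambda>S'. B_state S' Ms (if 0 < k \<and> gdet Ms (k - 1) \<noteq> 0 then k - 1 else k))" (is "runs _ _ _ _ ?Q")
proof (cases "0 < k")
  case False
  then have "runs inp skip S 1 ?Q"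
    using S by (intro runs_mono[OF run_skip[of S Ms k]]) (auto simp: B_state_def)
  then show ?thesis
    unfolding raise_rank_def by (rule runs_If_False[rotated]) (use S False in \<open>auto simp: regs_okD\<close>)
next
  case True
  let ?j = "2 * n + (k - 1)"
  let ?S = "S\<lparr>nmem := (nmem S)(10 := k - 1, 31 := ?j), fmem := (fmem S)(16 := 0)\<rparr>"
  let ?if = "If det_zero undo_prog (Instr (NSub 30 30 35)) :: 'a com"
  have v: "view ?S = view S" by (simp add: view_def)
  have r: "regs_ok ?S" using S(1) by (simp add: regs_ok_def const_regs_def)
  have pos: "k - 1 + 1 = k" using True by simp
  obtain x s' where x: "exec (upd_input (\<lambda>_. 0) (Entry_Upd (length ds + 2) ?j ?j 0)) (process_upd A) (view S) x s'"
    "x \<le> U f ds" "A_state s' Ms (k - 1)"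
    using A_dec[of "view S" Ms "k - 1"] S(3,4) unfolding pos by blast
  have att: "runs inp att_k ?S (126 * U f ds + 2) (after_attempt ?S s' (U f ds))"
    by (rule run_attempt_k[where j = ?j and v = 0]) (use x r v in auto)
  have "runs inp (Seq att_k ?if) ?S (166 * U f ds + 6) ?Q"
  proof (rule runs_Seq[OF att, where b' = "40 * U f ds + 4"])
    fix S1 assume S1: "after_attempt ?S s' (U f ds) S1"
    note a = after_attemptD[OF S1 r]
    have k1: "nmem S1 30 = k" "undone S1 = view S" using a(3,4) v S(2) by simp_all
    show "runs inp ?if S1 (40 * U f ds + 4) ?Q"
    proof (cases "gdet Ms (k - 1) = 0")
      case zero: True
      then have h: "holds det_zero S1" using det_zero[OF a(1), of Ms "k - 1"] x(3) a(2) by simp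
      have "runs inp undo_prog S1 (40 * U f ds + 3) ?Q"
        by (rule runs_mono[OF run_undo_state[OF a(5,1)]]) (use zero k1 S in \<open>auto simp: B_state_def\<close>)
      then show ?thesis by (rule runs_If_True[OF h]) simp
    next
      case nz: False
      then have h: "\<not> holds det_zero S1" using det_zero[OF a(1), of Ms "k - 1"] x(3) a(2) by simp
      have "runs inp (Instr (NSub 30 30 35)) S1 1 ?Q"
        by (rule runs_ev) (use nz k1 a x(3) True S(5) in \<open>auto simp: B_state_def regs_okD view_regs\<close>)
      then show ?thesis by (rule runs_If_False[OF h]) simp
    qed
  qed simp
  moreover have "runs inp (seqs [Instr (NSub 10 30 35), Instr (NAdd 31 34 10), Instr (FLit 16 0)]) S 3 (\<lambda>S'. S' = ?S)"
    by (rule runs_ev) (use S in \<open>auto simp: regs_okD\<close>)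
  ultimately have "runs inp (Seq (seqs [Instr (NSub 10 30 35), Instr (NAdd 31 34 10), Instr (FLit 16 0)])
      (Seq att_k ?if)) S (166 * U f ds + 9) ?Q"
    by (rule runs_Seq_det) simp
  then show ?thesis
    unfolding raise_rank_def by (rule runs_If_True[rotated]) (use S True in \<open>auto simp: regs_okD\<close>)
qed

lemma lower_rank:
  assumes S: "regs_ok S" "nmem S 30 = k" "nmem S 1 + nmem S 2 \<le> 2 * U f ds" "undone S = s"
    and s: "A_state s Ms k" "gdet Ms k \<noteq> 0" "k \<le> n"
    and u: "valid_upd F Ms u" "upd_kind u \<in> K" "feval (apply_upd u Ms) f \<noteq> None"
  shows "runs (upd_input t u) (lower_rank (process_upd A)) S (292 * U f ds + 20)
    (\<lambda>S'. B_state S' (apply_upd u Ms) (if k < n \<and> gdet Ms (k + 1) \<noteq> 0 \<and> gdet (apply_upd u Ms) (k + 1) \<noteq> 0 then k + 1 else n + 1))"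
    (is "runs ?inp _ _ _ ?Q")
proof -
  let ?last = "If det_zero fail skip :: 'a com"
  let ?mid = "If det_zero fail (Seq att_upd ?last)"
  let ?inc = "seqs [Instr (NAdd 31 34 30), Instr (FLit 16 1)] :: 'a com"
  let ?if = "If (NLess 30 16) (Seq ?inc (Seq att_k (Seq (Instr (NAdd 30 30 35)) ?mid))) fail"
  show ?thesis
    unfolding lower_rank_def
  proof (rule runs_Seq[OF run_undo_state[OF S(3,1)], where b' = "252 * U f ds + 17"])
    fix S1 assume "view S1 = undone S \<and> regs_ok S1 \<and> nmem S1 30 = nmem S 30"
    then have S1: "view S1 = s" "regs_ok S1" "nmem S1 30 = k" using S by auto
    show "runs ?inp ?if S1 (252 * U f ds + 17) ?Q"
    proof (cases "k < n")
      case False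
      then have "runs ?inp fail S1 1 ?Q" using run_fail[OF S1(2)] by (auto elim: runs_mono)
      then show ?thesis by (rule runs_If_False[rotated]) (use S1 False in \<open>auto simp: regs_okD\<close>)
    next
      case True
      let ?j = "2 * n + k"
      let ?S = "S1\<lparr>nmem := (nmem S1)(31 := ?j), fmem := (fmem S1)(16 := 1)\<rparr>"
      have v: "view ?S = s" using S1 by (simp add: view_def)
      have r: "regs_ok ?S" using S1(2) by (simp add: regs_ok_def const_regs_def)
      obtain x s1 where x: "exec (upd_input (\<lambda>_. 0) (Entry_Upd (length ds + 2) ?j ?j 1)) (process_upd A) s x s1"
        "x \<le> U f ds" "A_state s1 Ms (k + 1)"
        using A_inc[OF s(1,2) True] by blast
      have att: "runs ?inp att_k ?S (126 * U f ds + 2) (after_attempt ?S s1 (U f ds))"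
        by (rule run_attempt_k[where j = ?j and v = 1]) (use x r v in auto)
      have "runs ?inp (Seq att_k (Seq (Instr (NAdd 30 30 35)) ?mid)) ?S (252 * U f ds + 12) ?Q"
      proof (rule runs_Seq[OF att, where b' = "126 * U f ds + 10"])
        fix S2 assume S2: "after_attempt ?S s1 (U f ds) S2"
        note a = after_attemptD[OF S2 r]
        let ?S2 = "S2\<lparr>nmem := (nmem S2)(30 := k + 1)\<rparr>"
        have k2: "nmem S2 30 = k" using a(4) S1 by simp
        have r2: "regs_ok ?S2" and v2: "view ?S2 = s1" using a by (simp_all add: view_regs)
        have hz: "holds det_zero ?S2 \<longleftrightarrow> gdet Ms (k + 1) = 0" using det_zero[OF r2] v2 x(3) by simp
        have "runs ?inp ?mid ?S2 (126 * U f ds + 9) ?Q"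
        proof (cases "gdet Ms (k + 1) = 0")
          case zero: True
          then have "runs ?inp fail ?S2 1 ?Q" using run_fail[OF r2] by (auto elim: runs_mono)
          then show ?thesis by (rule runs_If_True[rotated]) (use hz zero in auto)
        next
          case nz: False
          obtain y s2 where y: "exec (upd_input (\<lambda>_. 0) u) (process_upd A) s1 y s2" "y \<le> U f ds"
            "A_state s2 (apply_upd u Ms) (k + 1)"
            using A_upd[OF x(3) nz u] by blast
          have att2: "runs ?inp att_upd ?S2 (126 * U f ds + 2) (after_attempt ?S2 s2 (U f ds))"
            by (rule run_attempt_upd) (use y v2 in auto)
          have "runs ?inp (Seq att_upd ?last) ?S2 (126 * U f ds + 6) ?Q"
          proof (rule runs_Seq[OF att2, where b' = 4])
            fix S3 assume S3: "after_attempt ?S2 s2 (U f ds) S3"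
            note a3 = after_attemptD[OF S3 r2]
            have hz3: "holds det_zero S3 \<longleftrightarrow> gdet (apply_upd u Ms) (k + 1) = 0" using det_zero[OF a3(1)] a3(2) y(3) by simp
            show "runs ?inp ?last S3 4 ?Q"
            proof (cases "gdet (apply_upd u Ms) (k + 1) = 0")
              case zero: True
              then have "runs ?inp fail S3 1 ?Q" using run_fail[OF a3(1)] by (auto elim: runs_mono)
              then show ?thesis by (rule runs_If_True[rotated]) (use hz3 zero in auto)
            next
              case nz3: False
              then have "B_state S3 (apply_upd u Ms) (k + 1)"
                using a3 y(3) True by (auto simp: B_state_def)
              then have "runs ?inp skip S3 1 ?Q" using run_skip[of S3 "apply_upd u Ms" "k + 1"] nz nz3 True by simp
              then show ?thesis by (rule runs_If_False[rotated]) (use hz3 nz3 in auto)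
            qed
          qed simp
          then show ?thesis by (rule runs_If_False[rotated]) (use hz nz in auto)
        qed
        moreover have "runs ?inp (Instr (NAdd 30 30 35)) S2 1 (\<lambda>S'. S' = ?S2)"
          by (rule runs_ev) (use a k2 in \<open>auto simp: regs_okD\<close>)
        ultimately show "runs ?inp (Seq (Instr (NAdd 30 30 35)) ?mid) S2 (126 * U f ds + 10) ?Q"
          by (rule runs_Seq_det) simp
      qed simp
      moreover have "runs ?inp ?inc S1 2 (\<lambda>S'. S' = ?S)"
        by (rule runs_ev) (use S1 in \<open>auto simp: regs_okD\<close>)
      ultimately have "runs ?inp (Seq ?inc (Seq att_k (Seq (Instr (NAdd 30 30 35)) ?mid))) S1 (252 * U f ds + 14) ?Q"
        by (rule runs_Seq_det) simp
      then show ?thesis by (rule runs_If_True[rotated]) (use S1 True in \<open>auto simp: regs_okD\<close>)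
    qed
  qed simp
qed

definition step_k :: "'a update \<Rightarrow> 'a mat list \<Rightarrow> nat \<Rightarrow> nat" where
  "step_k u Ms k = (if k \<le> n then next_k n (\<lambda>k. gdet Ms k \<noteq> 0) (\<lambda>k. gdet (apply_upd u Ms) k \<noteq> 0) k else n + 1)"

lemma rank_upd:
  assumes S: "B_state S Ms k" and adm: "admissible Ms"
    and u: "valid_upd F Ms u" "upd_kind u \<in> K" "feval (apply_upd u Ms) f \<noteq> None"
  shows "runs (upd_input t u) (rank_upd (process_upd A)) S (500 * U f ds)
    (\<lambda>S'. B_state S' (apply_upd u Ms) (step_k u Ms k) \<and> nmem S' 0 = n - step_k u Ms k)"
proof -
  let ?inp = "upd_input t u" and ?Ms' = "apply_upd u Ms"
  let ?Q = "\<lambda>S'. B_state S' ?Ms' (step_k u Ms k)"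
  let ?main = "Seq att_upd (If det_zero (lower_rank (process_upd A)) (raise_rank (process_upd A)))"
  \<comment> \<open>Needed at the end to absorb the additive constants:
    \<open>418 * U f ds + 25\<close> is at most \<open>500 * U f ds\<close>.\<close>
  have U: "1 \<le> U f ds" by (rule U_pos[OF adm u])
  have r: "regs_ok S" "nmem S 30 = k" using S by (auto simp: B_state_def)
  have main: "runs ?inp (If (NLess 30 33) ?main skip) S (418 * U f ds + 24) ?Q"
  proof (cases "k \<le> n")
    case False
    then have "k = n + 1" "step_k u Ms k = n + 1" using S by (auto simp: B_state_def step_k_def)
    then have "B_state S ?Ms' (step_k u Ms k)" using r by (simp add: B_state_def)
    then have "runs ?inp skip S 1 ?Q" by (rule run_skip)
    then show ?thesis by (rule runs_If_False[rotated]) (use r False in \<open>auto simp: regs_okD\<close>)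
  next
    case True
    then have A1: "A_state (view S) Ms k" "gdet Ms k \<noteq> 0" using S by (auto simp: B_state_def)
    obtain x s' where x: "exec (upd_input (\<lambda>_. 0) u) (process_upd A) (view S) x s'" "x \<le> U f ds" "A_state s' ?Ms' k"
      using A_upd[OF A1 u] by blast
    have "runs ?inp ?main S (418 * U f ds + 23) ?Q"
    proof (rule runs_Seq[OF run_attempt_upd[OF x(1,2)], where b' = "292 * U f ds + 21"])
      fix S1 assume S1: "after_attempt S s' (U f ds) S1"
      note a = after_attemptD[OF S1 r(1)]
      have k1: "nmem S1 30 = k" using a(4) r(2) by simp
      have hz: "holds det_zero S1 \<longleftrightarrow> gdet ?Ms' k = 0" using det_zero[OF a(1)] a(2) x(3) by simp
      show "runs ?inp (If det_zero (lower_rank (process_upd A)) (raise_rank (process_upd A))) S1 (292 * U f ds + 21) ?Q"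
      proof (cases "gdet ?Ms' k = 0")
        case zero: True
        then have "step_k u Ms k = (if k < n \<and> gdet Ms (k + 1) \<noteq> 0 \<and> gdet ?Ms' (k + 1) \<noteq> 0 then k + 1 else n + 1)"
          using True by (simp add: step_k_def next_k_def)
        then have "runs ?inp (lower_rank (process_upd A)) S1 (292 * U f ds + 20) ?Q"
          using lower_rank[OF a(1) k1 a(5,3) A1 True u] by simp
        then show ?thesis by (rule runs_If_True[rotated]) (use hz zero in auto)
      next
        case nz: False
        then have "step_k u Ms k = (if 0 < k \<and> gdet ?Ms' (k - 1) \<noteq> 0 then k - 1 else k)"
          using True by (simp add: step_k_def next_k_def)
        moreover have "runs ?inp (raise_rank (process_upd A)) S1 (166 * U f ds + 11)
            (\<lambda>S'. B_state S' ?Ms' (if 0 < k \<and> gdet ?Ms' (k - 1) \<noteq> 0 then k - 1 else k))"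
          by (rule raise_rank[OF a(1) k1 _ nz True]) (use a(2) x(3) in simp)
        ultimately have "runs ?inp (raise_rank (process_upd A)) S1 (166 * U f ds + 11) ?Q" by simp
        then show ?thesis by (rule runs_If_False[rotated]) (use hz nz in auto)
      qed
    qed simp
    then show ?thesis by (rule runs_If_True[rotated]) (use r True in \<open>auto simp: regs_okD\<close>)
  qed
  show ?thesis
    unfolding rank_upd_def
  proof (rule runs_Seq[OF main, where b' = 1])
    fix S1 assume "?Q S1"
    then show "runs ?inp (Instr (NSub 0 16 30)) S1 1 (\<lambda>S'. ?Q S' \<and> nmem S' 0 = n - step_k u Ms k)"
      by (intro runs_ev) (auto simp: B_state_def regs_okD view_regs)
  qed (use U in simp)
qed

section \<open>Correctness of the maintained \<open>k\<close> on serving tapes\<close>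

lemma gdet_iff:
  assumes "admissible Ms" "k \<le> n"
  shows "gdet Ms k \<noteq> 0 \<longleftrightarrow> Determinant.det (tape_pert n (val Ms) t k) \<noteq> 0"
  using g_det_eq_0_iff[OF tape_XY_carrier(1) tape_XY_carrier(2) assms(2) admissibleD(6,3,4)[OF assms(1)]] tape_pert_eq[OF assms(2)]
  by metis

lemmas gdet_serves = servesD[OF admissibleD(4) _ gdet_iff]

lemma loop_post_k:
  assumes "B_state S Ms0 k" "\<forall>j<k. gdet Ms0 j = 0" "serves n (val Ms0) t"
  shows "k = n - vec_space.rank n (val Ms0)"
proof -
  note sv = gdet_serves[OF adm0 assms(3) adm0]
  have "k \<le> n - vec_space.rank n (val Ms0)" using assms(2) sv(1) by (meson linorder_not_less)
  moreover from this have "gdet Ms0 k \<noteq> 0" "k \<le> n" using assms(1) by (auto simp: B_state_def)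
  ultimately show ?thesis using sv(3) by (metis le_antisym)
qed

lemma step_k_rank:
  assumes "admissible Ms" "serves n (val Ms) t" "serves n (val (apply_upd u Ms)) t"
    and u: "valid_upd F Ms u" "feval (apply_upd u Ms) f \<noteq> None"
  shows "step_k u Ms (n - vec_space.rank n (val Ms)) = n - vec_space.rank n (val (apply_upd u Ms))"
proof -
  let ?Ms' = "apply_upd u Ms"
  let ?k = "n - vec_space.rank n (val Ms)" and ?k' = "n - vec_space.rank n (val ?Ms')"
  have adm': "admissible ?Ms'" by (rule admissible_apply_upd[OF assms(1) u])
  note sv = gdet_serves[OF assms(1,2,1)] and sv' = gdet_serves[OF adm' assms(3) adm']
  have "next_k n (\<lambda>k. gdet Ms k \<noteq> 0) (\<lambda>k. gdet ?Ms' k \<noteq> 0) ?k = ?k'"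
  proof (rule next_k_eq)
    show "?k' \<le> j" if "gdet ?Ms' j \<noteq> 0" for j
    proof (cases "j \<le> n")
      case True
      then show ?thesis using sv'(3) that by blast
    qed simp
    show "?k' \<le> ?k + 1" "?k \<le> ?k' + 1"
      using rank_apply_upd[OF assms(1) u] by linarith+
  qed (use sv sv' in auto)
  then show ?thesis by (simp add: step_k_def)
qed

text \<open>One induction gives both claims of \<open>maintains_rank\<close>: the run and its time
  bounds exist for every tape in the support, whereas the value of \<open>k\<close> is claimed only
  if the tape serves all matrices met so far.\<close>

lemma alg_run_rank:
  assumes "f_run F K f Ms0 us Ms"
  shows "\<exists>s k. alg_run (rank_alg A) t n f Ms0 (500 * ((n + 1) * (I f ds + isize))) (500 * U f ds) us s \<and>
    B_state s Ms k \<and> nmem s 0 = n - k \<and>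
    ((\<forall>i\<le>length us. \<forall>Ms'. f_run F K f Ms0 (take i us) Ms' \<longrightarrow> serves n (val Ms') t) \<longrightarrow>
      k = n - vec_space.rank n (val Ms))"
  using assms
proof (induction rule: f_run.induct)
  case f_run_Nil
  obtain x s where x: "exec (init_input t n f Ms0) (rank_pre (preprocess A)) blank x s"
    "x \<le> 300 * ((n + 1) * (I f ds + isize))" "loop_post s" "nmem s 0 = n - nmem s 30"
    using rank_pre unfolding runs_def by blast
  then obtain k where k: "B_state s Ms0 k" "\<forall>j<k. gdet Ms0 j = 0" by (auto simp: loop_post_def)
  have "alg_run (rank_alg A) t n f Ms0 (500 * ((n + 1) * (I f ds + isize))) (500 * U f ds) [] s"
    using x(1,2) by (intro alg_run_init[of t n f Ms0 "rank_alg A" x s]) (auto simp: rank_alg_def)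
  moreover have "f_run F K f Ms0 [] Ms0" using f_run_Nil by (rule f_run.f_run_Nil)
  then have "(\<forall>i\<le>length []. \<forall>Ms'. f_run F K f Ms0 (take i []) Ms' \<longrightarrow> serves n (val Ms') t) \<longrightarrow>
      k = n - vec_space.rank n (val Ms0)"
    using loop_post_k[OF k] by auto
  moreover have "nmem s 30 = k" using k(1) by (simp add: B_state_def)
  ultimately show ?case using x(4) k(1) by (intro exI[of _ s] exI[of _ k]) simp
next
  case (f_run_snoc us Ms u)
  obtain s k where s: "alg_run (rank_alg A) t n f Ms0 (500 * ((n + 1) * (I f ds + isize))) (500 * U f ds) us s"
    "B_state s Ms k" "(\<forall>i\<le>length us. \<forall>Ms'. f_run F K f Ms0 (take i us) Ms' \<longrightarrow> serves n (val Ms') t) \<longrightarrow>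
      k = n - vec_space.rank n (val Ms)"
    using f_run_snoc.IH by blast
  have adm: "admissible Ms" by (rule f_run_admissible[OF adm0 f_run_snoc.hyps(1)])
  obtain x s' where x: "exec (upd_input t u) (rank_upd (process_upd A)) s x s'" "x \<le> 500 * U f ds"
    "B_state s' (apply_upd u Ms) (step_k u Ms k)" "nmem s' 0 = n - step_k u Ms k"
    using rank_upd[OF s(2) adm f_run_snoc.hyps(2-4)] unfolding runs_def by blast
  have "alg_run (rank_alg A) t n f Ms0 (500 * ((n + 1) * (I f ds + isize))) (500 * U f ds) (us @ [u]) s'"
    using s(1) by (rule alg_run_upd) (use x in \<open>auto simp: rank_alg_def\<close>)
  moreover have "step_k u Ms k = n - vec_space.rank n (val (apply_upd u Ms))"
    if all: "\<forall>i\<le>length (us @ [u]). \<forall>Ms'. f_run F K f Ms0 (take i (us @ [u])) Ms' \<longrightarrow> serves n (val Ms') t"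
  proof -
    have sv: "serves n (val Ms') t" if "i \<le> length us" "f_run F K f Ms0 (take i us) Ms'" for i Ms'
      using all[rule_format, of i Ms'] that by simp
    then have k: "k = n - vec_space.rank n (val Ms)" using s(3) by blast
    have "serves n (val Ms) t" using sv[of "length us" Ms] f_run_snoc.hyps(1) by simp
    moreover have "serves n (val (apply_upd u Ms)) t"
      using all[rule_format, of "length (us @ [u])" "apply_upd u Ms"] f_run.f_run_snoc[OF f_run_snoc.hyps] by simp
    ultimately show ?thesis unfolding k by (rule step_k_rank[OF adm _ _ f_run_snoc.hyps(2,4)])
  qed
  ultimately show ?case using x(3,4) by blast
qed

end

section \<open>Error probability and conclusion\<close>

lemma f_run_start: "f_run F K f Ms us Ms' \<Longrightarrow> feval Ms f \<noteq> None"
  by (induction rule: f_run.induct) auto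

context reduction
begin

text \<open>By \<open>f_run_det\<close> each of the \<open>length us + 1\<close> prefixes leads to a
  single matrix, fixed independently of the tape; each is not served with probability at most
  \<open>2 n\<close> divided by the size of the field.\<close>

lemma prob_outputs_correct:
  assumes Ms: "admissible Ms" and run: "f_run F K f Ms us Ms'"
    and correct: "\<And>t. t \<in> set_pmf (random_tape (Fex n) (2 * n\<^sup>2)) \<Longrightarrow>
      \<forall>i\<le>length us. \<forall>Ms'. f_run F K f Ms (take i us) Ms' \<longrightarrow> serves n (val Ms') t \<Longrightarrow> t \<in> G"
  shows "measure_pmf.prob (random_tape (Fex n) (2 * n\<^sup>2)) G \<ge>
    1 - 2 * real n * (real (length us) + 1) / real (card (Fex n))"
proof -
  let ?p = "random_tape (Fex n) (2 * n\<^sup>2)" and ?q = "real (card (Fex n))"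
  have E: "finite (Fex n)" "Fex n \<noteq> {}"
    using ext by (auto simp: extension_field_def finite_subfield_def)
  define M where "M i = (SOME Ms'. f_run F K f Ms (take i us) Ms')" for i
  have M: "f_run F K f Ms (take i us) (M i)" if "i \<le> length us" for i
    unfolding M_def by (rule someI_ex) (rule f_run_take[OF run that])
  define Bad where "Bad i = {t. \<not> serves n (val (M i)) t}" for i
  have bad: "measure_pmf.prob ?p (Bad i) \<le> 2 * real n / ?q" if "i \<le> length us" for i
    unfolding Bad_def by (rule prob_not_serves[OF E admissibleD(4)[OF f_run_admissible[OF Ms M[OF that]]]])
  have "- G \<inter> set_pmf ?p \<subseteq> (\<Union>i\<le>length us. Bad i)"
  proof
    fix t assume t: "t \<in> - G \<inter> set_pmf ?p"
    then obtain i Ms'' where "i \<le> length us" "f_run F K f Ms (take i us) Ms''" "\<not> serves n (val Ms'') t"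
      using correct[of t] by blast
    then show "t \<in> (\<Union>i\<le>length us. Bad i)" using f_run_det[OF M] by (auto simp: Bad_def)
  qed
  \<comment> \<open>The complement of \<open>G\<close> is cut down to the support because
    \<open>correct\<close> speaks only about tapes in it.\<close>
  then have "measure_pmf.prob ?p (- G \<inter> set_pmf ?p) \<le> measure_pmf.prob ?p (\<Union>i\<le>length us. Bad i)"
    by (intro measure_pmf.finite_measure_mono) auto
  also have "\<dots> \<le> (\<Sum>i\<le>length us. measure_pmf.prob ?p (Bad i))"
    by (rule measure_pmf.finite_measure_subadditive_finite) auto
  also have "\<dots> \<le> (\<Sum>i\<le>length us. 2 * real n / ?q)" by (intro sum_mono bad) simp
  also have "\<dots> = 2 * real n * (real (length us) + 1) / ?q" by (simp add: algebra_simps)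
  finally have "measure_pmf.prob ?p (- G) \<le> 2 * real n * (real (length us) + 1) / ?q"
    by (simp add: measure_Int_set_pmf)
  moreover have "measure_pmf.prob ?p (- G) = 1 - measure_pmf.prob ?p G"
    using measure_pmf.prob_compl[of G ?p] by (simp add: Compl_eq_Diff_UNIV)
  ultimately show ?thesis by linarith
qed

end

theorem theorem5p3:
  fixes F :: "'a::field set" and Fex :: "nat \<Rightarrow> 'a set"
    and K :: "update_kind set" and \<A> :: "'a dyn_alg"
    and I U :: "mformula \<Rightarrow> (nat \<times> nat) list \<Rightarrow> nat"
  assumes "finite_subfield F"
    and "\<And>n. extension_field F (Fex n)"
    and "maintains_g_det F Fex K \<A> I U"
  shows "\<exists>(\<B> :: 'a dyn_alg) C.
    maintains_rank F Fex K \<B> (\<lambda>f ds. C * rank_preprocessing_time I f ds) (\<lambda>f ds. C * U f ds)"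
proof (intro exI)
  show "maintains_rank F Fex K (rank_alg \<A>) (\<lambda>f ds. 500 * rank_preprocessing_time I f ds) (\<lambda>f ds. 500 * U f ds)"
    unfolding maintains_rank_def
  proof (intro conjI allI impI; (elim conjE)?)
    show "alg_over F (rank_alg \<A>)"
      by (rule rank_alg_over) (use assms in \<open>auto simp: maintains_g_det_def finite_subfield_def\<close>)
    fix f ds n Ms us Ms'
    assume f: "matrix_formula ds f n" and Ms: "inputs_over F ds Ms" and run: "f_run F K f Ms us Ms'"
    interpret reduction F Fex K \<A> I U f ds n
      by unfold_locales (use assms f in auto)
    have adm: "admissible Ms" using Ms f_run_start[OF run] by (simp add: admissible_def)
    have tape: "tape_run F Fex K \<A> I U f ds n t Ms" if "t \<in> set_pmf (random_tape (Fex n) (2 * n\<^sup>2))" for t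
      by unfold_locales (use that adm in auto)
    have time: "rank_preprocessing_time I f ds = (n + 1) * (I f ds + tape_run.isize f ds n)"
      if "t \<in> set_pmf (random_tape (Fex n) (2 * n\<^sup>2))" for t
      using f by (simp add: rank_preprocessing_time_def matrix_formula_def tape_run.isize_def[OF tape[OF that]])
    let ?a = "500 * rank_preprocessing_time I f ds" and ?b = "500 * U f ds"
    show "\<forall>t\<in>set_pmf (random_tape (Fex n) (2 * n\<^sup>2)). \<exists>s. alg_run (rank_alg \<A>) t n f Ms ?a ?b us s"
      using tape_run.alg_run_rank[OF tape run] time by metis
    show "measure_pmf.prob (random_tape (Fex n) (2 * n\<^sup>2)) {t. outputs_correct F K (rank_alg \<A>) ?a ?b t n f Ms us}
        \<ge> 1 - 2 * real n * (real (length us) + 1) / real (card (Fex n))"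
    proof (rule prob_outputs_correct[OF adm run], rule CollectI)
      fix t assume t: "t \<in> set_pmf (random_tape (Fex n) (2 * n\<^sup>2))"
        and sv: "\<forall>i\<le>length us. \<forall>Ms'. f_run F K f Ms (take i us) Ms' \<longrightarrow> serves n (val Ms') t"
      show "outputs_correct F K (rank_alg \<A>) ?a ?b t n f Ms us"
        unfolding outputs_correct_def
      proof (intro allI impI)
        fix i Mi assume i: "i \<le> length us" and run_i: "f_run F K f Ms (take i us) Mi"
        \<comment> \<open>The run is considered up to step \<open>i\<close> only; the prefixes of
          \<open>take i us\<close> are prefixes of \<open>us\<close>, so the tape serves them
          too.\<close>
        have "serves n (val Mj) t" if "j \<le> length (take i us)" "f_run F K f Ms (take j (take i us)) Mj" for j Mj
          using sv[rule_format, of j Mj] that i by (simp add: min_absorb1)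
        then obtain s k where s: "alg_run (rank_alg \<A>) t n f Ms ?a ?b (take i us) s" "nmem s 0 = n - k"
          "k = n - vec_space.rank n (val Mi)"
          using tape_run.alg_run_rank[OF tape[OF t] run_i] unfolding time[OF t] by blast
        \<comment> \<open>Ensures that the truncated subtraction \<open>n - (n - rank)\<close>
          returns the rank.\<close>
        moreover have "vec_space.rank n (val Mi) \<le> n"
          using vec_space.rank_le_nc[OF admissibleD(4)[OF f_run_admissible[OF adm run_i]]] .
        ultimately show "\<exists>s. alg_run (rank_alg \<A>) t n f Ms ?a ?b (take i us) s \<and>
            nmem s 0 = vec_space.rank n (the (feval Mi f))"
          by (auto simp: val_def)
      qed
    qed
  qed
qed

end
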